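(* Consider the MTLS problem with the data, standing assumptions and notation given in the context, assume that one of the genericity conditions (G1) or (G2) of the context holds, and let $x=x_{\rm M}$ be the MTLS solution, $r=Ax-b$, $P=A^TA-\tilde\sigma_{n_2+1}^2W$, $H_0=I_m-\frac{2rr^T}{\|r\|_2^2}$, $\gamma=1+\|x\|_2^2$, $\bar\gamma=1+x^TWx$. Let $$K=-P^{-1}\Big(A^TH_0\,([x^T,-1]\otimes I_m)+[\,I_n\otimes r^T,\ O_{n\times m}\,]\Big).$$ Then the absolute condition number $\kappa=\|K\|_2$ of the MTLS solution $x$ has the following equivalent forms, $\kappa=\kappa_1=\kappa_2=\kappa_3=\kappa_4$: $$\kappa_1=\big\|P^{-1}\big(\gamma A^TA-A^Trx^T-xr^TA+\|r\|_2^2I_n\big)P^{-1}\big\|_2^{1/2},$$ $$\kappa_2=\gamma^{1/2}\Big\|P^{-1}\Big(A^TA+\gamma^{-1}\tilde\sigma_{n_2+1}^2\bar\gamma\Big(I_n-\frac{Wxx^T+xx^TW}{\bar\gamma}\Big)\Big)P^{-1}\Big\|_2^{1/2},$$ $$\kappa_3=\Big\|P^{-1}\Big[A^T,\ \ \|x\|_2A^T-\|x\|_2\tilde\sigma_{n_2+1}^2\frac{Wxr^T}{\|r\|_2^2},\ \ \|r\|_2I_n-\tilde\sigma_{n_2+1}^2\frac{Wxx^T}{\|r\|_2}\Big]\Big\|_2,$$ $$\kappa_4=\Big\|P^{-1}\Big[(1+\beta)A^T-\beta\tilde\sigma_{n_2+1}^2\frac{Wxr^T}{\|r\|_2^2},\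 \ \|r\|_2I_n-\tilde\sigma_{n_2+1}^2\frac{Wxx^T}{\|r\|_2}\Big]\Big\|_2,$$ where $\beta=-1\pm\sqrt{1+\|x\|_2^2}$ (either sign).
   Context: Data and standing assumptions: $A\in\mathbb{R}^{m\times n}$, $m\ge n$, has full column rank, $b\in\mathbb{R}^m$, and $Ax=b$ is not consistent. $A=[A_1,A_2]$ with $A_1\in\mathbb{R}^{m\times n_1}$ (columns known exactly), $A_2\in\mathbb{R}^{m\times n_2}$, $n_1+n_2=n$; vectors $x=[x_1^T,x_2^T]^T$ are partitioned conformally. The MTLS problem is $\min_{E_2,f}\|[E_2,f]\|_F$ subject to $A_1x_1+(A_2+E_2)x_2=b+f$. An MTLS solution is a vector $x\in\mathbb{R}^n$ satisfying the constraint for some $(E_2,f)$ attaining the minimum over all triples $(E_2,f,x)$ satisfying the constraint; it is denoted $x_{\rm M}$ when unique. QR factorization: for an orthogonal $Q\in\mathbb{R}^{m\times m}$, $Q^T[A_1,A_2,b]=\begin{bmatrix}R_{11}&R_{12}&R_{1b}\\0&R_{22}&R_{2b}\end{bmatrix}$, upper triangular, with row blocks of sizes $n_1$, $m-n_1$ and column blocks of sizes $n_1,n_2,1$. Put $W=\mathrm{diag}(O_{n_1},I_{n_2})$, $\tilde W=\mathrm{diag}(W,1)$, $\tilde A=[A,b]$, and $\tilde\sigma_{n_2+1}=\sigma_{n_2+1}([R_{22},R_{2b}])$. Genericity conditions: (G1) $\sigma_{n_2}(R_{22})>\sigma_{n_2+1}([R_{22},R_{2b}])>0$; (G2) $\lambda_n(A^TA,W)>\lambda_{n+1}(\tilde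 A^T\tilde A,\tilde W)$. Here $\sigma_i$ is the $i$-th largest singular value (if $n_2=0$, read $\sigma_0=+\infty$), and $\lambda_i(M,N)$ is the $i$-th largest generalized eigenvalue of the pair $(M,N)$, infinite eigenvalues (arising when $N$ is singular) being counted first. One has $\tilde\sigma_{n_2+1}^2=\lambda_{n+1}(\tilde A^T\tilde A,\tilde W)$, and under (G1) or (G2) the MTLS solution is unique and given by $x_{\rm M}=(A^TA-\tilde\sigma_{n_2+1}^2W)^{-1}A^Tb$. Notation: $\otimes$ is the Kronecker product, $A\otimes B=[a_{ij}B]$; $O_{p\times q}$ is the zero matrix; $\|\cdot\|_2$ of a matrix is the spectral norm. $K$ is the matrix of the Fréchet derivative of $[A,b]\mapsto x_{\rm M}$ with respect to $\mathrm{vec}([A,b])$. *)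

theory Defs
  imports
    "Jordan_Normal_Form.Char_Poly"
    "Jordan_Normal_Form.DL_Rank"
    "Jordan_Normal_Form.Gauss_Jordan_Elimination"
    "HOL-Library.Extended_Real"
begin

text \<open>Carrier-based matrices are used throughout, since the column blocks may be empty.\<close>

definition append_cols :: "'a::zero mat \<Rightarrow> 'a mat \<Rightarrow> 'a mat" (infixr \<open>@\<^sub>c\<close> 65) where
  "A @\<^sub>c B = four_block_mat A B (0\<^sub>m 0 (dim_col A)) (0\<^sub>m 0 (dim_col B))"

definition col_mat :: "'a vec \<Rightarrow> 'a mat" where
  "col_mat v = mat_of_cols (dim_vec v) [v]"

definition outer_prod :: "real vec \<Rightarrow> real vec \<Rightarrow> real mat" where
  "outer_prod u v = mat (dim_vec u) (dim_vec v) (\<lambda>(i, j). u $ i * v $ j)"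

definition kronecker :: "real mat \<Rightarrow> real mat \<Rightarrow> real mat" (infixl \<open>\<otimes>\<^sub>K\<close> 70) where
  "A \<otimes>\<^sub>K B = mat (dim_row A * dim_row B) (dim_col A * dim_col B)
     (\<lambda>(i, j). A $$ (i div dim_row B, j div dim_col B) * B $$ (i mod dim_row B, j mod dim_col B))"

text \<open>Columns are stacked from left to right.\<close>
definition vectorize :: "'a mat \<Rightarrow> 'a vec" where
  "vectorize M = vec (dim_row M * dim_col M) (\<lambda>k. M $$ (k mod dim_row M, k div dim_row M))"

text \<open>This is \<open>the None\<close>, hence unspecified, if the matrix is singular.\<close>
definition mat_inv :: "real mat \<Rightarrow> real mat" where
  "mat_inv M = the (mat_inverse M)"

definition vnorm :: "real vec \<Rightarrow> real" where
  "vnorm v = sqrt (v \<bullet> v)"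

definition frobenius_norm :: "real mat \<Rightarrow> real" where
  "frobenius_norm M = sqrt (\<Sum>i<dim_row M. \<Sum>j<dim_col M. (M $$ (i, j))\<^sup>2)"

text \<open>The unit ball rather than the unit sphere, so that the supremum is taken over a nonempty
  set even for matrices without columns.\<close>
definition spectral_norm :: "real mat \<Rightarrow> real" where
  "spectral_norm M = Sup {vnorm (M *\<^sub>v v) | v. v \<in> carrier_vec (dim_col M) \<and> vnorm v \<le> 1}"

text \<open>Roots with multiplicity, in decreasing order.\<close>
definition roots_desc :: "real poly \<Rightarrow> real list" where
  "roots_desc p = rev (sorted_list_of_multiset (proots p))"

text \<open>Both \<open>sing_val\<close> and \<open>gen_eigval\<close> are counted from \<open>1\<close>. A matrix with more columns than
  rows gets additional zero singular values.\<close>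
definition sing_val :: "nat \<Rightarrow> real mat \<Rightarrow> real" where
  "sing_val i M = map sqrt (roots_desc (char_poly (M\<^sup>T * M))) ! (i - 1)"

definition pencil_poly :: "real mat \<Rightarrow> real mat \<Rightarrow> real poly" where
  "pencil_poly M N = det (map_mat (\<lambda>a. [:0, a:]) N - map_mat (\<lambda>a. [:a:]) M)"

text \<open>For a regular pencil, the finite generalized eigenvalues are the roots of
  \<open>det (\<lambda> N - M)\<close>, and the multiplicity of the eigenvalue \<open>\<infinity>\<close> is the defect of the
  degree of this polynomial.\<close>
definition gen_eigval :: "nat \<Rightarrow> real mat \<Rightarrow> real mat \<Rightarrow> ereal" where
  "gen_eigval i M N =
     (replicate (dim_row M - degree (pencil_poly M N)) \<infinity> @
      map ereal (roots_desc (pencil_poly M N))) ! (i - 1)"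

definition mtls_feasible ::
  "real mat \<Rightarrow> real mat \<Rightarrow> real vec \<Rightarrow> real mat \<Rightarrow> real vec \<Rightarrow> real vec \<Rightarrow> bool" where
  "mtls_feasible A1 A2 b E2 f x \<longleftrightarrow>
     E2 \<in> carrier_mat (dim_row A2) (dim_col A2) \<and> f \<in> carrier_vec (dim_row A2) \<and>
     x \<in> carrier_vec (dim_col A1 + dim_col A2) \<and>
     A1 *\<^sub>v vec_first x (dim_col A1) + (A2 + E2) *\<^sub>v vec_last x (dim_col A2) = b + f"

definition mtls_solution :: "real mat \<Rightarrow> real mat \<Rightarrow> real vec \<Rightarrow> real vec \<Rightarrow> bool" where
  "mtls_solution A1 A2 b x \<longleftrightarrow>
     (\<exists>E2 f. mtls_feasible A1 A2 b E2 f x \<and>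
        (\<forall>E2' f' x'. mtls_feasible A1 A2 b E2' f' x' \<longrightarrow>
           frobenius_norm (E2 @\<^sub>c col_mat f) \<le> frobenius_norm (E2' @\<^sub>c col_mat f')))"

text \<open>\<open>mtls_frechet A1 A2 b K\<close>: the MTLS solution is unique for all data near \<open>[A1, A2, b]\<close>, and
  \<open>K\<close> is the matrix of the Frechet derivative at this point of the solution map, with respect to
  \<open>vec [A1, A2, b]\<close>. Taking zero perturbations shows uniqueness at the point itself.\<close>
definition mtls_frechet :: "real mat \<Rightarrow> real mat \<Rightarrow> real vec \<Rightarrow> real mat \<Rightarrow> bool" where
  "mtls_frechet A1 A2 b K \<longleftrightarrow>
     (let m = dim_vec b; n1 = dim_col A1; n2 = dim_col A2 in
      K \<in> carrier_mat (n1 + n2) (m * (n1 + n2 + 1)) \<and>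
      (\<forall>\<epsilon>>0. \<exists>\<delta>>0. \<forall>D1 \<in> carrier_mat m n1. \<forall>D2 \<in> carrier_mat m n2. \<forall>d \<in> carrier_vec m.
         let D = D1 @\<^sub>c D2 @\<^sub>c col_mat d in
         frobenius_norm D < \<delta> \<longrightarrow>
         (\<exists>!y. mtls_solution (A1 + D1) (A2 + D2) (b + d) y) \<and>
         vnorm ((THE y. mtls_solution (A1 + D1) (A2 + D2) (b + d) y)
                 - (THE x. mtls_solution A1 A2 b x) - K *\<^sub>v vectorize D)
           \<le> \<epsilon> * frobenius_norm D))"

definition mtls_G1 :: "nat \<Rightarrow> real mat \<Rightarrow> real vec \<Rightarrow> bool" where
  "mtls_G1 n2 R22 R2b \<longleftrightarrow>
     (n2 = 0 \<or> sing_val n2 R22 > sing_val (n2 + 1) (R22 @\<^sub>c col_mat R2b)) \<and>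
     sing_val (n2 + 1) (R22 @\<^sub>c col_mat R2b) > 0"

definition mtls_G2 :: "nat \<Rightarrow> real mat \<Rightarrow> real vec \<Rightarrow> real mat \<Rightarrow> bool" where
  "mtls_G2 n A b W \<longleftrightarrow>
     (let A' = A @\<^sub>c col_mat b; W' = diag_block_mat [W, 1\<^sub>m 1] in
      gen_eigval n (A\<^sup>T * A) W > gen_eigval (n + 1) (A'\<^sup>T * A') W')"

end

theory Submission
  imports Defs
begin

text \<open>
  For fixed \<open>y\<close> the cheapest perturbation \<open>[E, f]\<close> under which \<open>y\<close> becomes feasible has rank one, with
  squared Frobenius norm \<open>q(y) = \<parallel>A y - b\<parallel>\<^sup>2 / (1 + y \<bullet> W y)\<close> (\<open>mtls_solution_iff\<close>). So the solutions are the
  minimizers of a Rayleigh quotient, and everything is derived from quadratic functions of the form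
  \<open>\<parallel>A y - b\<parallel>\<^sup>2 - \<nu> (1 + y \<bullet> W y)\<close>. With \<open>\<mu> = q(x)\<close> and \<open>r = A x - b\<close>, a minimizer \<open>x\<close> satisfies
  \<open>A\<^sup>T r = \<mu> W x\<close>, and \<open>P = A\<^sup>T A - \<mu> W\<close> is positive semidefinite (\<open>minimizer_stationary\<close>).

  Eliminating \<open>x1\<close> through the triangular form shows that \<open>\<mu>\<close> is the smallest eigenvalue of \<open>C\<^sup>T C\<close> for
  \<open>C = [R22, R2b]\<close>, with eigenvector \<open>(x2, -1)\<close>; hence \<open>\<mu> = \<sigma>\<^sup>2\<close> (\<open>minimal_value_smallest_eigenvalue\<close>). If \<open>n2 > 0\<close>, each
  genericity condition puts the smallest eigenvalue of \<open>R22\<^sup>T R22\<close> strictly above \<open>\<mu>\<close>; for the pencils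
  this comes from a block congruence (\<open>pencil_poly_block_triangular\<close>). A null vector of \<open>P\<close> would make
  \<open>\<mu>\<close> an eigenvalue of \<open>R22\<^sup>T R22\<close>, so \<open>P\<close> is positive definite (\<open>definite_of_gap\<close>); for \<open>n2 = 0\<close> it is
  \<open>A\<^sup>T A\<close>.

  Definiteness persists under small perturbations \<open>[E, d]\<close> of \<open>[A, b]\<close>. It yields existence and
  uniqueness of the perturbed minimizer \<open>y\<close> by completing the square at the infimum of the quotient
  (\<open>minimizer_exists\<close>). Put \<open>h = y - x\<close>, \<open>w = E x - d\<close>, and let \<open>\<nu>\<close> be the perturbed minimal value.
  Subtracting the stationarity conditions gives \<open>P h = (\<nu> - \<mu>) W x - E\<^sup>T r - A\<^sup>T w\<close> up to second
  order, and \<open>\<nu> - \<mu> = 2 (r \<bullet> w) / (1 + x \<bullet> W x)\<close> up to second order. Since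
  \<open>A\<^sup>T r / \<parallel>r\<parallel>\<^sup>2 = W x / (1 + x \<bullet> W x)\<close>, the first order part of \<open>P h\<close> is \<open>- A\<^sup>T H0 w - E\<^sup>T r\<close>, and the Kronecker
  products in \<open>K\<close> express just this (\<open>minimizer_expansion\<close>, \<open>minimizer_frechet\<close>).

  For the norms, \<open>\<parallel>K\<^sup>T u\<parallel>\<^sup>2 = \<phi>(P\<^sup>-\<^sup>1 u)\<close> for the quadratic form
  \<open>\<phi>(v) = (1 + \<parallel>x\<parallel>\<^sup>2) \<parallel>A v\<parallel>\<^sup>2 - 2 (A v \<bullet> r) (x \<bullet> v) + \<parallel>r\<parallel>\<^sup>2 \<parallel>v\<parallel>\<^sup>2\<close> (\<open>derivative_factor_form\<close>). Each of the other
  expressions arises in the same way from another matrix with this form, after \<open>A\<^sup>T r = \<mu> W x\<close> and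
  \<open>\<parallel>r\<parallel>\<^sup>2 = \<mu> (1 + x \<bullet> W x)\<close> have been inserted where needed, and the spectral norm depends on the form
  alone.
\<close>

section \<open>Euclidean geometry of vectors of variable length\<close>

text \<open>Side conditions are equations between dimensions instead of carrier memberships, since the
  simplifier computes dimensions of compound terms.\<close>

lemma scalar_prod_comm: "dim_vec u = dim_vec v \<Longrightarrow> u \<bullet> v = v \<bullet> (u :: real vec)"
  by (simp add: scalar_prod_def mult.commute)

lemma scalar_prod_add_right: "dim_vec v = dim_vec w \<Longrightarrow> u \<bullet> (v + w) = u \<bullet> v + u \<bullet> (w :: real vec)"
  by (simp add: scalar_prod_def algebra_simps sum.distrib)

lemma scalar_prod_add_left:
  "dim_vec u = dim_vec w \<Longrightarrow> dim_vec v = dim_vec w \<Longrightarrow> (u + v) \<bullet> w = u \<bullet> w + v \<bullet> (w :: real vec)"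
  by (simp add: scalar_prod_def algebra_simps sum.distrib)

lemma scalar_prod_diff_right: "dim_vec v = dim_vec w \<Longrightarrow> u \<bullet> (v - w) = u \<bullet> v - u \<bullet> (w :: real vec)"
  by (simp add: scalar_prod_def algebra_simps sum_subtractf)

lemma scalar_prod_diff_left:
  "dim_vec u = dim_vec w \<Longrightarrow> dim_vec v = dim_vec w \<Longrightarrow> (u - v) \<bullet> w = u \<bullet> w - v \<bullet> (w :: real vec)"
  by (simp add: scalar_prod_def algebra_simps sum_subtractf)

lemma scalar_prod_uminus_right_dim: "u \<bullet> (- v) = - (u \<bullet> (v :: real vec))"
  by (simp add: scalar_prod_def sum_negf)

lemma scalar_prod_uminus_left_dim: "dim_vec u = dim_vec v \<Longrightarrow> (- u) \<bullet> v = - (u \<bullet> (v :: real vec))"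
  by (simp add: scalar_prod_def sum_negf)

lemma mult_mat_vec_add: "dim_vec v = dim_col A \<Longrightarrow> dim_vec w = dim_col A \<Longrightarrow>
    A *\<^sub>v (v + w) = A *\<^sub>v v + A *\<^sub>v (w :: real vec)"
  by (auto intro!: eq_vecI simp: scalar_prod_add_right)

lemma mult_mat_vec_diff: "dim_vec v = dim_col A \<Longrightarrow> dim_vec w = dim_col A \<Longrightarrow>
    A *\<^sub>v (v - w) = A *\<^sub>v v - A *\<^sub>v (w :: real vec)"
  by (auto intro!: eq_vecI simp: scalar_prod_diff_right)

lemma mult_mat_vec_smult: "dim_vec v = dim_col A \<Longrightarrow> A *\<^sub>v (k \<cdot>\<^sub>v v) = k \<cdot>\<^sub>v (A *\<^sub>v (v :: real vec))"
  by (auto intro!: eq_vecI)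

lemma mult_mat_vec_uminus: "dim_vec v = dim_col A \<Longrightarrow> A *\<^sub>v (- v) = - (A *\<^sub>v (v :: real vec))"
  by (auto intro!: eq_vecI simp: scalar_prod_uminus_right_dim)

lemma add_mat_mult_vec: "dim_row A = dim_row B \<Longrightarrow> dim_col A = dim_col B \<Longrightarrow> dim_vec v = dim_col B \<Longrightarrow>
    (A + B) *\<^sub>v v = A *\<^sub>v v + B *\<^sub>v (v :: real vec)"
  by (auto intro!: eq_vecI simp: scalar_prod_def algebra_simps sum.distrib)

lemma diff_mat_mult_vec: "dim_row A = dim_row B \<Longrightarrow> dim_col A = dim_col B \<Longrightarrow> dim_vec v = dim_col B \<Longrightarrow>
    (A - B) *\<^sub>v v = A *\<^sub>v v - B *\<^sub>v (v :: real vec)"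
  by (auto intro!: eq_vecI simp: scalar_prod_def algebra_simps sum_subtractf)

lemma smult_mat_mult_vec: "dim_vec v = dim_col A \<Longrightarrow> (k \<cdot>\<^sub>m A) *\<^sub>v v = k \<cdot>\<^sub>v (A *\<^sub>v (v :: real vec))"
  by (auto intro!: eq_vecI)

lemma mult_mat_mult_vec: "dim_col A = dim_row B \<Longrightarrow> dim_vec v = dim_col B \<Longrightarrow>
    (A * B) *\<^sub>v v = A *\<^sub>v (B *\<^sub>v (v :: real vec))"
  by (rule assoc_mult_mat_vec[of A "dim_row A" "dim_col A"]) (auto intro: carrier_matI carrier_vecI)

lemma one_mat_mult_vec: "dim_vec v = k \<Longrightarrow> 1\<^sub>m k *\<^sub>v v = (v :: real vec)"
  by (rule one_mult_mat_vec) (auto intro: carrier_vecI)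

lemma zero_mat_mult_vec: "dim_vec v = l \<Longrightarrow> 0\<^sub>m k l *\<^sub>v v = 0\<^sub>v k"
  by (auto intro!: eq_vecI simp: scalar_prod_def)

lemma scalar_prod_transpose_right: "dim_vec u = dim_col A \<Longrightarrow> dim_vec v = dim_row A \<Longrightarrow>
    u \<bullet> (A\<^sup>T *\<^sub>v v) = (A *\<^sub>v u) \<bullet> (v :: real vec)"
  using transpose_vec_mult_scalar[of A "dim_row A" "dim_col A" u v]
  by (metis carrier_mat_triv carrier_vec_dim_vec dim_mult_mat_vec index_transpose_mat(2) scalar_prod_comm)

lemmas scalar_prod_linear = scalar_prod_add_right scalar_prod_add_left scalar_prod_diff_right
  scalar_prod_diff_left scalar_prod_uminus_right_dim scalar_prod_uminus_left_dim

lemmas mult_mat_vec_linear = mult_mat_vec_add mult_mat_vec_diff mult_mat_vec_smult mult_mat_vec_uminus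
  add_mat_mult_vec diff_mat_mult_vec smult_mat_mult_vec mult_mat_mult_vec one_mat_mult_vec
  zero_mat_mult_vec

lemma scalar_prod_self_nonneg: "0 \<le> v \<bullet> (v :: real vec)"
  by (simp add: scalar_prod_def sum_nonneg)

lemma scalar_prod_self_eq_0: "v \<bullet> v = 0 \<longleftrightarrow> v = 0\<^sub>v (dim_vec (v :: real vec))"
proof
  assume "v \<bullet> v = 0"
  then have "\<forall>i<dim_vec v. v $ i * v $ i = 0"
    by (simp add: scalar_prod_def sum_nonneg_eq_0_iff)
  then show "v = 0\<^sub>v (dim_vec v)" by (intro eq_vecI) auto
qed (metis carrier_vec_dim_vec scalar_prod_left_zero)

text \<open>This reduces vector identities to identities between bilinear forms, where transposes can be
  moved to the other argument.\<close>

lemma vec_eq_by_scalar_prod: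
  assumes "dim_vec u = dim_vec v" "\<And>w. dim_vec w = dim_vec v \<Longrightarrow> w \<bullet> u = w \<bullet> (v :: real vec)"
  shows "u = v"
proof -
  have "(u - v) \<bullet> (u - v) = 0"
    using assms(2)[of "u - v"] assms(1) by (simp add: scalar_prod_diff_right)
  then have "u - v = 0\<^sub>v (dim_vec v)" by (simp add: scalar_prod_self_eq_0)
  then have "\<And>i. i < dim_vec v \<Longrightarrow> (u - v) $ i = 0" by simp
  then show ?thesis using assms(1) by (intro eq_vecI) auto
qed

lemma vnorm_nonneg [simp]: "0 \<le> vnorm v"
  by (simp add: vnorm_def scalar_prod_self_nonneg)

lemma vnorm_sq: "(vnorm v)\<^sup>2 = v \<bullet> v"
  by (simp add: vnorm_def scalar_prod_self_nonneg)

lemma vnorm_mult_self: "vnorm v * vnorm v = v \<bullet> v"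
  using vnorm_sq[of v] by (simp add: power2_eq_square)

lemma vnorm_0 [simp]: "vnorm (0\<^sub>v k) = 0"
  by (simp add: vnorm_def)

lemma vnorm_smult: "vnorm (k \<cdot>\<^sub>v v) = \<bar>k\<bar> * vnorm v"
  by (simp add: vnorm_def real_sqrt_mult mult.assoc[symmetric])

lemma vnorm_uminus [simp]: "vnorm (- v) = vnorm v"
  by (simp add: vnorm_def scalar_prod_def)

lemma abs_scalar_prod_le: 
  assumes "dim_vec u = dim_vec v"
  shows "\<bar>u \<bullet> v\<bar> \<le> vnorm u * vnorm v"
proof -
  let ?w = "(v \<bullet> v) \<cdot>\<^sub>v u - (u \<bullet> v) \<cdot>\<^sub>v v"
  have "0 \<le> ?w \<bullet> ?w" by (rule scalar_prod_self_nonneg)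
  also have "\<dots> = (v \<bullet> v) * ((v \<bullet> v) * (u \<bullet> u) - (u \<bullet> v)\<^sup>2)"
    using assms by (simp add: scalar_prod_linear scalar_prod_comm[of v u] algebra_simps power2_eq_square)
  finally have *: "0 \<le> (v \<bullet> v) * ((v \<bullet> v) * (u \<bullet> u) - (u \<bullet> v)\<^sup>2)" .
  have "(u \<bullet> v)\<^sup>2 \<le> (vnorm u * vnorm v)\<^sup>2"
  proof (cases "v \<bullet> v = 0")
    case True
    then have "v = 0\<^sub>v (dim_vec v)" by (simp add: scalar_prod_self_eq_0)
    then have "u \<bullet> v = 0" using assms by (metis carrier_vec_dim_vec scalar_prod_right_zero)
    then show ?thesis by simp
  next
    case False
    then have "0 < v \<bullet> v" using scalar_prod_self_nonneg[of v] by linarith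
    with * have "0 \<le> (v \<bullet> v) * (u \<bullet> u) - (u \<bullet> v)\<^sup>2" by (simp add: zero_le_mult_iff)
    then show ?thesis by (simp add: power_mult_distrib vnorm_sq mult.commute)
  qed
  then show ?thesis by (simp add: abs_le_square_iff[symmetric] abs_mult)
qed

lemma scalar_prod_le: "dim_vec u = dim_vec v \<Longrightarrow> u \<bullet> v \<le> vnorm u * vnorm v"
  using abs_scalar_prod_le[of u v] by simp

lemma vnorm_add_le:
  assumes "dim_vec u = dim_vec v"
  shows "vnorm (u + v) \<le> vnorm u + vnorm v"
proof (rule power2_le_imp_le)
  have "(vnorm (u + v))\<^sup>2 = u \<bullet> u + 2 * (u \<bullet> v) + v \<bullet> v"
    using assms by (simp add: vnorm_sq scalar_prod_linear scalar_prod_comm[of v u])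
  also have "\<dots> \<le> (vnorm u + vnorm v)\<^sup>2"
    using scalar_prod_le[OF assms] by (simp add: power2_sum vnorm_sq)
  finally show "(vnorm (u + v))\<^sup>2 \<le> (vnorm u + vnorm v)\<^sup>2" .
qed simp

lemma vnorm_diff_le:
  assumes "dim_vec u = dim_vec v"
  shows "vnorm (u - v) \<le> vnorm u + vnorm v"
proof -
  have "u - v = u + (- v)" using assms by (intro eq_vecI) auto
  then show ?thesis using vnorm_add_le[of u "- v"] assms by simp
qed

lemma vnorm_append_sq: "(vnorm (u @\<^sub>v v))\<^sup>2 = (vnorm u)\<^sup>2 + (vnorm v)\<^sup>2"
  by (simp add: vnorm_sq scalar_prod_append[OF carrier_vec_dim_vec carrier_vec_dim_vec
        carrier_vec_dim_vec carrier_vec_dim_vec])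

lemma frobenius_norm_nonneg [simp]: "0 \<le> frobenius_norm M"
  by (simp add: frobenius_norm_def sum_nonneg)

lemma frobenius_norm_sq: "(frobenius_norm M)\<^sup>2 = (\<Sum>i<dim_row M. \<Sum>j<dim_col M. (M $$ (i, j))\<^sup>2)"
  by (simp add: frobenius_norm_def sum_nonneg)

lemma frobenius_norm_transpose: "frobenius_norm (M\<^sup>T) = frobenius_norm M"
  unfolding frobenius_norm_def by (subst sum.swap) (auto intro!: arg_cong[where f=sqrt] sum.cong)

lemma vnorm_mult_mat_vec_le:
  assumes "dim_vec v = dim_col M"
  shows "vnorm (M *\<^sub>v v) \<le> frobenius_norm M * vnorm v"
proof (rule power2_le_imp_le)
  have "(vnorm (M *\<^sub>v v))\<^sup>2 = (\<Sum>i<dim_row M. (row M i \<bullet> v)\<^sup>2)"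
    unfolding vnorm_sq scalar_prod_def[of "M *\<^sub>v v" "M *\<^sub>v v"]
    by (simp add: power2_eq_square atLeast0LessThan)
  also have "\<dots> \<le> (\<Sum>i<dim_row M. (\<Sum>j<dim_col M. (M $$ (i, j))\<^sup>2) * (vnorm v)\<^sup>2)"
  proof (rule sum_mono)
    fix i assume i: "i \<in> {..<dim_row M}"
    have "\<bar>row M i \<bullet> v\<bar>\<^sup>2 \<le> (vnorm (row M i) * vnorm v)\<^sup>2"
      using assms by (intro power_mono abs_scalar_prod_le) simp_all
    moreover have "(vnorm (row M i))\<^sup>2 = (\<Sum>j<dim_col M. (M $$ (i, j))\<^sup>2)"
      unfolding vnorm_sq scalar_prod_def using i by (simp add: power2_eq_square atLeast0LessThan)
    ultimately show "(row M i \<bullet> v)\<^sup>2 \<le> (\<Sum>j<dim_col M. (M $$ (i, j))\<^sup>2) * (vnorm v)\<^sup>2"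
      by (simp add: power_mult_distrib)
  qed
  also have "\<dots> = (frobenius_norm M * vnorm v)\<^sup>2"
    by (simp add: power_mult_distrib frobenius_norm_sq sum_distrib_right)
  finally show "(vnorm (M *\<^sub>v v))\<^sup>2 \<le> (frobenius_norm M * vnorm v)\<^sup>2" .
qed simp

lemma vnorm_add_bound:
  "dim_vec u = dim_vec v \<Longrightarrow> vnorm u \<le> \<alpha> \<Longrightarrow> vnorm v \<le> \<beta> \<Longrightarrow> vnorm (u + v) \<le> \<alpha> + \<beta>"
  using vnorm_add_le[of u v] by linarith

lemma vnorm_diff_bound:
  "dim_vec u = dim_vec v \<Longrightarrow> vnorm u \<le> \<alpha> \<Longrightarrow> vnorm v \<le> \<beta> \<Longrightarrow> vnorm (u - v) \<le> \<alpha> + \<beta>"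
  using vnorm_diff_le[of u v] by linarith

lemma vnorm_mult_bound:
  assumes "dim_vec v = dim_col M" "frobenius_norm M \<le> \<alpha>" "vnorm v \<le> \<beta>"
  shows "vnorm (M *\<^sub>v v) \<le> \<alpha> * \<beta>"
proof -
  have "0 \<le> \<alpha>" using frobenius_norm_nonneg[of M] assms(2) by linarith
  then have "frobenius_norm M * vnorm v \<le> \<alpha> * \<beta>" using assms by (intro mult_mono) simp_all
  then show ?thesis using vnorm_mult_mat_vec_le[OF assms(1)] by linarith
qed

lemma vnorm_transpose_mult_bound:
  "dim_vec v = dim_row M \<Longrightarrow> frobenius_norm M \<le> \<alpha> \<Longrightarrow> vnorm v \<le> \<beta> \<Longrightarrow> vnorm (M\<^sup>T *\<^sub>v v) \<le> \<alpha> * \<beta>"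
  using vnorm_mult_bound[of v "M\<^sup>T" \<alpha> \<beta>] by (simp add: frobenius_norm_transpose)

lemma vnorm_smult_bound: "\<bar>k\<bar> \<le> \<alpha> \<Longrightarrow> vnorm v \<le> \<beta> \<Longrightarrow> vnorm (k \<cdot>\<^sub>v v) \<le> \<alpha> * \<beta>"
  unfolding vnorm_smult by (intro mult_mono) auto

lemma abs_scalar_prod_bound:
  assumes "dim_vec u = dim_vec v" "vnorm u \<le> \<alpha>" "vnorm v \<le> \<beta>"
  shows "\<bar>u \<bullet> v\<bar> \<le> \<alpha> * \<beta>"
proof -
  have "0 \<le> \<alpha>" using vnorm_nonneg[of u] assms(2) by linarith
  then have "vnorm u * vnorm v \<le> \<alpha> * \<beta>" using assms by (intro mult_mono) simp_all
  then show ?thesis using abs_scalar_prod_le[OF assms(1)] by linarith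
qed

lemma scalar_prod_add_self:
  "dim_vec u = dim_vec v \<Longrightarrow> (u + v) \<bullet> (u + v) = u \<bullet> u + 2 * (u \<bullet> v) + v \<bullet> (v :: real vec)"
  by (simp add: scalar_prod_linear scalar_prod_comm[of v u])

lemma scalar_prod_diff_self:
  "dim_vec u = dim_vec v \<Longrightarrow> (u - v) \<bullet> (u - v) = u \<bullet> u - 2 * (u \<bullet> v) + v \<bullet> (v :: real vec)"
  by (simp add: scalar_prod_linear scalar_prod_comm[of v u])

lemma transpose_linear:
  fixes A B :: "real mat"
  shows "dim_row A = dim_row B \<Longrightarrow> dim_col A = dim_col B \<Longrightarrow> (A + B)\<^sup>T = A\<^sup>T + B\<^sup>T"
    and "dim_row A = dim_row B \<Longrightarrow> dim_col A = dim_col B \<Longrightarrow> (A - B)\<^sup>T = A\<^sup>T - B\<^sup>T"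
    and "(k \<cdot>\<^sub>m A)\<^sup>T = k \<cdot>\<^sub>m A\<^sup>T"
    and "(- A)\<^sup>T = - A\<^sup>T"
  by (auto intro!: eq_matI)

lemma transpose_mult_dim:
  fixes A B :: "real mat"
  shows "dim_col A = dim_row B \<Longrightarrow> (A * B)\<^sup>T = B\<^sup>T * A\<^sup>T"
  by (rule transpose_mult[of A "dim_row A" "dim_col A" B "dim_col B"]) (auto intro: carrier_matI)

lemma uminus_mat_mult_vec: "dim_vec v = dim_col A \<Longrightarrow> (- A) *\<^sub>v v = - (A *\<^sub>v (v :: real vec))"
  by (auto intro!: eq_vecI simp: scalar_prod_uminus_left_dim)

section \<open>The spectral norm\<close>

lemma spectral_norm_bdd: "bdd_above {vnorm (M *\<^sub>v v) | v. v \<in> carrier_vec (dim_col M) \<and> vnorm v \<le> 1}"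
proof (rule bdd_aboveI[of _ "frobenius_norm M"], safe)
  fix v :: "real vec" assume "v \<in> carrier_vec (dim_col M)" "vnorm v \<le> 1"
  then show "vnorm (M *\<^sub>v v) \<le> frobenius_norm M"
    using vnorm_mult_mat_vec_le[of v M] mult_left_mono[of "vnorm v" 1 "frobenius_norm M"] by simp
qed

lemma spectral_norm_le:
  assumes "\<And>v. dim_vec v = dim_col M \<Longrightarrow> vnorm v \<le> 1 \<Longrightarrow> vnorm (M *\<^sub>v v) \<le> c"
  shows "spectral_norm M \<le> c"
  unfolding spectral_norm_def
proof (rule cSup_least)
  have "vnorm (M *\<^sub>v 0\<^sub>v (dim_col M))
      \<in> {vnorm (M *\<^sub>v v) | v. v \<in> carrier_vec (dim_col M) \<and> vnorm v \<le> 1}"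
    by (rule CollectI, rule exI[of _ "0\<^sub>v (dim_col M)"]) simp
  then show "{vnorm (M *\<^sub>v v) | v. v \<in> carrier_vec (dim_col M) \<and> vnorm v \<le> 1} \<noteq> {}"
    by blast
qed (use assms in auto)

lemma vnorm_le_spectral_norm_unit:
  "dim_vec v = dim_col M \<Longrightarrow> vnorm v \<le> 1 \<Longrightarrow> vnorm (M *\<^sub>v v) \<le> spectral_norm M"
  unfolding spectral_norm_def by (rule cSup_upper[OF _ spectral_norm_bdd]) (auto intro: carrier_vecI)

lemma spectral_norm_nonneg: "0 \<le> spectral_norm M"
  by (rule order_trans[OF vnorm_nonneg vnorm_le_spectral_norm_unit[of "0\<^sub>v (dim_col M)"]]) simp_all

lemma vnorm_mult_mat_vec_le_spectral_norm:
  assumes "dim_vec v = dim_col M"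
  shows "vnorm (M *\<^sub>v v) \<le> spectral_norm M * vnorm v"
proof (cases "vnorm v = 0")
  case True
  then show ?thesis using vnorm_mult_mat_vec_le[OF assms] by simp
next
  case False
  then have pos: "vnorm v > 0" using vnorm_nonneg[of v] by linarith
  then have "vnorm (M *\<^sub>v ((1 / vnorm v) \<cdot>\<^sub>v v)) \<le> spectral_norm M"
    using assms by (intro vnorm_le_spectral_norm_unit) (simp_all add: vnorm_smult)
  then show ?thesis using pos assms by (simp add: mult_mat_vec_smult vnorm_smult field_simps)
qed

text \<open>This follows from \<open>\<parallel>M\<^sup>T v\<parallel>\<^sup>2 = M (M\<^sup>T v) \<bullet> v\<close> and the Cauchy-Schwarz inequality.\<close>

lemma spectral_norm_transpose_le: "spectral_norm (M\<^sup>T) \<le> spectral_norm M"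
proof (rule spectral_norm_le)
  fix v :: "real vec" assume "dim_vec v = dim_col (M\<^sup>T)" and v1: "vnorm v \<le> 1"
  then have d: "dim_vec v = dim_row M" by simp
  let ?u = "M\<^sup>T *\<^sub>v v"
  have "vnorm ?u * vnorm ?u = (M *\<^sub>v ?u) \<bullet> v"
    unfolding vnorm_mult_self by (rule scalar_prod_transpose_right) (simp_all add: d)
  also have "\<dots> \<le> vnorm (M *\<^sub>v ?u) * vnorm v" by (rule scalar_prod_le) (simp add: d)
  also have "\<dots> \<le> vnorm (M *\<^sub>v ?u)" using v1 mult_left_mono[OF v1, of "vnorm (M *\<^sub>v ?u)"] by simp
  also have "\<dots> \<le> spectral_norm M * vnorm ?u" by (rule vnorm_mult_mat_vec_le_spectral_norm) simp
  finally show "vnorm ?u \<le> spectral_norm M"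
    using spectral_norm_nonneg[of M] vnorm_nonneg[of ?u] by (cases "vnorm ?u = 0") simp_all
qed

lemma spectral_norm_transpose: "spectral_norm (M\<^sup>T) = spectral_norm M"
  using spectral_norm_transpose_le[of M] spectral_norm_transpose_le[of "M\<^sup>T"] by simp

lemma spectral_norm_smult:
  assumes "0 \<le> k"
  shows "spectral_norm (k \<cdot>\<^sub>m M) = k * spectral_norm M"
proof -
  have le: "spectral_norm (k \<cdot>\<^sub>m M) \<le> k * spectral_norm M" if "0 \<le> k" for k M
  proof (rule spectral_norm_le)
    fix v :: "real vec" assume "dim_vec v = dim_col (k \<cdot>\<^sub>m M)" "vnorm v \<le> 1"
    then show "vnorm ((k \<cdot>\<^sub>m M) *\<^sub>v v) \<le> k * spectral_norm M"
      using that vnorm_le_spectral_norm_unit[of v M]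
      by (simp add: smult_mat_mult_vec vnorm_smult mult_left_mono)
  qed
  show ?thesis
  proof (cases "k = 0")
    case True
    then show ?thesis using le[of 0 M] spectral_norm_nonneg[of "k \<cdot>\<^sub>m M"] by simp
  next
    case False
    then have "(1 / k) \<cdot>\<^sub>m (k \<cdot>\<^sub>m M) = M" by (intro eq_matI) auto
    then have "spectral_norm M \<le> (1 / k) * spectral_norm (k \<cdot>\<^sub>m M)"
      using le[of "1 / k" "k \<cdot>\<^sub>m M"] assms by simp
    then have "k * spectral_norm M \<le> spectral_norm (k \<cdot>\<^sub>m M)"
      using False assms by (simp add: field_simps)
    then show ?thesis using le[OF assms, of M] by simp
  qed
qed

text \<open>The expressions for the condition number are compared through the quadratic form
  \<open>u \<mapsto> \<parallel>M\<^sup>T u\<parallel>\<^sup>2\<close>, which spares the explicit products \<open>M M\<^sup>T\<close>.\<close>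

lemma spectral_norm_eq_if_same_form:
  assumes "dim_row M = dim_row N"
    and "\<And>u. dim_vec u = dim_row N \<Longrightarrow> (vnorm (M\<^sup>T *\<^sub>v u))\<^sup>2 = (vnorm (N\<^sup>T *\<^sub>v u))\<^sup>2"
  shows "spectral_norm M = spectral_norm N"
proof -
  have *: "spectral_norm (M\<^sup>T) \<le> spectral_norm (N\<^sup>T)"
    if "dim_row M = dim_row N"
      "\<And>u. dim_vec u = dim_row N \<Longrightarrow> (vnorm (M\<^sup>T *\<^sub>v u))\<^sup>2 = (vnorm (N\<^sup>T *\<^sub>v u))\<^sup>2" for M N
  proof (rule spectral_norm_le)
    fix u :: "real vec" assume u: "dim_vec u = dim_col (M\<^sup>T)" "vnorm u \<le> 1"
    then have "vnorm (M\<^sup>T *\<^sub>v u) = vnorm (N\<^sup>T *\<^sub>v u)"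
      using that(2)[of u] that(1) by simp
    then show "vnorm (M\<^sup>T *\<^sub>v u) \<le> spectral_norm (N\<^sup>T)"
      using vnorm_le_spectral_norm_unit[of u "N\<^sup>T"] u that(1) by simp
  qed
  show ?thesis using *[of M N] *[of N M] assms by (simp add: spectral_norm_transpose)
qed

text \<open>Polarization turns the hypothesis on the form into \<open>u \<bullet> S v = N\<^sup>T u \<bullet> N\<^sup>T v\<close>, so that in
  effect \<open>S = N N\<^sup>T\<close>.\<close>

lemma spectral_norm_gram:
  fixes S N :: "real mat"
  assumes S: "dim_row S = k" "dim_col S = k" and N: "dim_row N = k"
    and sym: "\<And>u v. dim_vec u = k \<Longrightarrow> dim_vec v = k \<Longrightarrow> u \<bullet> (S *\<^sub>v v) = v \<bullet> (S *\<^sub>v u)"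
    and form: "\<And>u. dim_vec u = k \<Longrightarrow> u \<bullet> (S *\<^sub>v u) = (vnorm (N\<^sup>T *\<^sub>v u))\<^sup>2"
  shows "spectral_norm S = (spectral_norm N)\<^sup>2"
proof (rule antisym)
  note [simp] = S N
  have polar: "u \<bullet> (S *\<^sub>v v) = (N\<^sup>T *\<^sub>v u) \<bullet> (N\<^sup>T *\<^sub>v v)" if [simp]: "dim_vec u = k" "dim_vec v = k" for u v
  proof -
    have "u \<bullet> (S *\<^sub>v u) + 2 * (u \<bullet> (S *\<^sub>v v)) + v \<bullet> (S *\<^sub>v v) = (u + v) \<bullet> (S *\<^sub>v (u + v))"
      using sym[of u v] by (simp add: mult_mat_vec_linear scalar_prod_linear)
    also have "\<dots> = (N\<^sup>T *\<^sub>v u) \<bullet> (N\<^sup>T *\<^sub>v u) + 2 * ((N\<^sup>T *\<^sub>v u) \<bullet> (N\<^sup>T *\<^sub>v v)) + (N\<^sup>T *\<^sub>v v) \<bullet> (N\<^sup>T *\<^sub>v v)"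
      using form[of "u + v"] scalar_prod_comm[of "N\<^sup>T *\<^sub>v u" "N\<^sup>T *\<^sub>v v"]
      by (simp add: mult_mat_vec_linear scalar_prod_linear vnorm_sq)
    finally show ?thesis using form[of u] form[of v] by (simp add: vnorm_sq)
  qed
  let ?s = "spectral_norm (N\<^sup>T)"
  have s: "?s = spectral_norm N" by (rule spectral_norm_transpose)
  show "spectral_norm S \<le> (spectral_norm N)\<^sup>2"
  proof (rule spectral_norm_le)
    fix v :: "real vec" assume v: "dim_vec v = dim_col S" "vnorm v \<le> 1"
    then have [simp]: "dim_vec v = k" by simp
    have "vnorm (S *\<^sub>v v) * vnorm (S *\<^sub>v v) = (N\<^sup>T *\<^sub>v (S *\<^sub>v v)) \<bullet> (N\<^sup>T *\<^sub>v v)"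
      unfolding vnorm_mult_self by (rule polar) simp_all
    also have "\<dots> \<le> vnorm (N\<^sup>T *\<^sub>v (S *\<^sub>v v)) * vnorm (N\<^sup>T *\<^sub>v v)" by (rule scalar_prod_le) simp
    also have "\<dots> \<le> (?s * vnorm (S *\<^sub>v v)) * ?s"
      using v(2) by (intro mult_mono vnorm_mult_mat_vec_le_spectral_norm vnorm_le_spectral_norm_unit)
        (simp_all add: spectral_norm_nonneg)
    finally have "vnorm (S *\<^sub>v v) * vnorm (S *\<^sub>v v) \<le> ?s\<^sup>2 * vnorm (S *\<^sub>v v)"
      by (simp add: power2_eq_square mult_ac)
    then show "vnorm (S *\<^sub>v v) \<le> (spectral_norm N)\<^sup>2"
      using vnorm_nonneg[of "S *\<^sub>v v"] by (cases "vnorm (S *\<^sub>v v) = 0") (simp_all add: s)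
  qed
  have "?s \<le> sqrt (spectral_norm S)"
  proof (rule spectral_norm_le)
    fix u :: "real vec" assume u: "dim_vec u = dim_col (N\<^sup>T)" "vnorm u \<le> 1"
    then have [simp]: "dim_vec u = k" by simp
    have "(vnorm (N\<^sup>T *\<^sub>v u))\<^sup>2 = u \<bullet> (S *\<^sub>v u)" by (simp add: form)
    also have "\<dots> \<le> vnorm u * vnorm (S *\<^sub>v u)" by (rule scalar_prod_le) simp
    also have "\<dots> \<le> 1 * spectral_norm S"
      using u(2) by (intro mult_mono vnorm_le_spectral_norm_unit) (simp_all add: spectral_norm_nonneg)
    finally show "vnorm (N\<^sup>T *\<^sub>v u) \<le> sqrt (spectral_norm S)" by (simp add: real_le_rsqrt)
  qed
  then show "(spectral_norm N)\<^sup>2 \<le> spectral_norm S"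
    using spectral_norm_nonneg[of N] spectral_norm_nonneg[of S] power_mono[of ?s "sqrt (spectral_norm S)" 2]
    by (simp add: s)
qed

section \<open>Eigenvalues of Gram matrices\<close>

text \<open>The characteristic polynomial splits over the complex numbers, and symmetry makes each complex
  eigenvalue real.\<close>

lemma symmetric_char_poly_splits:
  fixes M :: "real mat"
  assumes M: "M \<in> carrier_mat k k" and sym: "M\<^sup>T = M"
  shows "\<exists>es. char_poly M = (\<Prod>e\<leftarrow>es. [:- e, 1:]) \<and> length es = k"
proof -
  let ?Mc = "map_mat complex_of_real M"
  have Mc: "?Mc \<in> carrier_mat k k" using M by simp
  from char_poly_factorized[OF Mc] obtain as where
    as: "char_poly ?Mc = (\<Prod>a\<leftarrow>as. [:- a, 1:])" "length as = k" by blast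
  have real: "complex_of_real (Re a) = a" if a: "a \<in> set as" for a
  proof -
    have "poly (char_poly ?Mc) a = 0"
      unfolding as poly_prod_list using a by (auto simp: prod_list_zero_iff)
    then have "eigenvalue ?Mc a" using eigenvalue_root_char_poly[OF Mc] by simp
    then obtain v where v: "v \<in> carrier_vec k" "v \<noteq> 0\<^sub>v k" "?Mc *\<^sub>v v = a \<cdot>\<^sub>v v"
      unfolding eigenvalue_def eigenvector_def using Mc by auto
    \<comment> \<open>Split the eigenvector into real and imaginary part and test the two resulting real
      equations against each other.\<close>
    define p q where "p = map_vec Re v" and "q = map_vec Im v"
    have d[simp]: "dim_vec p = k" "dim_vec q = k" "dim_vec v = k" "dim_row M = k" "dim_col M = k"
      using v M by (auto simp: p_def q_def)
    have entry: "(\<Sum>j\<in>{0..<k}. complex_of_real (M $$ (i, j)) * v $ j) = a * v $ i" if "i < k" for i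
      using arg_cong[OF v(3), of "\<lambda>w. w $ i"] that by (simp add: scalar_prod_def)
    have Mp: "M *\<^sub>v p = Re a \<cdot>\<^sub>v p - Im a \<cdot>\<^sub>v q"
    proof (rule eq_vecI)
      fix i assume "i < dim_vec (Re a \<cdot>\<^sub>v p - Im a \<cdot>\<^sub>v q)"
      then have i: "i < k" by simp
      show "(M *\<^sub>v p) $ i = (Re a \<cdot>\<^sub>v p - Im a \<cdot>\<^sub>v q) $ i"
        using arg_cong[OF entry[OF i], of Re] i by (simp add: p_def q_def scalar_prod_def)
    qed simp
    have Mq: "M *\<^sub>v q = Im a \<cdot>\<^sub>v p + Re a \<cdot>\<^sub>v q"
    proof (rule eq_vecI)
      fix i assume "i < dim_vec (Im a \<cdot>\<^sub>v p + Re a \<cdot>\<^sub>v q)"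
      then have i: "i < k" by simp
      show "(M *\<^sub>v q) $ i = (Im a \<cdot>\<^sub>v p + Re a \<cdot>\<^sub>v q) $ i"
        using arg_cong[OF entry[OF i], of Im] i by (simp add: p_def q_def scalar_prod_def)
    qed simp
    have "q \<bullet> (M *\<^sub>v p) = p \<bullet> (M *\<^sub>v q)"
      using scalar_prod_transpose_right[of q M p] by (simp add: sym scalar_prod_comm)
    then have "Im a * (p \<bullet> p + q \<bullet> q) = 0"
      unfolding Mp Mq by (simp add: scalar_prod_linear scalar_prod_comm[of q p] algebra_simps)
    moreover have "p \<bullet> p + q \<bullet> q \<noteq> 0"
    proof
      assume "p \<bullet> p + q \<bullet> q = 0"
      then have "p = 0\<^sub>v k" "q = 0\<^sub>v k"
        using scalar_prod_self_nonneg[of p] scalar_prod_self_nonneg[of q]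
          scalar_prod_self_eq_0[of p] scalar_prod_self_eq_0[of q] by (simp_all add: add_nonneg_eq_0_iff)
      then have "p $ i = 0" "q $ i = 0" if "i < k" for i
        using that by simp_all
      then have "v $ i = 0" if "i < k" for i
        using that by (simp add: p_def q_def complex_eq_iff)
      then have "v = 0\<^sub>v k" by (intro eq_vecI) simp_all
      with v(2) show False by simp
    qed
    ultimately show ?thesis by (simp add: complex_eq_iff)
  qed
  let ?es = "map Re as"
  have "map_poly complex_of_real (char_poly M) = char_poly ?Mc"
    by (rule of_real_hom.char_poly_hom[OF M, symmetric])
  also have "\<dots> = (\<Prod>a\<leftarrow>as. map_poly complex_of_real [:- Re a, 1:])"
    unfolding as(1) by (intro arg_cong[of _ _ prod_list] map_cong) (simp_all add: real)
  also have "\<dots> = map_poly complex_of_real (\<Prod>e\<leftarrow>?es. [:- e, 1:])"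
  proof -
    interpret map_poly_comm_ring_hom complex_of_real ..
    show ?thesis by (simp add: hom_prod_list o_def)
  qed
  finally have "char_poly M = (\<Prod>e\<leftarrow>?es. [:- e, 1:])"
    by (simp add: poly_eq_iff coeff_map_poly)
  then show ?thesis using as(2) by (intro exI[of _ ?es]) simp
qed

lemma set_roots_desc: "p \<noteq> 0 \<Longrightarrow> set (roots_desc p) = {x. poly p x = 0}"
  by (simp add: roots_desc_def)

lemma length_roots_desc: "length (roots_desc p) = size (proots p)"
  by (simp add: roots_desc_def size_mset[symmetric] del: size_mset)

lemma gram_carrier: "B \<in> carrier_mat p k \<Longrightarrow> B\<^sup>T * B \<in> carrier_mat k k" for B :: "real mat"
  by auto

lemma gram_symmetric: "(B\<^sup>T * B)\<^sup>T = B\<^sup>T * (B :: real mat)"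
  by (simp add: transpose_mult[of "B\<^sup>T" "dim_col B" "dim_row B" B "dim_col B"])

lemma char_poly_nonzero: "M \<in> carrier_mat k k \<Longrightarrow> char_poly (M :: real mat) \<noteq> 0"
  using degree_monic_char_poly[of M k] by auto

lemma length_roots_desc_gram:
  fixes B :: "real mat"
  assumes "B \<in> carrier_mat p k"
  shows "length (roots_desc (char_poly (B\<^sup>T * B))) = k"
proof -
  obtain es where es: "char_poly (B\<^sup>T * B) = (\<Prod>e\<leftarrow>es. [:- e, 1:])" "length es = k"
    using symmetric_char_poly_splits[OF gram_carrier[OF assms] gram_symmetric] by blast
  have "proots (\<Prod>e\<leftarrow>es. [:- e, 1:]) = mset es" for es :: "real list"
  proof (induction es)
    case (Cons e es)
    have "(\<Prod>e\<leftarrow>es. [:- e, 1:]) \<noteq> (0 :: real poly)" by (auto simp: prod_list_zero_iff)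
    then show ?case
      unfolding list.map prod_list.Cons by (subst proots_mult) (simp_all add: Cons.IH)
  qed simp
  then show ?thesis using es by (simp add: length_roots_desc)
qed

text \<open>The entry with the largest index is the smallest eigenvalue; that the list is long enough
  for this entry to exist is the real splitting of the characteristic polynomial.\<close>

lemma smallest_root_gram:
  fixes B :: "real mat"
  assumes B: "B \<in> carrier_mat p (Suc k)"
  defines "lam \<equiv> roots_desc (char_poly (B\<^sup>T * B)) ! k"
  shows "poly (char_poly (B\<^sup>T * B)) lam = 0"
    and "poly (char_poly (B\<^sup>T * B)) e = 0 \<Longrightarrow> lam \<le> e"
proof -
  let ?p = "char_poly (B\<^sup>T * B)" and ?l = "roots_desc (char_poly (B\<^sup>T * B))"
  have len: "length ?l = Suc k" by (rule length_roots_desc_gram[OF B])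
  have set: "set ?l = {x. poly ?p x = 0}"
    by (rule set_roots_desc[OF char_poly_nonzero[OF gram_carrier[OF B]]])
  have "lam \<in> set ?l" unfolding lam_def by (rule nth_mem) (simp add: len)
  then show "poly ?p lam = 0" using set by simp
  show "lam \<le> e" if "poly ?p e = 0"
  proof -
    have "e \<in> set ?l" using set that by simp
    then obtain i where i: "i < Suc k" "e = ?l ! i" using len by (metis in_set_conv_nth)
    have "sorted (rev ?l)" by (simp add: roots_desc_def)
    then show ?thesis
      using i len sorted_rev_nth_mono[of ?l i k] by (simp add: lam_def)
  qed
qed

lemma root_gram_iff:
  fixes B :: "real mat"
  assumes B: "B \<in> carrier_mat p k"
  shows "poly (char_poly (B\<^sup>T * B)) e = 0 \<longleftrightarrow>
    (\<exists>z. dim_vec z = k \<and> z \<noteq> 0\<^sub>v k \<and> B\<^sup>T *\<^sub>v (B *\<^sub>v z) = e \<cdot>\<^sub>v z)"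
proof -
  have "poly (char_poly (B\<^sup>T * B)) e = 0 \<longleftrightarrow> eigenvalue (B\<^sup>T * B) e"
    by (rule eigenvalue_root_char_poly[OF gram_carrier[OF B], symmetric])
  also have "\<dots> \<longleftrightarrow> (\<exists>z. dim_vec z = k \<and> z \<noteq> 0\<^sub>v k \<and> B\<^sup>T *\<^sub>v (B *\<^sub>v z) = e \<cdot>\<^sub>v z)"
  proof -
    have "eigenvector (B\<^sup>T * B) z e \<longleftrightarrow> dim_vec z = k \<and> z \<noteq> 0\<^sub>v k \<and> B\<^sup>T *\<^sub>v (B *\<^sub>v z) = e \<cdot>\<^sub>v z" for z
    proof (cases "dim_vec z = k")
      case True
      then have "z \<in> carrier_vec k" by (rule carrier_vecI)
      moreover have "(B\<^sup>T * B) *\<^sub>v z = B\<^sup>T *\<^sub>v (B *\<^sub>v z)" using True B by (simp add: mult_mat_mult_vec)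
      ultimately show ?thesis using True B by (simp add: eigenvector_def)
    next
      case False
      then show ?thesis using B by (auto simp: eigenvector_def)
    qed
    then show ?thesis by (simp add: eigenvalue_def)
  qed
  finally show ?thesis .
qed

lemma sing_val_last:
  fixes B :: "real mat"
  assumes B: "B \<in> carrier_mat p (Suc k)"
  shows "sing_val (Suc k) B = sqrt (roots_desc (char_poly (B\<^sup>T * B)) ! k)"
  by (simp add: sing_val_def length_roots_desc_gram[OF B])

lemma linear_term_vanishes:
  fixes a c :: real
  assumes "\<And>t. 0 \<le> 2 * t * a + t\<^sup>2 * c"
  shows "a = 0" and "0 \<le> c"
proof -
  show c: "0 \<le> c" using assms[of 1] assms[of "-1"] by simp
  show "a = 0"
  proof (rule ccontr)
    assume a: "a \<noteq> 0"
    \<comment> \<open>This \<open>t\<close> minimizes the parabola up to the shift of \<open>c\<close> that keeps the denominator positive.\<close>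
    have "0 \<le> 2 * (- a / (c + 1)) * a + (- a / (c + 1))\<^sup>2 * c" by (rule assms)
    also have "\<dots> = - (a\<^sup>2 * (c + 2)) / (c + 1)\<^sup>2"
      using c by (simp add: divide_simps power2_eq_square) (simp add: algebra_simps)
    also have "\<dots> < 0" using a c by (simp add: divide_neg_pos)
    finally show False by simp
  qed
qed

text \<open>The form \<open>\<parallel>B z\<parallel>\<^sup>2 - \<mu> \<parallel>z\<parallel>\<^sup>2\<close> is nonnegative, hence its linear term vanishes at a zero.\<close>

lemma gram_eigenvector_of_minimizer:
  fixes B :: "real mat"
  assumes low: "\<And>z. dim_vec z = dim_col B \<Longrightarrow> \<mu> * (z \<bullet> z) \<le> (B *\<^sub>v z) \<bullet> (B *\<^sub>v z)"
    and z[simp]: "dim_vec z = dim_col B" and eq: "\<mu> * (z \<bullet> z) = (B *\<^sub>v z) \<bullet> (B *\<^sub>v z)"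
  shows "B\<^sup>T *\<^sub>v (B *\<^sub>v z) = \<mu> \<cdot>\<^sub>v z"
proof (rule vec_eq_by_scalar_prod)
  fix w :: "real vec" assume "dim_vec w = dim_vec (\<mu> \<cdot>\<^sub>v z)"
  then have [simp]: "dim_vec w = dim_col B" by simp
  have "0 \<le> 2 * t * ((B *\<^sub>v w) \<bullet> (B *\<^sub>v z) - \<mu> * (w \<bullet> z)) + t\<^sup>2 * ((B *\<^sub>v w) \<bullet> (B *\<^sub>v w) - \<mu> * (w \<bullet> w))" for t
    using low[of "z + t \<cdot>\<^sub>v w"] eq
    by (simp add: mult_mat_vec_linear scalar_prod_linear scalar_prod_comm[of z w]
        scalar_prod_comm[of "B *\<^sub>v z" "B *\<^sub>v w"] algebra_simps power2_eq_square)
  from linear_term_vanishes(1)[OF this]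
  show "w \<bullet> (B\<^sup>T *\<^sub>v (B *\<^sub>v z)) = w \<bullet> (\<mu> \<cdot>\<^sub>v z)" by (simp add: scalar_prod_transpose_right)
qed simp

lemma smallest_root_gram_eqI:
  fixes B :: "real mat"
  assumes B: "B \<in> carrier_mat p (Suc k)"
    and low: "\<And>z. dim_vec z = Suc k \<Longrightarrow> \<mu> * (z \<bullet> z) \<le> (B *\<^sub>v z) \<bullet> (B *\<^sub>v z)"
    and z: "dim_vec z = Suc k" "z \<noteq> 0\<^sub>v (Suc k)" and eq: "\<mu> * (z \<bullet> z) = (B *\<^sub>v z) \<bullet> (B *\<^sub>v z)"
  shows "roots_desc (char_poly (B\<^sup>T * B)) ! k = \<mu>"
proof (rule antisym)
  let ?lam = "roots_desc (char_poly (B\<^sup>T * B)) ! k"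
  have [simp]: "dim_row B = p" "dim_col B = Suc k" using B by auto
  have "B\<^sup>T *\<^sub>v (B *\<^sub>v z) = \<mu> \<cdot>\<^sub>v z"
    using gram_eigenvector_of_minimizer[of B \<mu> z] low z eq by simp
  then show "?lam \<le> \<mu>" using smallest_root_gram(2)[OF B] root_gram_iff[OF B] z by blast
  obtain y where y: "dim_vec y = Suc k" "y \<noteq> 0\<^sub>v (Suc k)" "B\<^sup>T *\<^sub>v (B *\<^sub>v y) = ?lam \<cdot>\<^sub>v y"
    using smallest_root_gram(1)[OF B] root_gram_iff[OF B] by blast
  have "(B *\<^sub>v y) \<bullet> (B *\<^sub>v y) = ?lam * (y \<bullet> y)"
    using scalar_prod_transpose_right[of y B "B *\<^sub>v y"] y by simp
  moreover have "0 < y \<bullet> y"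
    using y scalar_prod_self_nonneg[of y] scalar_prod_self_eq_0[of y] by fastforce
  ultimately show "\<mu> \<le> ?lam" using low[of y] y by simp
qed

section \<open>The generalized eigenvalues of the augmented pencil\<close>

text \<open>The congruence that clears the off-diagonal blocks; it is applied over the ring of polynomials.\<close>

lemma block_congruence:
  fixes R T G :: "'a::comm_ring_1 mat"
  assumes R: "R \<in> carrier_mat k1 k1" and T: "T \<in> carrier_mat k1 k" and G: "G \<in> carrier_mat k k"
  defines "U \<equiv> four_block_mat R T (0\<^sub>m k k1) (1\<^sub>m k)"
  shows "U\<^sup>T * (four_block_mat (- 1\<^sub>m k1) (0\<^sub>m k1 k) (0\<^sub>m k k1) G * U)
    = four_block_mat (- (R\<^sup>T * R)) (- (R\<^sup>T * T)) (- (T\<^sup>T * R)) (- (T\<^sup>T * T) + G)"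
proof -
  note z = zero_carrier_mat and i = one_carrier_mat
  have m: "- 1\<^sub>m k1 \<in> carrier_mat k1 k1" by simp
  have uR: "- R \<in> carrier_mat k1 k1" and uT: "- T \<in> carrier_mat k1 k"
    and RT: "R\<^sup>T \<in> carrier_mat k1 k1" and TT: "T\<^sup>T \<in> carrier_mat k k1"
    using R T by simp_all
  have DU: "four_block_mat (- 1\<^sub>m k1) (0\<^sub>m k1 k) (0\<^sub>m k k1) G * U = four_block_mat (- R) (- T) (0\<^sub>m k k1) G"
    unfolding U_def mult_four_block_mat[OF m z z G R T z i]
    using R T G by (intro cong_four_block_mat) (auto simp: uminus_mult_left_mat)
  have UT: "U\<^sup>T = four_block_mat (R\<^sup>T) (0\<^sub>m k1 k) (T\<^sup>T) (1\<^sub>m k)"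
    unfolding U_def by (simp add: transpose_four_block_mat[OF R T z i])
  show ?thesis
    unfolding DU unfolding UT mult_four_block_mat[OF RT z TT i uR uT z G]
    using R T G by (intro cong_four_block_mat) (auto simp: uminus_mult_right_mat)
qed

lemma diag_block_zero_one:
  "diag_block_mat [0\<^sub>m k k, 1\<^sub>m l]
    = four_block_mat (0\<^sub>m k k) (0\<^sub>m k l) (0\<^sub>m l k) (1\<^sub>m l :: real mat)"
  unfolding diag_block_mat.simps Let_def by (rule eq_matI) auto

lemma pencil_blocks:
  fixes X Y Z V G :: "real mat"
  assumes "X \<in> carrier_mat k1 k1" "Y \<in> carrier_mat k1 k" "Z \<in> carrier_mat k k1"
    "V \<in> carrier_mat k k" "G \<in> carrier_mat k k"
  shows "map_mat (\<lambda>a. [:0, a:]) (four_block_mat (0\<^sub>m k1 k1) (0\<^sub>m k1 k) (0\<^sub>m k k1) (1\<^sub>m k))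
      - map_mat (\<lambda>a. [:a:]) (four_block_mat X Y Z (V + G))
    = four_block_mat (- map_mat (\<lambda>a. [:a:]) X) (- map_mat (\<lambda>a. [:a:]) Y) (- map_mat (\<lambda>a. [:a:]) Z)
        (- map_mat (\<lambda>a. [:a:]) V + char_poly_matrix G)"
proof (rule eq_matI)
  note [simp] = assms[THEN carrier_matD(1)] assms[THEN carrier_matD(2)]
  have [simp]: "dim_row (char_poly_matrix G) = k" "dim_col (char_poly_matrix G) = k"
    by (simp_all add: char_poly_matrix_def)
  fix i j
  assume "i < dim_row (four_block_mat (- map_mat (\<lambda>a. [:a:]) X) (- map_mat (\<lambda>a. [:a:]) Y)
      (- map_mat (\<lambda>a. [:a:]) Z) (- map_mat (\<lambda>a. [:a:]) V + char_poly_matrix G))"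
    "j < dim_col (four_block_mat (- map_mat (\<lambda>a. [:a:]) X) (- map_mat (\<lambda>a. [:a:]) Y)
      (- map_mat (\<lambda>a. [:a:]) Z) (- map_mat (\<lambda>a. [:a:]) V + char_poly_matrix G))"
  then have "i < k1 + k" "j < k1 + k" by simp_all
  then show "(map_mat (\<lambda>a. [:0, a:]) (four_block_mat (0\<^sub>m k1 k1) (0\<^sub>m k1 k) (0\<^sub>m k k1) (1\<^sub>m k))
      - map_mat (\<lambda>a. [:a:]) (four_block_mat X Y Z (V + G))) $$ (i, j)
    = four_block_mat (- map_mat (\<lambda>a. [:a:]) X) (- map_mat (\<lambda>a. [:a:]) Y) (- map_mat (\<lambda>a. [:a:]) Z)
        (- map_mat (\<lambda>a. [:a:]) V + char_poly_matrix G) $$ (i, j)"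
    by (cases "i < k1"; cases "j < k1"; cases "i = j") (auto simp: char_poly_matrix_def)
qed (simp_all add: assms[THEN carrier_matD(1)] assms[THEN carrier_matD(2)] char_poly_matrix_def)

text \<open>A congruence with the block triangular matrix \<open>[R, T; 0, I]\<close>, whose determinant is \<open>det R\<close>, splits
  \<open>\<lambda> diag(0, I) - S\<^sup>T S\<close> into the blocks \<open>- I\<close> and \<open>\<lambda> I - C\<^sup>T C\<close>. For invertible \<open>R\<close> the infinite
  eigenvalues therefore number exactly \<open>k1\<close>, and the finite ones are the eigenvalues of \<open>C\<^sup>T C\<close>.\<close>

lemma pencil_poly_block_triangular:
  fixes R T C :: "real mat"
  assumes R: "R \<in> carrier_mat k1 k1" and T: "T \<in> carrier_mat k1 k" and C: "C \<in> carrier_mat p k"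
  defines "S \<equiv> four_block_mat R T (0\<^sub>m p k1) C"
  shows "pencil_poly (S\<^sup>T * S) (diag_block_mat [0\<^sub>m k1 k1, 1\<^sub>m k])
    = Polynomial.smult ((- 1) ^ k1 * (det R)\<^sup>2) (char_poly (C\<^sup>T * C))"
proof -
  interpret const: comm_ring_hom "\<lambda>a::real. [:a:]"
    by unfold_locales (simp_all add: pCons_one)
  let ?c = "map_mat (\<lambda>a::real. [:a:])"
  define U where "U = four_block_mat (?c R) (?c T) (0\<^sub>m k k1) (1\<^sub>m k)"
  define D where "D = four_block_mat (- 1\<^sub>m k1) (0\<^sub>m k1 k) (0\<^sub>m k k1) (char_poly_matrix (C\<^sup>T * C))"
  note [simp] = carrier_matD[OF R] carrier_matD[OF T] carrier_matD[OF C]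
  have cp: "char_poly_matrix (C\<^sup>T * C) \<in> carrier_mat k k"
    by (rule char_poly_matrix_closed[OF gram_carrier[OF C]])
  have UDU: "U\<^sup>T * (D * U) = four_block_mat (- ((?c R)\<^sup>T * ?c R)) (- ((?c R)\<^sup>T * ?c T))
      (- ((?c T)\<^sup>T * ?c R)) (- ((?c T)\<^sup>T * ?c T) + char_poly_matrix (C\<^sup>T * C))"
    unfolding U_def D_def by (rule block_congruence) (use R T cp in simp_all)
  have ST: "S\<^sup>T = four_block_mat (R\<^sup>T) (0\<^sub>m k1 p) (T\<^sup>T) (C\<^sup>T)"
    unfolding S_def by (simp add: transpose_four_block_mat[OF R T zero_carrier_mat C])
  have SS: "S\<^sup>T * S = four_block_mat (R\<^sup>T * R) (R\<^sup>T * T) (T\<^sup>T * R) (T\<^sup>T * T + C\<^sup>T * C)"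
  proof -
    have RT: "R\<^sup>T \<in> carrier_mat k1 k1" and TT: "T\<^sup>T \<in> carrier_mat k k1" and CT: "C\<^sup>T \<in> carrier_mat k p"
      using R T C by simp_all
    show ?thesis
      unfolding ST unfolding S_def mult_four_block_mat[OF RT zero_carrier_mat TT CT R T zero_carrier_mat C]
      by (rule cong_four_block_mat)
        (simp_all add: left_mult_zero_mat[OF C] right_mult_zero_mat[OF CT] left_mult_zero_mat[OF zero_carrier_mat]
          right_add_zero_mat[OF mult_carrier_mat[OF RT R]] right_add_zero_mat[OF mult_carrier_mat[OF RT T]]
          right_add_zero_mat[OF mult_carrier_mat[OF TT R]])
  qed
  have cmult: "?c (X * Y) = ?c X * ?c Y" if "dim_col X = dim_row Y" for X Y
    using that by (intro const.mat_hom_mult[of _ "dim_row X" "dim_col X" _ "dim_col Y"]) (auto intro: carrier_matI)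
  have ct: "(?c X)\<^sup>T = ?c (X\<^sup>T)" for X by (rule eq_matI) auto
  have cuminus: "- ?c X = ?c (- X)" for X by (rule eq_matI) auto
  have "map_mat (\<lambda>a. [:0, a:]) (diag_block_mat [0\<^sub>m k1 k1, 1\<^sub>m k]) - ?c (S\<^sup>T * S) = U\<^sup>T * (D * U)"
    unfolding UDU SS ct diag_block_zero_one using R T C
    by (simp add: cmult[symmetric] pencil_blocks)
  then have "pencil_poly (S\<^sup>T * S) (diag_block_mat [0\<^sub>m k1 k1, 1\<^sub>m k]) = det (U\<^sup>T * (D * U))"
    by (simp add: pencil_poly_def)
  also have "\<dots> = det U * (det D * det U)"
  proof -
    have cU: "U \<in> carrier_mat (k1 + k) (k1 + k)" and cD: "D \<in> carrier_mat (k1 + k) (k1 + k)"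
      unfolding U_def D_def using R cp by auto
    then show ?thesis by (simp add: det_mult[of _ "k1 + k"] det_transpose[OF cU])
  qed
  also have "det U = [:det R:]"
    unfolding U_def using R T by (subst det_four_block_mat_lower_left_zero[of _ k1 _ k]) (auto simp: const.hom_det)
  also have "det D = [:(- 1) ^ k1:] * char_poly (C\<^sup>T * C)"
  proof -
    have "- 1\<^sub>m k1 = [:- 1:] \<cdot>\<^sub>m (1\<^sub>m k1 :: real poly mat)" by (rule eq_matI) (auto simp: pCons_one)
    then have "det (- 1\<^sub>m k1 :: real poly mat) = [:(- 1) ^ k1:]" by (simp add: const.hom_power)
    then show ?thesis
      unfolding D_def char_poly_def using cp
      by (subst det_four_block_mat_lower_left_zero[of _ k1 _ k]) auto
  qed
  finally show ?thesis
    by (simp add: power2_eq_square mult_ac)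
qed

section \<open>Column blocks\<close>

lemma dim_append_cols [simp]:
  "dim_row (A @\<^sub>c B) = dim_row A" "dim_col (A @\<^sub>c B) = dim_col A + dim_col B"
  by (simp_all add: append_cols_def)

lemma index_append_cols [simp]:
  "i < dim_row A \<Longrightarrow> j < dim_col A + dim_col B \<Longrightarrow>
    (A @\<^sub>c B) $$ (i, j) = (if j < dim_col A then A $$ (i, j) else B $$ (i, j - dim_col A))"
  by (simp add: append_cols_def)

lemma dims_col_mat [simp]: "dim_row (col_mat v) = dim_vec v" "dim_col (col_mat v) = 1"
  by (simp_all add: col_mat_def)

lemma index_col_mat [simp]: "i < dim_vec v \<Longrightarrow> col_mat v $$ (i, 0) = v $ i"
  by (simp add: col_mat_def mat_of_cols_index)

lemma append_cols_mult_vec: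
  fixes A B :: "real mat"
  assumes "dim_row B = dim_row A" "dim_vec u = dim_col A" "dim_vec v = dim_col B"
  shows "(A @\<^sub>c B) *\<^sub>v (u @\<^sub>v v) = A *\<^sub>v u + B *\<^sub>v v"
proof -
  have "(A @\<^sub>c B) *\<^sub>v (u @\<^sub>v v)
      = (A *\<^sub>v u + B *\<^sub>v v) @\<^sub>v (0\<^sub>m 0 (dim_col A) *\<^sub>v u + 0\<^sub>m 0 (dim_col B) *\<^sub>v v)"
    unfolding append_cols_def using assms
    by (intro four_block_mat_mult_vec[where ?nr1.0 = "dim_row A"]) (auto intro: carrier_matI carrier_vecI)
  then show ?thesis by (auto intro!: eq_vecI)
qed

lemma transpose_append_cols_mult_vec:
  fixes A B :: "real mat"
  assumes "dim_row B = dim_row A" "dim_vec v = dim_row A"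
  shows "(A @\<^sub>c B)\<^sup>T *\<^sub>v v = (A\<^sup>T *\<^sub>v v) @\<^sub>v (B\<^sup>T *\<^sub>v v)"
  using assms by (intro eq_vecI) (auto simp: scalar_prod_def)

lemma append_cols_add:
  fixes A B C D :: "real mat"
  assumes "dim_row B = dim_row A" "dim_row C = dim_row A" "dim_row D = dim_row A"
    "dim_col C = dim_col A" "dim_col D = dim_col B"
  shows "(A + C) @\<^sub>c (B + D) = (A @\<^sub>c B) + (C @\<^sub>c D)"
  using assms by (intro eq_matI) auto

lemma col_mat_mult_vec:
  "dim_vec w = 1 \<Longrightarrow> col_mat v *\<^sub>v w = (w $ 0) \<cdot>\<^sub>v (v :: real vec)"
  by (intro eq_vecI) (auto simp: scalar_prod_def)

lemma frobenius_norm_append_cols_sq: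
  assumes "dim_row B = dim_row A"
  shows "(frobenius_norm (A @\<^sub>c B))\<^sup>2 = (frobenius_norm A)\<^sup>2 + (frobenius_norm B)\<^sup>2"
proof -
  have "(\<Sum>j<dim_col A + dim_col B. ((A @\<^sub>c B) $$ (i, j))\<^sup>2)
      = (\<Sum>j<dim_col A. (A $$ (i, j))\<^sup>2) + (\<Sum>j<dim_col B. (B $$ (i, j))\<^sup>2)" if i: "i < dim_row A" for i
  proof -
    have "(\<Sum>j<dim_col A + dim_col B. ((A @\<^sub>c B) $$ (i, j))\<^sup>2)
        = (\<Sum>j\<in>{0..<dim_col A + dim_col B}. ((A @\<^sub>c B) $$ (i, j))\<^sup>2)" by (simp add: atLeast0LessThan)
    also have "\<dots> = (\<Sum>j\<in>{0..<dim_col A}. ((A @\<^sub>c B) $$ (i, j))\<^sup>2)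
        + (\<Sum>j\<in>{dim_col A..<dim_col A + dim_col B}. ((A @\<^sub>c B) $$ (i, j))\<^sup>2)"
      by (rule sum.atLeastLessThan_concat[symmetric]) simp_all
    also have "(\<Sum>j\<in>{dim_col A..<dim_col A + dim_col B}. ((A @\<^sub>c B) $$ (i, j))\<^sup>2)
        = (\<Sum>j\<in>{0..<dim_col B}. ((A @\<^sub>c B) $$ (i, j + dim_col A))\<^sup>2)"
      using sum.shift_bounds_nat_ivl[of "\<lambda>j. ((A @\<^sub>c B) $$ (i, j))\<^sup>2" 0 "dim_col A" "dim_col B"]
      by (simp add: add.commute)
    finally show ?thesis using i by (simp add: atLeast0LessThan)
  qed
  then show ?thesis by (simp add: frobenius_norm_sq assms sum.distrib)
qed

lemma frobenius_norm_col_mat_sq: "(frobenius_norm (col_mat v))\<^sup>2 = v \<bullet> v"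
  unfolding frobenius_norm_sq scalar_prod_def by (simp add: power2_eq_square atLeast0LessThan)

lemma append_vec_first_last: "dim_vec x = k + l \<Longrightarrow> vec_first x k @\<^sub>v vec_last x l = x"
  by (rule vec_first_last_append) (rule carrier_vecI)

section \<open>The problem as the minimization of a Rayleigh quotient\<close>

definition wtls_quotient :: "real mat \<Rightarrow> real vec \<Rightarrow> real mat \<Rightarrow> real vec \<Rightarrow> real" where
  "wtls_quotient A b W y = ((A *\<^sub>v y - b) \<bullet> (A *\<^sub>v y - b)) / (1 + y \<bullet> (W *\<^sub>v y))"

definition tail_projection :: "nat \<Rightarrow> nat \<Rightarrow> real mat" where
  "tail_projection k l = diag_block_mat [0\<^sub>m k k, 1\<^sub>m l]"

lemma dim_tail_projection [simp]:
  "dim_row (tail_projection k l) = k + l" "dim_col (tail_projection k l) = k + l"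
  by (simp_all add: tail_projection_def diag_block_zero_one del: diag_block_mat.simps)

lemma tail_projection_mult_vec:
  assumes "dim_vec u = k" "dim_vec v = l"
  shows "tail_projection k l *\<^sub>v (u @\<^sub>v v) = 0\<^sub>v k @\<^sub>v v"
proof -
  have "tail_projection k l *\<^sub>v (u @\<^sub>v v) = (0\<^sub>m k k *\<^sub>v u) @\<^sub>v (1\<^sub>m l *\<^sub>v v)"
    unfolding tail_projection_def diag_block_zero_one
    by (rule mult_mat_vec_split) (use assms in \<open>auto intro: carrier_vecI\<close>)
  then show ?thesis using assms by (simp add: mult_mat_vec_linear)
qed

lemma tail_projection_form:
  assumes "dim_vec u = k" "dim_vec v = l"
  shows "(u @\<^sub>v v) \<bullet> (tail_projection k l *\<^sub>v (u @\<^sub>v v)) = v \<bullet> v"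
proof -
  have u: "u \<in> carrier_vec k" and v: "v \<in> carrier_vec l" using assms by (auto intro: carrier_vecI)
  show ?thesis
    unfolding tail_projection_mult_vec[OF assms] scalar_prod_append[OF u v zero_carrier_vec v]
    using u by simp
qed

text \<open>For a fixed \<open>y\<close> the perturbations \<open>[E, f]\<close> that make \<open>y\<close> feasible are those which map
  \<open>(y2, -1)\<close> to \<open>b - A y\<close>. The Cauchy-Schwarz inequality bounds their norm from below, and the rank
  one matrix along \<open>(y2, -1)\<close> attains the bound. So the constrained problem amounts to minimizing
  \<open>\<parallel>A y - b\<parallel>\<^sup>2 / (1 + \<parallel>y2\<parallel>\<^sup>2)\<close>.\<close>

context
  fixes m k l :: nat and A1 A2 :: "real mat" and b :: "real vec"
  assumes A1: "A1 \<in> carrier_mat m k" and A2: "A2 \<in> carrier_mat m l" and b: "b \<in> carrier_vec m"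
begin

private abbreviation "Q \<equiv> wtls_quotient (A1 @\<^sub>c A2) b (tail_projection k l)"

lemma mtls_feasible_lower_bound:
  assumes "mtls_feasible A1 A2 b E f y"
  shows "Q y \<le> (frobenius_norm (E @\<^sub>c col_mat f))\<^sup>2"
proof -
  note [simp] = carrier_matD[OF A1] carrier_matD[OF A2] carrier_vecD[OF b]
  have [simp]: "dim_row E = m" "dim_col E = l" "dim_vec f = m" and y: "dim_vec y = k + l"
    using assms by (auto simp: mtls_feasible_def)
  define y1 y2 where "y1 = vec_first y k" and "y2 = vec_last y l"
  have [simp]: "dim_vec y1 = k" "dim_vec y2 = l" by (simp_all add: y1_def y2_def)
  have y_eq: "y = y1 @\<^sub>v y2" using append_vec_first_last[OF y] by (simp add: y1_def y2_def)
  let ?z = "y2 @\<^sub>v vec 1 (\<lambda>_. - 1)"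
  have feas: "A1 *\<^sub>v y1 + (A2 + E) *\<^sub>v y2 = b + f"
    using assms by (simp add: mtls_feasible_def y1_def y2_def)
  have "- (A1 *\<^sub>v y1 + A2 *\<^sub>v y2 - b) = E *\<^sub>v y2 + (- 1) \<cdot>\<^sub>v f"
  proof (rule eq_vecI)
    fix i assume "i < dim_vec (E *\<^sub>v y2 + (- 1) \<cdot>\<^sub>v f)"
    then have i: "i < m" by simp
    show "(- (A1 *\<^sub>v y1 + A2 *\<^sub>v y2 - b)) $ i = (E *\<^sub>v y2 + (- 1) \<cdot>\<^sub>v f) $ i"
      using arg_cong[OF feas, of "\<lambda>w. w $ i"] i by (simp add: mult_mat_vec_linear)
  qed simp
  then have "- ((A1 @\<^sub>c A2) *\<^sub>v y - b) = (E @\<^sub>c col_mat f) *\<^sub>v ?z"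
    by (simp add: y_eq append_cols_mult_vec col_mat_mult_vec)
  then have "vnorm ((A1 @\<^sub>c A2) *\<^sub>v y - b) \<le> frobenius_norm (E @\<^sub>c col_mat f) * vnorm ?z"
    using vnorm_mult_mat_vec_le[of ?z "E @\<^sub>c col_mat f"] vnorm_uminus[of "(A1 @\<^sub>c A2) *\<^sub>v y - b"] by simp
  then have "(vnorm ((A1 @\<^sub>c A2) *\<^sub>v y - b))\<^sup>2 \<le> (frobenius_norm (E @\<^sub>c col_mat f))\<^sup>2 * (vnorm ?z)\<^sup>2"
    using power_mono[of _ _ 2] by (fastforce simp: power_mult_distrib)
  moreover have "(vnorm ?z)\<^sup>2 = 1 + y \<bullet> (tail_projection k l *\<^sub>v y)"
  proof -
    have "vec 1 (\<lambda>_. - 1) \<bullet> vec 1 (\<lambda>_. - 1) = (1 :: real)" by (simp add: scalar_prod_def)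
    then show ?thesis unfolding vnorm_append_sq y_eq by (simp add: tail_projection_form vnorm_sq)
  qed
  moreover have "0 < 1 + y \<bullet> (tail_projection k l *\<^sub>v y)"
    unfolding y_eq using scalar_prod_self_nonneg[of y2] by (simp add: tail_projection_form)
  ultimately show ?thesis by (simp add: wtls_quotient_def vnorm_sq pos_divide_le_eq)
qed

lemma mtls_feasible_attained:
  assumes y: "dim_vec y = k + l"
  obtains E f where "mtls_feasible A1 A2 b E f y" "(frobenius_norm (E @\<^sub>c col_mat f))\<^sup>2 = Q y"
proof -
  note [simp] = carrier_matD[OF A1] carrier_matD[OF A2] carrier_vecD[OF b]
  define y1 y2 where "y1 = vec_first y k" and "y2 = vec_last y l"
  have [simp]: "dim_vec y1 = k" "dim_vec y2 = l" by (simp_all add: y1_def y2_def)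
  have y_eq: "y = y1 @\<^sub>v y2" using append_vec_first_last[OF y] by (simp add: y1_def y2_def)
  define r g where "r = A1 *\<^sub>v y1 + A2 *\<^sub>v y2 - b" and "g = 1 + y2 \<bullet> y2"
  have g: "0 < g" using scalar_prod_self_nonneg[of y2] by (simp add: g_def)
  have [simp]: "dim_vec r = m" by (simp add: r_def)
  define E f where "E = mat m l (\<lambda>(i, j). - (r $ i * y2 $ j / g))" and "f = (1 / g) \<cdot>\<^sub>v r"
  have [simp]: "dim_row E = m" "dim_col E = l" "dim_vec f = m" by (simp_all add: E_def f_def)
  have Ey: "(E *\<^sub>v y2) $ i = - (r $ i * (y2 \<bullet> y2) / g)" if "i < m" for i
    using that by (simp add: E_def scalar_prod_def sum_distrib_left sum_divide_distrib sum_negf mult_ac)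
  have "A1 *\<^sub>v y1 + (A2 + E) *\<^sub>v y2 = b + f"
  proof (rule eq_vecI)
    fix i assume "i < dim_vec (b + f)"
    then have i: "i < m" by simp
    have "(A1 *\<^sub>v y1) $ i + (A2 *\<^sub>v y2) $ i = b $ i + r $ i" using i by (simp add: r_def)
    moreover have "r $ i = (E *\<^sub>v y2) $ i * (- 1) + f $ i"
      using Ey[OF i] g i by (simp add: f_def g_def field_simps)
    ultimately show "(A1 *\<^sub>v y1 + (A2 + E) *\<^sub>v y2) $ i = (b + f) $ i"
      using i by (simp add: add_mat_mult_vec)
  qed simp
  then have feas: "mtls_feasible A1 A2 b E f y"
    using y by (auto simp: mtls_feasible_def y1_def y2_def intro: carrier_matI carrier_vecI)
  have "(frobenius_norm E)\<^sup>2 = (r \<bullet> r) * (y2 \<bullet> y2) / g\<^sup>2"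
  proof -
    have "(frobenius_norm E)\<^sup>2 = (\<Sum>i<m. \<Sum>j<l. (r $ i * r $ i) * (y2 $ j * y2 $ j) / g\<^sup>2)"
      by (simp add: frobenius_norm_sq) (simp add: E_def power2_eq_square mult_ac)
    also have "\<dots> = (r \<bullet> r) * (y2 \<bullet> y2) / g\<^sup>2"
      by (simp add: scalar_prod_def sum_product sum_divide_distrib atLeast0LessThan)
    finally show ?thesis .
  qed
  moreover have "f \<bullet> f = (r \<bullet> r) / g\<^sup>2" by (simp add: f_def power2_eq_square)
  ultimately have "(frobenius_norm (E @\<^sub>c col_mat f))\<^sup>2 = (r \<bullet> r) * g / g\<^sup>2"
    by (simp add: frobenius_norm_append_cols_sq frobenius_norm_col_mat_sq g_def algebra_simps add_divide_distrib)
  also have "\<dots> = Q y"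
    using g unfolding wtls_quotient_def y_eq
    by (simp add: append_cols_mult_vec tail_projection_form power2_eq_square flip: r_def g_def)
  finally show thesis using feas that by blast
qed

lemma mtls_solution_iff:
  "mtls_solution A1 A2 b x \<longleftrightarrow> dim_vec x = k + l \<and> (\<forall>y. dim_vec y = k + l \<longrightarrow> Q x \<le> Q y)"
proof
  assume "mtls_solution A1 A2 b x"
  then obtain E f where feas: "mtls_feasible A1 A2 b E f x"
    and opt: "\<And>E' f' x'. mtls_feasible A1 A2 b E' f' x' \<Longrightarrow>
      frobenius_norm (E @\<^sub>c col_mat f) \<le> frobenius_norm (E' @\<^sub>c col_mat f')"
    unfolding mtls_solution_def by blast
  have "Q x \<le> Q y" if y: "dim_vec y = k + l" for y
  proof -
    obtain E' f' where "mtls_feasible A1 A2 b E' f' y" "(frobenius_norm (E' @\<^sub>c col_mat f'))\<^sup>2 = Q y"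
      using mtls_feasible_attained[OF y] by blast
    then show ?thesis
      using mtls_feasible_lower_bound[OF feas] power_mono[OF opt[of E' f' y], of 2] by simp
  qed
  moreover have "dim_vec x = k + l" using feas A1 A2 by (auto simp: mtls_feasible_def)
  ultimately show "dim_vec x = k + l \<and> (\<forall>y. dim_vec y = k + l \<longrightarrow> Q x \<le> Q y)" by blast
next
  assume x: "dim_vec x = k + l \<and> (\<forall>y. dim_vec y = k + l \<longrightarrow> Q x \<le> Q y)"
  then obtain E f where feas: "mtls_feasible A1 A2 b E f x" "(frobenius_norm (E @\<^sub>c col_mat f))\<^sup>2 = Q x"
    using mtls_feasible_attained[of x] by blast
  have "frobenius_norm (E @\<^sub>c col_mat f) \<le> frobenius_norm (E' @\<^sub>c col_mat f')"
    if "mtls_feasible A1 A2 b E' f' x'" for E' f' x'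
  proof (rule power2_le_imp_le)
    have "dim_vec x' = k + l" using that A1 A2 by (auto simp: mtls_feasible_def)
    then show "(frobenius_norm (E @\<^sub>c col_mat f))\<^sup>2 \<le> (frobenius_norm (E' @\<^sub>c col_mat f'))\<^sup>2"
      using x feas(2) mtls_feasible_lower_bound[OF that] by fastforce
  qed simp
  then show "mtls_solution A1 A2 b x" using feas unfolding mtls_solution_def by blast
qed

end

section \<open>Minimizers of the Rayleigh quotient\<close>

lemma invertible_if_trivial_kernel:
  fixes M :: "real mat"
  assumes M: "M \<in> carrier_mat n n" and ker: "\<And>v. dim_vec v = n \<Longrightarrow> M *\<^sub>v v = 0\<^sub>v n \<Longrightarrow> v = 0\<^sub>v n"
  obtains B where "B \<in> carrier_mat n n" "M * B = 1\<^sub>m n" "B * M = 1\<^sub>m n"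
proof -
  have "det M \<noteq> 0" using det_0_iff_vec_prod_zero[OF M] ker by auto
  then obtain B where "B \<in> carrier_mat n n" "B * M = 1\<^sub>m n" "M * B = 1\<^sub>m n"
    using det_non_zero_imp_unit[OF M, of "()"] by (auto simp: Units_def ring_mat_def)
  then show thesis using that by blast
qed

text \<open>Minimization and perturbation are treated for an arbitrary orthogonal projection \<open>W\<close>.\<close>

locale weighted_tls =
  fixes m n :: nat and A W :: "real mat" and b :: "real vec"
  assumes A: "A \<in> carrier_mat m n" and b: "b \<in> carrier_vec m" and W: "W \<in> carrier_mat n n"
    and W_sym: "W\<^sup>T = W" and W_idem: "W * W = W"
begin

abbreviation "Q \<equiv> wtls_quotient A b W"

abbreviation "minimizer x \<equiv> dim_vec x = n \<and> (\<forall>y. dim_vec y = n \<longrightarrow> Q x \<le> Q y)"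

lemma dims [simp]: "dim_row A = m" "dim_col A = n" "dim_vec b = m" "dim_row W = n" "dim_col W = n"
  using A b W by auto

lemma W_adjoint: "dim_vec u = n \<Longrightarrow> dim_vec v = n \<Longrightarrow> u \<bullet> (W *\<^sub>v v) = (W *\<^sub>v u) \<bullet> v"
  using scalar_prod_transpose_right[of u W v] by (simp add: W_sym)

lemma W_commute: "dim_vec u = n \<Longrightarrow> dim_vec v = n \<Longrightarrow> u \<bullet> (W *\<^sub>v v) = v \<bullet> (W *\<^sub>v u)"
  using W_adjoint[of u v] scalar_prod_comm[of "W *\<^sub>v u" v] by simp

lemma W_form:
  assumes "dim_vec v = n"
  shows "v \<bullet> (W *\<^sub>v v) = (W *\<^sub>v v) \<bullet> (W *\<^sub>v v)"
proof -
  have "v \<bullet> (W *\<^sub>v v) = v \<bullet> (W *\<^sub>v (W *\<^sub>v v))"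
    using assms by (simp add: W_idem flip: mult_mat_mult_vec)
  then show ?thesis using assms W_adjoint[of v "W *\<^sub>v v"] by simp
qed

lemma W_form_nonneg: "dim_vec v = n \<Longrightarrow> 0 \<le> v \<bullet> (W *\<^sub>v v)"
  by (simp add: W_form scalar_prod_self_nonneg)

lemma W_form_le:
  assumes "dim_vec v = n"
  shows "v \<bullet> (W *\<^sub>v v) \<le> v \<bullet> v"
proof -
  have "0 \<le> (v - W *\<^sub>v v) \<bullet> (v - W *\<^sub>v v)" by (rule scalar_prod_self_nonneg)
  also have "\<dots> = v \<bullet> v - v \<bullet> (W *\<^sub>v v)"
    using assms W_form[OF assms] W_adjoint[OF assms assms]
    by (simp add: scalar_prod_linear)
  finally show ?thesis by simp
qed

lemma vnorm_W_le: "dim_vec v = n \<Longrightarrow> vnorm (W *\<^sub>v v) \<le> vnorm v"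
  using W_form[of v] W_form_le[of v] by (simp add: vnorm_def)

lemma denominator_ge_1: "dim_vec y = n \<Longrightarrow> 1 \<le> 1 + y \<bullet> (W *\<^sub>v y)"
  using W_form_nonneg by simp

lemma residual_sq:
  assumes "dim_vec y = n"
  shows "(A *\<^sub>v y - b) \<bullet> (A *\<^sub>v y - b) = Q y * (1 + y \<bullet> (W *\<^sub>v y))"
  using denominator_ge_1[OF assms] by (simp add: wtls_quotient_def)

lemma Q_le_iff: "dim_vec y = n \<Longrightarrow> Q y \<le> c \<longleftrightarrow> (A *\<^sub>v y - b) \<bullet> (A *\<^sub>v y - b) \<le> c * (1 + y \<bullet> (W *\<^sub>v y))"
  using denominator_ge_1[of y] by (simp add: wtls_quotient_def pos_divide_le_eq)

lemma Q_ge_iff: "dim_vec y = n \<Longrightarrow> c \<le> Q y \<longleftrightarrow> c * (1 + y \<bullet> (W *\<^sub>v y)) \<le> (A *\<^sub>v y - b) \<bullet> (A *\<^sub>v y - b)"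
  using denominator_ge_1[of y] by (simp add: wtls_quotient_def pos_le_divide_eq)

lemma Q_nonneg: "dim_vec y = n \<Longrightarrow> 0 \<le> Q y"
  by (simp add: Q_ge_iff scalar_prod_self_nonneg)

text \<open>The function \<open>y \<mapsto> \<parallel>A y - b\<parallel>\<^sup>2 - \<nu> (1 + y \<bullet> W y)\<close> is quadratic; expanded around a stationary
  point it has no linear term. Existence and uniqueness of minimizers of the quotient are both read
  off from this identity.\<close>

lemma excess_at_stationary_point:
  assumes x[simp]: "dim_vec x = n" and h[simp]: "dim_vec h = n"
    and stat: "A\<^sup>T *\<^sub>v (A *\<^sub>v x - b) = \<nu> \<cdot>\<^sub>v (W *\<^sub>v x)"
  shows "(A *\<^sub>v (x + h) - b) \<bullet> (A *\<^sub>v (x + h) - b) - \<nu> * (1 + (x + h) \<bullet> (W *\<^sub>v (x + h)))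
    = ((A *\<^sub>v x - b) \<bullet> (A *\<^sub>v x - b) - \<nu> * (1 + x \<bullet> (W *\<^sub>v x)))
      + ((A *\<^sub>v h) \<bullet> (A *\<^sub>v h) - \<nu> * (h \<bullet> (W *\<^sub>v h)))"
proof -
  define r where "r = A *\<^sub>v x - b"
  have [simp]: "dim_vec r = m" by (simp add: r_def)
  have "(A *\<^sub>v h) \<bullet> r = \<nu> * (h \<bullet> (W *\<^sub>v x))"
    using scalar_prod_transpose_right[of h A r] stat by (simp add: r_def)
  moreover have "A *\<^sub>v (x + h) - b = r + A *\<^sub>v h"
    by (rule eq_vecI) (simp_all add: r_def mult_mat_vec_linear)
  ultimately show ?thesis
    using W_commute[of x h]
    by (simp add: mult_mat_vec_linear scalar_prod_linear scalar_prod_comm[of r "A *\<^sub>v h"] algebra_simps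
        flip: r_def)
qed

text \<open>The quadratic function with \<open>\<nu> = Q x\<close> is nonnegative and vanishes at \<open>x\<close>; along each line through
  \<open>x\<close> its first derivative is zero and its second derivative is nonnegative.\<close>

lemma minimizer_stationary:
  assumes x: "minimizer x"
  shows "A\<^sup>T *\<^sub>v (A *\<^sub>v x - b) = Q x \<cdot>\<^sub>v (W *\<^sub>v x)"
    and "dim_vec h = n \<Longrightarrow> Q x * (h \<bullet> (W *\<^sub>v h)) \<le> (A *\<^sub>v h) \<bullet> (A *\<^sub>v h)"
proof -
  have [simp]: "dim_vec x = n" using x by simp
  define r where "r = A *\<^sub>v x - b"
  have [simp]: "dim_vec r = m" by (simp add: r_def)
  have expand: "0 \<le> 2 * t * ((A *\<^sub>v h) \<bullet> r - Q x * (h \<bullet> (W *\<^sub>v x)))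
      + t\<^sup>2 * ((A *\<^sub>v h) \<bullet> (A *\<^sub>v h) - Q x * (h \<bullet> (W *\<^sub>v h)))" if [simp]: "dim_vec h = n" for h t
  proof -
    have res: "A *\<^sub>v (x + t \<cdot>\<^sub>v h) - b = r + t \<cdot>\<^sub>v (A *\<^sub>v h)"
      by (rule eq_vecI) (simp_all add: r_def mult_mat_vec_linear)
    have "Q x * (1 + (x + t \<cdot>\<^sub>v h) \<bullet> (W *\<^sub>v (x + t \<cdot>\<^sub>v h))) \<le> (r + t \<cdot>\<^sub>v (A *\<^sub>v h)) \<bullet> (r + t \<cdot>\<^sub>v (A *\<^sub>v h))"
      using x Q_ge_iff[of "x + t \<cdot>\<^sub>v h" "Q x"] by (simp flip: res)
    then show ?thesis
      using W_commute[of x h] residual_sq[of x]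
      by (simp add: mult_mat_vec_linear scalar_prod_linear scalar_prod_comm[of r "A *\<^sub>v h"] algebra_simps
          power2_eq_square flip: r_def)
  qed
  show "A\<^sup>T *\<^sub>v (A *\<^sub>v x - b) = Q x \<cdot>\<^sub>v (W *\<^sub>v x)"
  proof (rule vec_eq_by_scalar_prod)
    fix h :: "real vec" assume "dim_vec h = dim_vec (Q x \<cdot>\<^sub>v (W *\<^sub>v x))"
    then have [simp]: "dim_vec h = n" by simp
    show "h \<bullet> (A\<^sup>T *\<^sub>v (A *\<^sub>v x - b)) = h \<bullet> (Q x \<cdot>\<^sub>v (W *\<^sub>v x))"
      using linear_term_vanishes(1)[OF expand[of h]] by (simp add: scalar_prod_transpose_right flip: r_def)
  qed simp
  show "Q x * (h \<bullet> (W *\<^sub>v h)) \<le> (A *\<^sub>v h) \<bullet> (A *\<^sub>v h)" if "dim_vec h = n"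
    using linear_term_vanishes(2)[OF expand[OF that]] by simp
qed

text \<open>Equivalently, \<open>(x, -1)\<close> is a null vector of \<open>[A, b]\<^sup>T [A, b] - Q x \<cdot> diag(W, 1)\<close>.\<close>

lemma minimizer_residual_product:
  assumes x: "minimizer x" and z[simp]: "dim_vec z = n"
  shows "(A *\<^sub>v x - b) \<bullet> (A *\<^sub>v z - b) = Q x * (1 + z \<bullet> (W *\<^sub>v x))"
proof -
  have [simp]: "dim_vec x = n" using x by simp
  define r where "r = A *\<^sub>v x - b"
  have [simp]: "dim_vec r = m" by (simp add: r_def)
  have stat: "(A *\<^sub>v h) \<bullet> r = Q x * (h \<bullet> (W *\<^sub>v x))" if "dim_vec h = n" for h
    using scalar_prod_transpose_right[of h A r] minimizer_stationary(1)[OF x] that by (simp add: r_def)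
  have "b = A *\<^sub>v x - r" by (rule eq_vecI) (simp_all add: r_def)
  then have "r \<bullet> b = (A *\<^sub>v x) \<bullet> r - r \<bullet> r"
    by (simp add: scalar_prod_linear scalar_prod_comm[of r "A *\<^sub>v x"])
  then show ?thesis
    using stat[of x] stat[of z] residual_sq[of x]
    by (simp add: scalar_prod_linear scalar_prod_comm[of r "A *\<^sub>v z"] algebra_simps flip: r_def)
qed

text \<open>Let \<open>\<nu>\<close> be the infimum of the quotient. By definiteness the quadratic function
  \<open>f(z) = \<parallel>A z - b\<parallel>\<^sup>2 - \<nu> (1 + z \<bullet> W z)\<close> has a stationary point \<open>y\<close>, obtained from a linear system. If
  \<open>f(y)\<close> were positive, then \<open>f(z)\<close> would exceed a fixed positive multiple of \<open>1 + z \<bullet> W z\<close> for all \<open>z\<close>,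
  and \<open>\<nu>\<close> would not be the infimum. Hence \<open>f(y) \<le> 0\<close>, so that \<open>y\<close> is a minimizer. This argument
  replaces compactness.\<close>

lemma minimizer_exists:
  assumes c: "0 < c" and x0: "dim_vec x0 = n"
    and pd0: "\<And>h. dim_vec h = n \<Longrightarrow> c * (h \<bullet> h) \<le> (A *\<^sub>v h) \<bullet> (A *\<^sub>v h) - Q x0 * (h \<bullet> (W *\<^sub>v h))"
  shows "\<exists>!x. minimizer x"
proof -
  define \<nu> where "\<nu> = (INF y\<in>{y. dim_vec y = n}. Q y)"
  have bdd: "bdd_below (Q ` {y. dim_vec y = n})"
    by (rule bdd_belowI[of _ 0]) (auto simp: Q_nonneg)
  have \<nu>_le: "\<nu> \<le> Q y" if "dim_vec y = n" for y
    unfolding \<nu>_def using that by (intro cINF_lower bdd) simp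
  have pd: "c * (h \<bullet> h) \<le> (A *\<^sub>v h) \<bullet> (A *\<^sub>v h) - s * (h \<bullet> (W *\<^sub>v h))"
    if h: "dim_vec h = n" and s: "s \<le> Q x0" for h s
    using pd0[OF h] mult_right_mono[OF s W_form_nonneg[OF h]] by linarith
  define M where "M = A\<^sup>T * A - \<nu> \<cdot>\<^sub>m W"
  have M: "M \<in> carrier_mat n n" by (auto simp: M_def intro: carrier_matI)
  have M_mult: "M *\<^sub>v v = A\<^sup>T *\<^sub>v (A *\<^sub>v v) - \<nu> \<cdot>\<^sub>v (W *\<^sub>v v)" if "dim_vec v = n" for v
    using that by (simp add: M_def mult_mat_vec_linear)
  have "v = 0\<^sub>v n" if v[simp]: "dim_vec v = n" and "M *\<^sub>v v = 0\<^sub>v n" for v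
  proof -
    have "v \<bullet> (M *\<^sub>v v) = 0" using that(2) by (simp add: scalar_prod_right_zero[OF carrier_vecI])
    then have "(A *\<^sub>v v) \<bullet> (A *\<^sub>v v) - \<nu> * (v \<bullet> (W *\<^sub>v v)) = 0"
      by (simp add: M_mult scalar_prod_linear scalar_prod_transpose_right)
    then have "c * (v \<bullet> v) \<le> 0" using pd[OF v \<nu>_le[OF x0]] by simp
    then have "v \<bullet> v = 0" using c scalar_prod_self_nonneg[of v] by (simp add: mult_le_0_iff)
    then show ?thesis by (simp add: scalar_prod_self_eq_0)
  qed
  then obtain B where B: "B \<in> carrier_mat n n" "M * B = 1\<^sub>m n"
    using invertible_if_trivial_kernel[OF M] by metis
  define y where "y = B *\<^sub>v (A\<^sup>T *\<^sub>v b)"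
  have [simp]: "dim_vec y = n" using B by (simp add: y_def)
  have "M *\<^sub>v y = (M * B) *\<^sub>v (A\<^sup>T *\<^sub>v b)" 
    unfolding y_def by (rule mult_mat_mult_vec[symmetric]) (use B M in auto)
  then have My: "A\<^sup>T *\<^sub>v b = A\<^sup>T *\<^sub>v (A *\<^sub>v y) - \<nu> \<cdot>\<^sub>v (W *\<^sub>v y)"
    by (simp add: B one_mat_mult_vec M_mult)
  have cancel: "p - (p - q) = q" if "dim_vec p = n" "dim_vec q = n" for p q :: "real vec"
    using that by (intro eq_vecI) simp_all
  have stat: "A\<^sup>T *\<^sub>v (A *\<^sub>v y - b) = \<nu> \<cdot>\<^sub>v (W *\<^sub>v y)"
    by (simp add: mult_mat_vec_diff My cancel)
  define s where "s = (A *\<^sub>v y - b) \<bullet> (A *\<^sub>v y - b) - \<nu> * (1 + y \<bullet> (W *\<^sub>v y))"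
  have "s \<le> 0"
  proof (rule ccontr)
    assume "\<not> s \<le> 0"
    then have s: "0 < s" by simp
    \<comment> \<open>With \<open>h = z - y\<close> one has \<open>1 + z \<bullet> W z \<le> K + 2 (h \<bullet> h)\<close>. The two bounds on \<open>\<tau>\<close> let \<open>\<tau> K\<close> be
      absorbed by \<open>s\<close> and \<open>2 \<tau> (h \<bullet> h)\<close> by the definite form.\<close>
    define K where "K = 1 + 2 * (y \<bullet> y)"
    have K: "1 \<le> K" using scalar_prod_self_nonneg[of y] by (simp add: K_def)
    define \<tau> where "\<tau> = min (s / K) (c / 2)"
    have \<tau>: "0 < \<tau>" "\<tau> * K \<le> s" "2 * \<tau> \<le> c"
      using s c K by (auto simp: \<tau>_def min_def field_simps)
    have "\<nu> + \<tau> \<le> Q z" if z[simp]: "dim_vec z = n" for z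
    proof -
      define h where "h = z - y"
      have [simp]: "dim_vec h = n" and zh: "z = y + h" by (auto simp: h_def intro!: eq_vecI)
      have "(A *\<^sub>v z - b) \<bullet> (A *\<^sub>v z - b) - \<nu> * (1 + z \<bullet> (W *\<^sub>v z))
          = s + ((A *\<^sub>v h) \<bullet> (A *\<^sub>v h) - \<nu> * (h \<bullet> (W *\<^sub>v h)))"
        unfolding zh s_def by (rule excess_at_stationary_point[OF _ _ stat]) simp_all
      moreover have "c * (h \<bullet> h) \<le> (A *\<^sub>v h) \<bullet> (A *\<^sub>v h) - \<nu> * (h \<bullet> (W *\<^sub>v h))"
        by (rule pd) (simp_all add: \<nu>_le x0)
      moreover have "\<tau> * (1 + z \<bullet> (W *\<^sub>v z)) \<le> s + c * (h \<bullet> h)"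
      proof -
        have "z \<bullet> (W *\<^sub>v z) \<le> z \<bullet> z" by (rule W_form_le) simp
        also have "\<dots> \<le> 2 * (y \<bullet> y) + 2 * (h \<bullet> h)"
          using scalar_prod_self_nonneg[of "y - h"] unfolding zh
          by (simp add: scalar_prod_linear scalar_prod_comm[of h y])
        finally have "\<tau> * (1 + z \<bullet> (W *\<^sub>v z)) \<le> \<tau> * (K + 2 * (h \<bullet> h))"
          using \<tau>(1) by (simp add: K_def)
        also have "\<dots> \<le> s + c * (h \<bullet> h)"
          using \<tau>(2) mult_right_mono[OF \<tau>(3) scalar_prod_self_nonneg[of h]] by (simp add: algebra_simps)
        finally show ?thesis .
      qed
      ultimately show ?thesis by (simp add: Q_ge_iff algebra_simps)
    qed
    then have "\<nu> + \<tau> \<le> (INF y\<in>{y. dim_vec y = n}. Q y)"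
      using x0 by (intro cINF_greatest) auto
    with \<tau>(1) show False by (simp flip: \<nu>_def)
  qed
  then have "Q y \<le> \<nu>" by (simp add: Q_le_iff s_def)
  then have y: "minimizer y" using \<nu>_le order_trans by auto
  show ?thesis
  proof (rule ex1I)
    show "minimizer y" by (rule y)
    fix x assume x: "minimizer x"
    define h where "h = x - y"
    have [simp]: "dim_vec x = n" using x by simp
    have [simp]: "dim_vec h = n" and xh: "x = y + h" by (auto simp: h_def intro!: eq_vecI)
    have "Q x = Q y" using x y by (intro antisym) simp_all
    then have "0 = (A *\<^sub>v h) \<bullet> (A *\<^sub>v h) - Q y * (h \<bullet> (W *\<^sub>v h))"
      using excess_at_stationary_point[OF _ _ minimizer_stationary(1)[OF y], of h] residual_sq[of x] residual_sq[of y]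
      by (simp flip: xh)
    then have "c * (h \<bullet> h) \<le> 0" using pd[of h "Q y"] y x0 by simp
    then have "h \<bullet> h = 0" using c scalar_prod_self_nonneg[of h] by (simp add: mult_le_0_iff)
    then show "x = y" unfolding xh by (auto simp: scalar_prod_self_eq_0 intro!: eq_vecI)
  qed
qed

end

section \<open>Differentiability of the minimizer\<close>

locale tls_minimizer = weighted_tls +
  fixes x :: "real vec" and c :: real
  assumes x_min: "minimizer x" and c: "0 < c"
    and pd: "dim_vec h = n \<Longrightarrow> c * (h \<bullet> h) \<le> (A *\<^sub>v h) \<bullet> (A *\<^sub>v h) - Q x * (h \<bullet> (W *\<^sub>v h))"
begin

abbreviation "r \<equiv> A *\<^sub>v x - b"
abbreviation "a \<equiv> frobenius_norm A"
abbreviation "X \<equiv> 1 + vnorm x"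
abbreviation "\<rho> \<equiv> vnorm r"
abbreviation "N1 \<equiv> 2 * \<rho> * X + X\<^sup>2"

lemma x_dim [simp]: "dim_vec x = n"
  using x_min by simp

text \<open>For a perturbation of size \<open>\<delta>\<close>, the perturbed minimizer has norm at most \<open>Y\<close> and a residual of
  norm at most \<open>R\<close>; the minimal value changes by at most \<open>N \<delta>\<close> and the minimizer by at most \<open>H \<delta>\<close>; the
  remainders of their first order expansions are at most \<open>S \<delta>\<^sup>2\<close> and \<open>T \<delta>\<^sup>2\<close>, the latter after
  multiplication by \<open>P\<close>. All constants depend on the unperturbed data alone, as a derivative requires.\<close>

definition "Y = 2 * (a + 1) * (vnorm b + 1) / c"
definition "R = (a + 1) * Y + vnorm b + 1"
definition "N = N1 + 2 * R * (Y + 1) + (Y + 1)\<^sup>2"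
definition "H = 2 * (\<rho> + a * X + X + N * X) / c"
definition "S = X\<^sup>2 + a * H * X + H * (\<rho> + X) + N * H * X"
definition "T = X + S * X + 2 * a * H + H + N * H"

lemma constants_nonneg: "0 \<le> Y" "0 \<le> R" "0 \<le> N" "0 \<le> H" "0 \<le> S" "0 \<le> T"
proof -
  show Y: "0 \<le> Y" unfolding Y_def using c by simp
  then show R: "0 \<le> R" unfolding R_def by simp
  then show N: "0 \<le> N" unfolding N_def using Y by simp
  then show H: "0 \<le> H" unfolding H_def using c by simp
  then show S: "0 \<le> S" unfolding S_def using N by simp
  then show "0 \<le> T" unfolding T_def using N H by simp
qed

end

locale perturbed_tls = tls_minimizer +
  fixes \<delta> :: real and E :: "real mat" and d :: "real vec"
  assumes E: "E \<in> carrier_mat m n" and d: "d \<in> carrier_vec m"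
    and \<delta>: "0 \<le> \<delta>" "\<delta> \<le> 1" and E_le: "frobenius_norm E \<le> \<delta>" and d_le: "vnorm d \<le> \<delta>"
begin

sublocale pert: weighted_tls m n "A + E" W "b + d"
  using A b W W_sym W_idem E d by unfold_locales auto

abbreviation "w \<equiv> E *\<^sub>v x - d"

lemma pdims [simp]: "dim_row E = m" "dim_col E = n" "dim_vec d = m"
  using E d by auto

lemma E_bound: "dim_vec v = n \<Longrightarrow> vnorm v \<le> \<beta> \<Longrightarrow> vnorm (E *\<^sub>v v) \<le> \<delta> * \<beta>"
  by (rule vnorm_mult_bound) (simp_all add: E_le)

lemma Et_bound: "dim_vec v = m \<Longrightarrow> vnorm v \<le> \<beta> \<Longrightarrow> vnorm (E\<^sup>T *\<^sub>v v) \<le> \<delta> * \<beta>"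
  by (rule vnorm_transpose_mult_bound) (simp_all add: E_le)

lemma residual_change_bound:
  assumes "dim_vec v = n" "vnorm v \<le> \<beta>"
  shows "vnorm (E *\<^sub>v v - d) \<le> \<delta> * (\<beta> + 1)"
  using vnorm_diff_bound[of "E *\<^sub>v v" d, OF _ E_bound[OF assms] d_le] by (simp add: algebra_simps)

lemma w_bound: "vnorm w \<le> \<delta> * X"
  using residual_change_bound[of x "vnorm x"] by (simp add: add.commute)

lemma residual_split: "(A + E) *\<^sub>v x - (b + d) = r + w"
  by (rule eq_vecI) (simp_all add: mult_mat_vec_linear)

lemma \<delta>_sq: "\<delta>\<^sup>2 \<le> \<delta>" 
  using \<delta> by (simp add: power2_eq_square mult_left_le)

text \<open>An upper bound on the perturbed minimal value, from the competitor \<open>x\<close>. Definiteness of the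
  perturbed problem rests on it; definiteness bounds the perturbed minimizer, and that in turn gives
  the lower bound.\<close>

lemma quotient_increase: "pert.Q x \<le> Q x + N1 * \<delta>"
proof -
  let ?g = "1 + x \<bullet> (W *\<^sub>v x)"
  have "(r + w) \<bullet> (r + w) = r \<bullet> r + 2 * (r \<bullet> w) + w \<bullet> w"
    by (rule scalar_prod_add_self) simp
  also have "\<dots> \<le> Q x * ?g + N1 * \<delta>"
  proof -
    have "r \<bullet> w \<le> \<rho> * (\<delta> * X)"
      using abs_scalar_prod_bound[of r w \<rho>, OF _ _ w_bound] by simp
    moreover have "w \<bullet> w \<le> (\<delta> * X) * (\<delta> * X)"
      using abs_scalar_prod_bound[of w w, OF _ w_bound w_bound] by simp
    moreover have "(\<delta> * X) * (\<delta> * X) \<le> X\<^sup>2 * \<delta>"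
      using mult_left_mono[OF \<delta>_sq, of "X\<^sup>2"] by (simp add: power2_eq_square mult_ac)
    ultimately show ?thesis using residual_sq[of x] by (simp add: algebra_simps)
  qed
  also have "\<dots> \<le> (Q x + N1 * \<delta>) * ?g"
  proof -
    have "0 \<le> N1 * \<delta>" using \<delta> by simp
    then have "N1 * \<delta> * 1 \<le> N1 * \<delta> * ?g" using W_form_nonneg[of x] by (intro mult_left_mono) simp_all
    then show ?thesis by (simp add: algebra_simps)
  qed
  finally show ?thesis by (simp add: pert.Q_le_iff residual_split)
qed

lemma definite_stable:
  assumes small: "2 * (2 * a + N1) * \<delta> \<le> c" and \<nu>: "\<nu> \<le> Q x + N1 * \<delta>" and h[simp]: "dim_vec h = n"
  shows "(c / 2) * (h \<bullet> h) \<le> ((A + E) *\<^sub>v h) \<bullet> ((A + E) *\<^sub>v h) - \<nu> * (h \<bullet> (W *\<^sub>v h))"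
proof -
  have hh: "vnorm h * vnorm h = h \<bullet> h" by (rule vnorm_mult_self)
  have "\<bar>(A *\<^sub>v h) \<bullet> (E *\<^sub>v h)\<bar> \<le> (a * vnorm h) * (\<delta> * vnorm h)"
    by (intro abs_scalar_prod_bound vnorm_mult_bound E_bound) simp_all
  then have "- (a * \<delta> * (h \<bullet> h)) \<le> (A *\<^sub>v h) \<bullet> (E *\<^sub>v h)"
    unfolding hh[symmetric] by (simp add: mult_ac abs_le_iff)
  moreover have "((A + E) *\<^sub>v h) \<bullet> ((A + E) *\<^sub>v h)
      = (A *\<^sub>v h) \<bullet> (A *\<^sub>v h) + 2 * ((A *\<^sub>v h) \<bullet> (E *\<^sub>v h)) + (E *\<^sub>v h) \<bullet> (E *\<^sub>v h)"
    by (simp add: mult_mat_vec_linear scalar_prod_linear scalar_prod_comm[of "E *\<^sub>v h" "A *\<^sub>v h"])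
  moreover have "\<nu> * (h \<bullet> (W *\<^sub>v h)) \<le> Q x * (h \<bullet> (W *\<^sub>v h)) + N1 * \<delta> * (h \<bullet> h)"
  proof -
    have "\<nu> * (h \<bullet> (W *\<^sub>v h)) \<le> (Q x + N1 * \<delta>) * (h \<bullet> (W *\<^sub>v h))"
      using \<nu> by (rule mult_right_mono) (simp add: W_form_nonneg)
    moreover have "N1 * \<delta> * (h \<bullet> (W *\<^sub>v h)) \<le> N1 * \<delta> * (h \<bullet> h)"
      using \<delta> by (intro mult_left_mono W_form_le) simp_all
    ultimately show ?thesis by (simp add: algebra_simps)
  qed
  moreover have "2 * (2 * a + N1) * \<delta> * (h \<bullet> h) \<le> c * (h \<bullet> h)"
    using small by (rule mult_right_mono) (rule scalar_prod_self_nonneg)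
  ultimately show ?thesis
    using pd[OF h] scalar_prod_self_nonneg[of "E *\<^sub>v h"] by (simp add: algebra_simps)
qed

lemma perturbed_minimizer_exists:
  assumes small: "2 * (2 * a + N1) * \<delta> \<le> c"
  shows "\<exists>!y. pert.minimizer y"
  using c definite_stable[OF small quotient_increase] by (intro pert.minimizer_exists[of "c / 2" x]) simp_all

context
  fixes y :: "real vec"
  assumes small: "2 * (2 * a + N1) * \<delta> \<le> c" and y_min: "pert.minimizer y"
begin

private abbreviation "\<mu> \<equiv> Q x"
private abbreviation "\<nu> \<equiv> pert.Q y"
private abbreviation "h \<equiv> y - x"
private abbreviation "r' \<equiv> (A + E) *\<^sub>v y - (b + d)"

lemma y_dim [simp]: "dim_vec y = n"
  using y_min by simp

lemma \<nu>_upper: "\<nu> \<le> \<mu> + N1 * \<delta>"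
proof -
  have "\<nu> \<le> pert.Q x" using y_min x_dim by blast
  then show ?thesis using quotient_increase by linarith
qed

lemma definite_y: "dim_vec z = n \<Longrightarrow>
    (c / 2) * (z \<bullet> z) \<le> ((A + E) *\<^sub>v z) \<bullet> ((A + E) *\<^sub>v z) - \<nu> * (z \<bullet> (W *\<^sub>v z))"
  by (rule definite_stable[OF small \<nu>_upper])

text \<open>Definiteness as a stability estimate for the linear system with matrix
  \<open>(A + E)\<^sup>T (A + E) - \<nu> W\<close>, in weak form.\<close>

lemma bound_from_definiteness:
  assumes z[simp]: "dim_vec z = n" and v: "dim_vec v = n" "vnorm v \<le> \<beta>"
    and eq: "((A + E) *\<^sub>v z) \<bullet> ((A + E) *\<^sub>v z) - \<nu> * (z \<bullet> (W *\<^sub>v z)) = z \<bullet> v"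
  shows "vnorm z \<le> 2 * \<beta> / c"
proof -
  have "(c / 2) * (z \<bullet> z) \<le> z \<bullet> v" using definite_y[OF z] eq by simp
  also have "\<dots> \<le> vnorm z * \<beta>" using abs_scalar_prod_bound[of z v "vnorm z" \<beta>] v by simp
  finally have "(c / 2) * (vnorm z * vnorm z) \<le> vnorm z * \<beta>" by (simp add: vnorm_mult_self)
  then have "vnorm z * (c / 2 * vnorm z) \<le> vnorm z * \<beta>" by (simp add: mult_ac)
  moreover have "0 \<le> \<beta>" using vnorm_nonneg[of v] v(2) by linarith
  ultimately show ?thesis
    using c vnorm_nonneg[of z] by (cases "vnorm z = 0") (simp_all add: field_simps)
qed

lemma perturbed_frobenius: "dim_vec v = n \<Longrightarrow> vnorm v \<le> \<beta> \<Longrightarrow> vnorm ((A + E) *\<^sub>v v) \<le> (a + 1) * \<beta>"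
proof -
  assume [simp]: "dim_vec v = n" and v: "vnorm v \<le> \<beta>"
  then have "0 \<le> \<beta>" using vnorm_nonneg[of v] by linarith
  then have "\<delta> * \<beta> \<le> 1 * \<beta>" using \<delta> by (intro mult_right_mono) simp_all
  moreover have "vnorm (A *\<^sub>v v + E *\<^sub>v v) \<le> a * \<beta> + \<delta> * \<beta>"
    by (intro vnorm_add_bound vnorm_mult_bound E_bound) (simp_all add: v)
  ultimately show ?thesis by (simp add: mult_mat_vec_linear algebra_simps)
qed

lemma y_bound: "vnorm y \<le> Y"
proof (cases "vnorm y = 0")
  case True
  then show ?thesis using constants_nonneg by simp
next
  case False
  then have pos: "0 < vnorm y" using vnorm_nonneg[of y] by linarith
  have "((A + E) *\<^sub>v y) \<bullet> r' = \<nu> * (y \<bullet> (W *\<^sub>v y))"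
    using pert.minimizer_stationary(1)[OF y_min] scalar_prod_transpose_right[of y "A + E" r'] by simp
  then have "((A + E) *\<^sub>v y) \<bullet> ((A + E) *\<^sub>v y) - \<nu> * (y \<bullet> (W *\<^sub>v y)) = ((A + E) *\<^sub>v y) \<bullet> (b + d)"
    by (simp add: scalar_prod_diff_right)
  then have "(c / 2) * (y \<bullet> y) \<le> ((A + E) *\<^sub>v y) \<bullet> (b + d)" using definite_y[of y] by simp
  also have "\<dots> \<le> ((a + 1) * vnorm y) * (vnorm b + 1)"
  proof -
    have "\<bar>((A + E) *\<^sub>v y) \<bullet> (b + d)\<bar> \<le> ((a + 1) * vnorm y) * (vnorm b + 1)"
      using d_le \<delta> by (intro abs_scalar_prod_bound perturbed_frobenius vnorm_add_bound) simp_all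
    then show ?thesis by simp
  qed
  finally have "vnorm y * (c / 2 * vnorm y) \<le> vnorm y * ((a + 1) * (vnorm b + 1))"
    by (simp add: vnorm_mult_self[symmetric] mult_ac)
  then have "c / 2 * vnorm y \<le> (a + 1) * (vnorm b + 1)" using pos by (simp only: mult_le_cancel_left_pos)
  then show ?thesis using c by (simp add: Y_def field_simps)
qed

text \<open>The lower bound arises by exchanging the roles of the two problems: \<open>y\<close> is a competitor for the
  unperturbed one, with a residual that differs from the perturbed one by \<open>E y - d\<close>.\<close>

lemma value_change: "\<bar>\<nu> - \<mu>\<bar> \<le> N * \<delta>"
proof -
  let ?g = "1 + y \<bullet> (W *\<^sub>v y)" and ?w = "E *\<^sub>v y - d"
  have "vnorm r' \<le> (a + 1) * Y + (vnorm b + 1)"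
    using d_le \<delta> by (intro vnorm_diff_bound perturbed_frobenius vnorm_add_bound y_bound) simp_all
  then have r': "vnorm r' \<le> R" by (simp add: R_def)
  have w: "vnorm ?w \<le> \<delta> * (Y + 1)" by (rule residual_change_bound[OF _ y_bound]) simp
  have "A *\<^sub>v y - b = r' - ?w" by (rule eq_vecI) (simp_all add: mult_mat_vec_linear)
  then have "(A *\<^sub>v y - b) \<bullet> (A *\<^sub>v y - b) = r' \<bullet> r' - 2 * (r' \<bullet> ?w) + ?w \<bullet> ?w"
    by (simp only: scalar_prod_diff_self[of r' ?w] dim_mult_mat_vec index_minus_vec index_add_vec pdims x_dim dims)
  also have "\<dots> \<le> \<nu> * ?g + (2 * R * (Y + 1) + (Y + 1)\<^sup>2) * \<delta>"
  proof -
    have "\<bar>r' \<bullet> ?w\<bar> \<le> R * (\<delta> * (Y + 1))" by (rule abs_scalar_prod_bound[OF _ r' w]) simp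
    moreover have "\<bar>?w \<bullet> ?w\<bar> \<le> (\<delta> * (Y + 1)) * (\<delta> * (Y + 1))" by (rule abs_scalar_prod_bound[OF _ w w]) simp
    moreover have "(\<delta> * (Y + 1)) * (\<delta> * (Y + 1)) \<le> (Y + 1)\<^sup>2 * \<delta>"
      using mult_left_mono[OF \<delta>_sq, of "(Y + 1)\<^sup>2"] by (simp add: power2_eq_square mult_ac)
    moreover have "r' \<bullet> r' = \<nu> * ?g" by (rule pert.residual_sq) simp
    ultimately show ?thesis by (simp add: algebra_simps abs_le_iff)
  qed
  finally have "(A *\<^sub>v y - b) \<bullet> (A *\<^sub>v y - b) \<le> \<nu> * ?g + (2 * R * (Y + 1) + (Y + 1)\<^sup>2) * \<delta>" .
  moreover have "\<mu> * ?g \<le> (A *\<^sub>v y - b) \<bullet> (A *\<^sub>v y - b)"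
    using x_min Q_ge_iff[of y \<mu>] by simp
  ultimately have low: "(\<mu> - \<nu>) * ?g \<le> (2 * R * (Y + 1) + (Y + 1)\<^sup>2) * \<delta>"
    by (simp add: algebra_simps)
  have nn: "0 \<le> (2 * R * (Y + 1) + (Y + 1)\<^sup>2) * \<delta>" "0 \<le> N1 * \<delta>"
    using constants_nonneg \<delta> by simp_all
  have "\<mu> - \<nu> \<le> (2 * R * (Y + 1) + (Y + 1)\<^sup>2) * \<delta>"
  proof (cases "\<mu> \<le> \<nu>")
    case True
    then show ?thesis using nn by linarith
  next
    case False
    then have "(\<mu> - \<nu>) * 1 \<le> (\<mu> - \<nu>) * ?g" using W_form_nonneg[of y] by (intro mult_left_mono) simp_all
    then show ?thesis using order_trans[OF _ low] by simp
  qed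
  then show ?thesis using \<nu>_upper nn unfolding N_def abs_le_iff distrib_right[of _ _ \<delta>] by linarith
qed

text \<open>Subtracting the two stationarity conditions leaves a linear system for \<open>h = y - x\<close> whose
  right hand side is of first order.\<close>

lemma step_equation:
  assumes z[simp]: "dim_vec z = n"
  shows "((A + E) *\<^sub>v z) \<bullet> ((A + E) *\<^sub>v h) - \<nu> * (z \<bullet> (W *\<^sub>v h))
    = z \<bullet> ((\<nu> - \<mu>) \<cdot>\<^sub>v (W *\<^sub>v x) - (E\<^sup>T *\<^sub>v r + (A\<^sup>T *\<^sub>v w + E\<^sup>T *\<^sub>v w)))"
proof -
  define u where "u = w"
  define s where "s = r"
  have [simp]: "dim_vec u = m" "dim_vec s = m" by (simp_all add: u_def s_def)
  have "((A + E) *\<^sub>v z) \<bullet> r' = \<nu> * (z \<bullet> (W *\<^sub>v y))"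
    using pert.minimizer_stationary(1)[OF y_min] scalar_prod_transpose_right[of z "A + E" r'] by simp
  moreover have "(A *\<^sub>v z) \<bullet> s = \<mu> * (z \<bullet> (W *\<^sub>v x))"
    using minimizer_stationary(1)[OF x_min] scalar_prod_transpose_right[of z A s] by (simp add: s_def)
  moreover have "r' = (A + E) *\<^sub>v h + (s + u)"
    by (rule eq_vecI) (simp_all add: u_def s_def mult_mat_vec_linear)
  moreover have "W *\<^sub>v y = W *\<^sub>v h + W *\<^sub>v x"
    by (rule eq_vecI) (simp_all add: mult_mat_vec_diff)
  ultimately show ?thesis
    unfolding u_def[symmetric] s_def[symmetric]
    by (simp add: add_mat_mult_vec[of A E z] scalar_prod_linear scalar_prod_transpose_right algebra_simps)
qed

lemma step_bound: "vnorm h \<le> H * \<delta>"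
proof -
  let ?v = "(\<nu> - \<mu>) \<cdot>\<^sub>v (W *\<^sub>v x) - (E\<^sup>T *\<^sub>v r + (A\<^sup>T *\<^sub>v w + E\<^sup>T *\<^sub>v w))"
  have "vnorm ?v \<le> N * \<delta> * X + (\<delta> * \<rho> + (a * (\<delta> * X) + \<delta> * (\<delta> * X)))"
    using vnorm_W_le[of x]
    by (intro vnorm_diff_bound vnorm_add_bound vnorm_smult_bound value_change Et_bound
        vnorm_transpose_mult_bound w_bound) simp_all
  also have "\<dots> \<le> (\<rho> + a * X + X + N * X) * \<delta>"
    using mult_left_mono[OF \<delta>_sq, of X] by (simp add: algebra_simps power2_eq_square)
  finally have v: "vnorm ?v \<le> (\<rho> + a * X + X + N * X) * \<delta>" .
  have "vnorm h \<le> 2 * ((\<rho> + a * X + X + N * X) * \<delta>) / c"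
    by (rule bound_from_definiteness[OF _ _ v step_equation]) simp_all
  then show ?thesis by (simp only: H_def times_divide_eq_left mult.assoc)
qed

text \<open>The two residuals, tested crosswise against the data of the other problem, yield an exact
  formula for the change of the minimal value, in which every remainder is of second order.\<close>

lemma value_expansion: "\<bar>(\<nu> - \<mu>) - 2 * (r \<bullet> w) / (1 + x \<bullet> (W *\<^sub>v x))\<bar> \<le> S * \<delta>\<^sup>2"
proof -
  define u where "u = w"
  define s where "s = r"
  define k where "k = h"
  have [simp]: "dim_vec u = m" "dim_vec s = m" "dim_vec k = n" by (simp_all add: u_def s_def k_def)
  let ?g = "1 + x \<bullet> (W *\<^sub>v x)"
  have y_eq: "y = x + k" by (rule eq_vecI) (simp_all add: k_def)
  have "r' = (s + u) + (A *\<^sub>v k + E *\<^sub>v k)"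
    by (rule eq_vecI) (simp_all add: u_def s_def k_def mult_mat_vec_linear)
  then have 1: "((s + u) + (A *\<^sub>v k + E *\<^sub>v k)) \<bullet> (s + u) = \<nu> * (1 + x \<bullet> (W *\<^sub>v y))"
    using pert.minimizer_residual_product[OF y_min, of x] residual_split by (simp add: u_def s_def)
  have "A *\<^sub>v y - b = s + A *\<^sub>v k"
    by (rule eq_vecI) (simp_all add: s_def k_def mult_mat_vec_linear)
  then have 2: "s \<bullet> (s + A *\<^sub>v k) = \<mu> * (1 + y \<bullet> (W *\<^sub>v x))"
    using minimizer_residual_product[OF x_min, of y] by (simp add: s_def)
  have eq: "(\<nu> - \<mu>) * ?g - 2 * (s \<bullet> u)
      = u \<bullet> u + (A *\<^sub>v k) \<bullet> u + (E *\<^sub>v k) \<bullet> (s + u) - (\<nu> - \<mu>) * (k \<bullet> (W *\<^sub>v x))"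
    using 1 2 W_commute[of x k] unfolding y_eq
    by (simp add: mult_mat_vec_add scalar_prod_linear scalar_prod_comm[of u s] scalar_prod_comm[of s "A *\<^sub>v k"]
        algebra_simps)
  have "\<bar>(\<nu> - \<mu>) * ?g - 2 * (s \<bullet> u)\<bar> \<le> (\<delta> * X) * (\<delta> * X) + (a * (H * \<delta>)) * (\<delta> * X) + (\<delta> * (H * \<delta>)) * (\<rho> + \<delta> * X)
      + (N * \<delta>) * ((H * \<delta>) * X)"
  proof -
    have k: "vnorm k \<le> H * \<delta>" using step_bound by (simp add: k_def)
    have u: "vnorm u \<le> \<delta> * X" using w_bound by (simp add: u_def)
    have "\<bar>u \<bullet> u\<bar> \<le> (\<delta> * X) * (\<delta> * X)" by (rule abs_scalar_prod_bound[OF _ u u]) simp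
    moreover have "\<bar>(A *\<^sub>v k) \<bullet> u\<bar> \<le> (a * (H * \<delta>)) * (\<delta> * X)"
      by (intro abs_scalar_prod_bound vnorm_mult_bound k u) simp_all
    moreover have "\<bar>(E *\<^sub>v k) \<bullet> (s + u)\<bar> \<le> (\<delta> * (H * \<delta>)) * (\<rho> + \<delta> * X)"
      by (intro abs_scalar_prod_bound E_bound vnorm_add_bound k u) (simp_all add: s_def)
    moreover have "\<bar>(\<nu> - \<mu>) * (k \<bullet> (W *\<^sub>v x))\<bar> \<le> (N * \<delta>) * ((H * \<delta>) * X)"
      unfolding abs_mult
      using vnorm_W_le[of x] constants_nonneg \<delta>
      by (intro mult_mono value_change abs_scalar_prod_bound k) simp_all
    ultimately show ?thesis unfolding eq by linarith
  qed
  also have "\<dots> \<le> S * \<delta>\<^sup>2"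
  proof -
    have "H * \<delta>\<^sup>2 * (X * \<delta>) \<le> H * \<delta>\<^sup>2 * X"
      using \<delta> constants_nonneg by (intro mult_left_mono) (simp_all add: mult_left_le)
    then show ?thesis by (simp add: S_def algebra_simps power2_eq_square)
  qed
  finally have *: "\<bar>(\<nu> - \<mu>) * ?g - 2 * (r \<bullet> w)\<bar> \<le> S * \<delta>\<^sup>2" by (simp add: s_def u_def)
  have g: "1 \<le> ?g" using W_form_nonneg[of x] by simp
  have "\<bar>(\<nu> - \<mu>) - 2 * (r \<bullet> w) / ?g\<bar> = \<bar>(\<nu> - \<mu>) * ?g - 2 * (r \<bullet> w)\<bar> / ?g"
  proof -
    have "(\<nu> - \<mu>) - 2 * (r \<bullet> w) / ?g = ((\<nu> - \<mu>) * ?g - 2 * (r \<bullet> w)) / ?g"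
      using g by (simp add: diff_divide_distrib)
    then show ?thesis using g by simp
  qed
  also have "\<dots> \<le> \<bar>(\<nu> - \<mu>) * ?g - 2 * (r \<bullet> w)\<bar> / 1" using g by (intro divide_left_mono) simp_all
  finally show ?thesis using * by simp
qed

text \<open>In the equation for \<open>h\<close> the perturbed matrix is replaced by \<open>P\<close> and \<open>\<nu> - \<mu>\<close> by its first order
  part; both changes cost second order, because \<open>h\<close> is of first order.\<close>

lemma minimizer_expansion:
  "vnorm ((A\<^sup>T *\<^sub>v (A *\<^sub>v h) - \<mu> \<cdot>\<^sub>v (W *\<^sub>v h))
      - ((2 * (r \<bullet> w) / (1 + x \<bullet> (W *\<^sub>v x))) \<cdot>\<^sub>v (W *\<^sub>v x) - (E\<^sup>T *\<^sub>v r + A\<^sup>T *\<^sub>v w))) \<le> T * \<delta>\<^sup>2"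
proof -
  define t where "t = 2 * (r \<bullet> w) / (1 + x \<bullet> (W *\<^sub>v x))"
  define u where "u = w"
  define s where "s = r"
  define k where "k = h"
  have [simp]: "dim_vec u = m" "dim_vec s = m" "dim_vec k = n" by (simp_all add: u_def s_def k_def)
  let ?rhs = "((\<nu> - \<mu>) - t) \<cdot>\<^sub>v (W *\<^sub>v x) + ((\<nu> - \<mu>) \<cdot>\<^sub>v (W *\<^sub>v k)
      - (E\<^sup>T *\<^sub>v u + (A\<^sup>T *\<^sub>v (E *\<^sub>v k) + (E\<^sup>T *\<^sub>v (A *\<^sub>v k) + E\<^sup>T *\<^sub>v (E *\<^sub>v k)))))"
  let ?lhs = "(A\<^sup>T *\<^sub>v (A *\<^sub>v k) - \<mu> \<cdot>\<^sub>v (W *\<^sub>v k)) - (t \<cdot>\<^sub>v (W *\<^sub>v x) - (E\<^sup>T *\<^sub>v s + A\<^sup>T *\<^sub>v u))"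
  have "?lhs = ?rhs"
  proof (rule vec_eq_by_scalar_prod)
    fix z :: "real vec" assume "dim_vec z = dim_vec ?rhs"
    then have [simp]: "dim_vec z = n" by simp
    show "z \<bullet> ?lhs = z \<bullet> ?rhs"
      using step_equation[of z] unfolding u_def[symmetric] s_def[symmetric] k_def[symmetric]
      by (simp add: add_mat_mult_vec scalar_prod_linear scalar_prod_transpose_right algebra_simps)
  qed simp
  moreover have "vnorm ?rhs \<le> (S * \<delta>\<^sup>2) * X + ((N * \<delta>) * (H * \<delta>)
      + (\<delta> * (\<delta> * X) + (a * (\<delta> * (H * \<delta>)) + (\<delta> * (a * (H * \<delta>)) + \<delta> * (\<delta> * (H * \<delta>))))))"
  proof -
    have k: "vnorm k \<le> H * \<delta>" using step_bound by (simp add: k_def)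
    have u: "vnorm u \<le> \<delta> * X" using w_bound by (simp add: u_def)
    show ?thesis
      using vnorm_W_le[of x] order_trans[OF vnorm_W_le k] value_expansion
      by (intro vnorm_diff_bound vnorm_add_bound vnorm_smult_bound value_change Et_bound E_bound
          vnorm_transpose_mult_bound vnorm_mult_bound[of _ A] k u) (simp_all add: t_def)
  qed
  moreover have "\<dots> \<le> T * \<delta>\<^sup>2"
  proof -
    have "H * \<delta>\<^sup>2 * \<delta> \<le> H * \<delta>\<^sup>2"
      using \<delta> constants_nonneg by (intro mult_left_le) simp_all
    then show ?thesis by (simp add: T_def algebra_simps power2_eq_square)
  qed
  ultimately have "vnorm ?lhs \<le> T * \<delta>\<^sup>2" by simp
  then show ?thesis by (simp only: t_def u_def s_def k_def)
qed

end

end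

section \<open>The Kronecker form of the derivative\<close>

lemma dim_kronecker [simp]:
  "dim_row (A \<otimes>\<^sub>K B) = dim_row A * dim_row B" "dim_col (A \<otimes>\<^sub>K B) = dim_col A * dim_col B"
  by (simp_all add: kronecker_def)

lemma dim_vectorize [simp]: "dim_vec (vectorize M) = dim_row M * dim_col M"
  by (simp add: vectorize_def)

lemma dim_outer_prod [simp]: "dim_row (outer_prod u v) = dim_vec u" "dim_col (outer_prod u v) = dim_vec v"
  by (simp_all add: outer_prod_def)

lemma outer_prod_mult_vec:
  "dim_vec w = dim_vec v \<Longrightarrow> outer_prod u v *\<^sub>v w = (v \<bullet> w) \<cdot>\<^sub>v u"
  by (intro eq_vecI) (auto simp: outer_prod_def scalar_prod_def sum_distrib_left mult_ac)

lemma transpose_outer_prod: "(outer_prod u v)\<^sup>T = outer_prod v u"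
  by (rule eq_matI) (auto simp: outer_prod_def)

lemma sum_div_mod:
  fixes f :: "nat \<Rightarrow> nat \<Rightarrow> real"
  shows "(\<Sum>k\<in>{0..<m * q}. f (k div m) (k mod m)) = (\<Sum>j\<in>{0..<q}. \<Sum>i\<in>{0..<m}. f j i)"
proof (induction q)
  case (Suc q)
  have "(\<Sum>k\<in>{0..<m * Suc q}. f (k div m) (k mod m))
      = (\<Sum>k\<in>{0..<m * q}. f (k div m) (k mod m)) + (\<Sum>k\<in>{m * q..<m * q + m}. f (k div m) (k mod m))"
    by (simp add: sum.atLeastLessThan_concat add.commute)
  also have "(\<Sum>k\<in>{m * q..<m * q + m}. f (k div m) (k mod m)) = (\<Sum>i\<in>{0..<m}. f q i)"
    using sum.shift_bounds_nat_ivl[of "\<lambda>k. f (k div m) (k mod m)" 0 "m * q" m]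
    by (simp add: add.commute)
  finally show ?case using Suc.IH by simp
qed simp

lemma vectorize_scalar_prod:
  fixes M N :: "real mat"
  assumes "dim_row N = dim_row M" "dim_col N = dim_col M"
  shows "vectorize M \<bullet> vectorize N = (\<Sum>j\<in>{0..<dim_col M}. \<Sum>i\<in>{0..<dim_row M}. M $$ (i, j) * N $$ (i, j))"
  using sum_div_mod[of "\<lambda>j i. M $$ (i, j) * N $$ (i, j)" "dim_row M" "dim_col M"] assms
  by (simp add: scalar_prod_def vectorize_def)

lemma vectorize_outer_prod_scalar_prod:
  assumes "dim_vec p = dim_vec s" "dim_vec q = dim_vec t"
  shows "vectorize (outer_prod p q) \<bullet> vectorize (outer_prod s t) = (p \<bullet> s) * (q \<bullet> t)"
  using assms by (simp add: vectorize_scalar_prod)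
    (simp add: outer_prod_def scalar_prod_def sum_product sum.swap[of _ "{0..<dim_vec t}"] mult_ac)

lemma vectorize_append_col:
  "dim_vec d = dim_row E \<Longrightarrow> vectorize (E @\<^sub>c col_mat d) = vectorize E @\<^sub>v d"
proof (rule eq_vecI)
  assume d: "dim_vec d = dim_row E"
  fix k assume "k < dim_vec (vectorize E @\<^sub>v d)"
  then have k: "k < dim_row E * dim_col E + dim_row E" using d by simp
  then have m: "0 < dim_row E" by (cases "dim_row E") simp_all
  show "vectorize (E @\<^sub>c col_mat d) $ k = (vectorize E @\<^sub>v d) $ k"
  proof (cases "k < dim_row E * dim_col E")
    case True
    then have "k div dim_row E < dim_col E" using m by (simp add: div_less_iff_less_mult mult.commute)
    then show ?thesis using True k m d by (simp add: vectorize_def)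
  next
    case False
    define i where "i = k - dim_row E * dim_col E"
    have i: "i < dim_row E" "k = i + dim_row E * dim_col E" using False k by (simp_all add: i_def)
    then have "k div dim_row E = dim_col E" "k mod dim_row E = i" using m by simp_all
    then show ?thesis using False k m d i by (simp add: vectorize_def)
  qed
qed simp

text \<open>On \<open>vec [E, d]\<close> the two Kronecker factors of \<open>K\<close> act as \<open>[E, d] \<mapsto> E x - d\<close> and \<open>E \<mapsto> E\<^sup>T r\<close>.\<close>

lemma kronecker_row_identity_mult_vec:
  "(mat_of_row g \<otimes>\<^sub>K 1\<^sub>m (dim_row D)) *\<^sub>v vectorize D = D *\<^sub>v g" if "dim_vec g = dim_col D"
proof (rule eq_vecI)
  fix i assume "i < dim_vec (D *\<^sub>v g)"
  then have i: "i < dim_row D" by simp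
  let ?m = "dim_row D"
  have "((mat_of_row g \<otimes>\<^sub>K 1\<^sub>m ?m) *\<^sub>v vectorize D) $ i
      = (\<Sum>k\<in>{0..<?m * dim_col D}. g $ (k div ?m) * (if i = k mod ?m then 1 else 0) * D $$ (k mod ?m, k div ?m))"
    using i that by (simp add: scalar_prod_def kronecker_def vectorize_def mult.commute less_mult_imp_div_less cong: if_cong)
  also have "\<dots> = (\<Sum>j\<in>{0..<dim_col D}. \<Sum>l\<in>{0..<?m}. g $ j * (if i = l then 1 else 0) * D $$ (l, j))"
    by (rule sum_div_mod)
  also have "\<dots> = (\<Sum>j\<in>{0..<dim_col D}. g $ j * D $$ (i, j))"
    using i by (intro sum.cong refl) (simp add: if_distrib[of "\<lambda>t. _ * t * _"] if_distrib[of "\<lambda>t. t * _"] if_distrib[of "\<lambda>t. _ * t"] sum.delta cong: if_cong)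
  also have "\<dots> = (D *\<^sub>v g) $ i" using i that by (simp add: scalar_prod_def mult.commute)
  finally show "((mat_of_row g \<otimes>\<^sub>K 1\<^sub>m ?m) *\<^sub>v vectorize D) $ i = (D *\<^sub>v g) $ i" .
qed simp

lemma kronecker_identity_row_mult_vec:
  "(1\<^sub>m (dim_col E) \<otimes>\<^sub>K mat_of_row s) *\<^sub>v vectorize E = E\<^sup>T *\<^sub>v s" if "dim_vec s = dim_row E"
proof (rule eq_vecI)
  fix j assume "j < dim_vec (E\<^sup>T *\<^sub>v s)"
  then have j: "j < dim_col E" by simp
  let ?m = "dim_row E"
  have "((1\<^sub>m (dim_col E) \<otimes>\<^sub>K mat_of_row s) *\<^sub>v vectorize E) $ j
      = (\<Sum>k\<in>{0..<?m * dim_col E}. (if j = k div ?m then 1 else 0) * s $ (k mod ?m) * E $$ (k mod ?m, k div ?m))"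
  proof -
    have "((1\<^sub>m (dim_col E) \<otimes>\<^sub>K mat_of_row s) *\<^sub>v vectorize E) $ j
        = (\<Sum>k\<in>{0..<?m * dim_col E}. (1\<^sub>m (dim_col E) \<otimes>\<^sub>K mat_of_row s) $$ (j, k) * vectorize E $ k)"
      using j that by (simp add: scalar_prod_def mult.commute)
    also have "\<dots> = (\<Sum>k\<in>{0..<?m * dim_col E}.
        (if j = k div ?m then 1 else 0) * s $ (k mod ?m) * E $$ (k mod ?m, k div ?m))"
    proof (intro sum.cong refl)
      fix k assume "k \<in> {0..<?m * dim_col E}"
      then have k: "k < ?m * dim_col E" by simp
      then have "0 < ?m" "k div ?m < dim_col E"
        by (cases ?m, simp_all add: less_mult_imp_div_less mult.commute)
      then show "(1\<^sub>m (dim_col E) \<otimes>\<^sub>K mat_of_row s) $$ (j, k) * vectorize E $ k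
          = (if j = k div ?m then 1 else 0) * s $ (k mod ?m) * E $$ (k mod ?m, k div ?m)"
        using j k that by (simp add: kronecker_def vectorize_def mult.commute)
    qed
    finally show ?thesis .
  qed
  also have "\<dots> = (\<Sum>l\<in>{0..<dim_col E}. \<Sum>i\<in>{0..<?m}. (if j = l then 1 else 0) * s $ i * E $$ (i, l))"
    by (rule sum_div_mod)
  also have "\<dots> = (\<Sum>l\<in>{0..<dim_col E}. if j = l then (\<Sum>i\<in>{0..<?m}. s $ i * E $$ (i, l)) else 0)"
    by (intro sum.cong refl) simp
  also have "\<dots> = (\<Sum>i\<in>{0..<?m}. s $ i * E $$ (i, j))" using j by simp
  also have "\<dots> = (E\<^sup>T *\<^sub>v s) $ j" using j that by (simp add: scalar_prod_def mult.commute)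
  finally show "((1\<^sub>m (dim_col E) \<otimes>\<^sub>K mat_of_row s) *\<^sub>v vectorize E) $ j = (E\<^sup>T *\<^sub>v s) $ j" .
qed simp

lemma vectorize_surj:
  assumes "dim_vec z = m * q"
  obtains D where "D \<in> carrier_mat m q" "vectorize D = z"
proof
  let ?D = "mat m q (\<lambda>(i, j). z $ (j * m + i))"
  show "?D \<in> carrier_mat m q" by simp
  show "vectorize ?D = z"
  proof (rule eq_vecI)
    fix k assume "k < dim_vec z"
    then have k: "k < m * q" using assms by simp
    then have "0 < m" by (cases m) simp_all
    moreover have "k div m < q" using k by (simp add: less_mult_imp_div_less mult.commute)
    ultimately show "vectorize ?D $ k = z $ k" using k by (simp add: vectorize_def)
  qed (simp add: assms)
qed

text \<open>The transposed Kronecker factors are found from their adjoints, tested on all matrices.\<close>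

lemma transpose_kronecker_row_identity_mult_vec:
  assumes "dim_vec s = m"
  shows "(mat_of_row g \<otimes>\<^sub>K 1\<^sub>m m)\<^sup>T *\<^sub>v s = vectorize (outer_prod s g)"
proof (rule vec_eq_by_scalar_prod)
  fix z :: "real vec" assume "dim_vec z = dim_vec (vectorize (outer_prod s g))"
  then obtain D where D: "D \<in> carrier_mat m (dim_vec g)" and z: "vectorize D = z"
    using vectorize_surj[of z m "dim_vec g"] assms by auto
  have [simp]: "dim_row D = m" "dim_col D = dim_vec g" using D by auto
  have "z \<bullet> ((mat_of_row g \<otimes>\<^sub>K 1\<^sub>m m)\<^sup>T *\<^sub>v s) = (D *\<^sub>v g) \<bullet> s"
    using kronecker_row_identity_mult_vec[of g D] assms
    by (subst scalar_prod_transpose_right) (simp_all add: z[symmetric] mult.commute)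
  also have "\<dots> = vectorize D \<bullet> vectorize (outer_prod s g)"
    using assms by (simp add: vectorize_scalar_prod)
      (simp add: outer_prod_def scalar_prod_def sum_distrib_left sum_distrib_right sum.swap[of _ "{0..<dim_vec g}"] mult_ac)
  finally show "z \<bullet> ((mat_of_row g \<otimes>\<^sub>K 1\<^sub>m m)\<^sup>T *\<^sub>v s) = z \<bullet> vectorize (outer_prod s g)" by (simp add: z)
qed (simp add: assms mult.commute)

lemma transpose_kronecker_identity_row_mult_vec:
  assumes "dim_vec v = n"
  shows "(1\<^sub>m n \<otimes>\<^sub>K mat_of_row s)\<^sup>T *\<^sub>v v = vectorize (outer_prod s v)"
proof (rule vec_eq_by_scalar_prod)
  fix z :: "real vec" assume "dim_vec z = dim_vec (vectorize (outer_prod s v))"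
  then obtain E where E: "E \<in> carrier_mat (dim_vec s) n" and z: "vectorize E = z"
    using vectorize_surj[of z "dim_vec s" n] assms by auto
  have [simp]: "dim_row E = dim_vec s" "dim_col E = n" using E by auto
  have "z \<bullet> ((1\<^sub>m n \<otimes>\<^sub>K mat_of_row s)\<^sup>T *\<^sub>v v) = (E\<^sup>T *\<^sub>v s) \<bullet> v"
    using kronecker_identity_row_mult_vec[of s E] assms
    by (subst scalar_prod_transpose_right) (simp_all add: z[symmetric] mult.commute)
  also have "\<dots> = vectorize E \<bullet> vectorize (outer_prod s v)"
    using assms by (simp add: vectorize_scalar_prod)
      (simp add: outer_prod_def scalar_prod_def sum_distrib_left sum_distrib_right mult_ac)
  finally show "z \<bullet> ((1\<^sub>m n \<otimes>\<^sub>K mat_of_row s)\<^sup>T *\<^sub>v v) = z \<bullet> vectorize (outer_prod s v)" by (simp add: z)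
qed (simp add: assms mult.commute)

definition householder :: "real vec \<Rightarrow> real mat" where
  "householder s = 1\<^sub>m (dim_vec s) - (2 / (vnorm s)\<^sup>2) \<cdot>\<^sub>m outer_prod s s"

lemma dim_householder [simp]: "dim_row (householder s) = dim_vec s" "dim_col (householder s) = dim_vec s"
  by (simp_all add: householder_def)

lemma householder_mult_vec:
  "dim_vec v = dim_vec s \<Longrightarrow> householder s *\<^sub>v v = v - (2 * (s \<bullet> v) / (s \<bullet> s)) \<cdot>\<^sub>v s"
  by (simp add: householder_def mult_mat_vec_linear outer_prod_mult_vec vnorm_sq smult_smult_assoc)

lemma transpose_householder [simp]: "(householder s)\<^sup>T = householder s"
  by (simp add: householder_def transpose_linear transpose_outer_prod)

context tls_minimizer
begin

text \<open>The derivative is \<open>- P\<^sup>-\<^sup>1\<close> times this matrix.\<close>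

definition derivative_factor :: "real mat" where
  "derivative_factor = A\<^sup>T * householder r * (mat_of_row (x @\<^sub>v vec 1 (\<lambda>_. - 1)) \<otimes>\<^sub>K 1\<^sub>m m)
    + ((1\<^sub>m n \<otimes>\<^sub>K mat_of_row r) @\<^sub>c 0\<^sub>m n m)"

lemma dim_derivative_factor [simp]:
  "dim_row derivative_factor = n" "dim_col derivative_factor = n * m + m"
  by (simp_all add: derivative_factor_def)

lemma derivative_factor_mult_vec:
  assumes "E \<in> carrier_mat m n" "d \<in> carrier_vec m"
  shows "derivative_factor *\<^sub>v vectorize (E @\<^sub>c col_mat d)
    = A\<^sup>T *\<^sub>v (householder r *\<^sub>v (E *\<^sub>v x - d)) + E\<^sup>T *\<^sub>v r"
proof -
  have [simp]: "dim_row E = m" "dim_col E = n" "dim_vec d = m" using assms by auto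
  let ?D = "E @\<^sub>c col_mat d" and ?g = "x @\<^sub>v vec 1 (\<lambda>_. - 1)"
  have "(mat_of_row ?g \<otimes>\<^sub>K 1\<^sub>m m) *\<^sub>v vectorize ?D = ?D *\<^sub>v ?g"
    using kronecker_row_identity_mult_vec[of ?g ?D] by simp
  also have "\<dots> = E *\<^sub>v x - d"
    by (simp add: append_cols_mult_vec col_mat_mult_vec) (auto intro!: eq_vecI)
  finally have 1: "(mat_of_row ?g \<otimes>\<^sub>K 1\<^sub>m m) *\<^sub>v vectorize ?D = E *\<^sub>v x - d" .
  have "((1\<^sub>m n \<otimes>\<^sub>K mat_of_row r) @\<^sub>c 0\<^sub>m n m) *\<^sub>v vectorize ?D
      = (1\<^sub>m n \<otimes>\<^sub>K mat_of_row r) *\<^sub>v vectorize E + 0\<^sub>m n m *\<^sub>v d"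
    by (simp add: vectorize_append_col append_cols_mult_vec mult.commute)
  also have "\<dots> = E\<^sup>T *\<^sub>v r"
    using kronecker_identity_row_mult_vec[of r E] by (simp add: zero_mat_mult_vec) (auto intro!: eq_vecI)
  finally have 2: "((1\<^sub>m n \<otimes>\<^sub>K mat_of_row r) @\<^sub>c 0\<^sub>m n m) *\<^sub>v vectorize ?D = E\<^sup>T *\<^sub>v r" .
  show ?thesis
    using 1 2 unfolding derivative_factor_def
    by (simp add: add_mat_mult_vec mult_mat_mult_vec mult.commute)
qed

lemma residual_self: "r \<bullet> r = Q x * (1 + x \<bullet> (W *\<^sub>v x))"
  by (rule residual_sq) simp

lemma stationary_product: "dim_vec v = n \<Longrightarrow> (A *\<^sub>v v) \<bullet> r = Q x * (v \<bullet> (W *\<^sub>v x))"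
  using minimizer_stationary(1)[OF x_min] scalar_prod_transpose_right[of v A r] by simp

text \<open>The change of the minimal value contributes the rank one part of the reflection, because
  \<open>Q x / \<parallel>r\<parallel>\<^sup>2 = 1 / (1 + x \<bullet> W x)\<close> and \<open>A\<^sup>T r = Q x \<cdot> W x\<close>.\<close>

lemma derivative_factor_first_order:
  assumes E: "E \<in> carrier_mat m n" "d \<in> carrier_vec m" and r: "r \<bullet> r \<noteq> 0"
  shows "(2 * (r \<bullet> (E *\<^sub>v x - d)) / (1 + x \<bullet> (W *\<^sub>v x))) \<cdot>\<^sub>v (W *\<^sub>v x) - (E\<^sup>T *\<^sub>v r + A\<^sup>T *\<^sub>v (E *\<^sub>v x - d))
    = - (derivative_factor *\<^sub>v vectorize (E @\<^sub>c col_mat d))"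
proof (rule vec_eq_by_scalar_prod)
  have [simp]: "dim_row E = m" "dim_col E = n" "dim_vec d = m" using E by auto
  define s where "s = r"
  define u where "u = E *\<^sub>v x - d"
  have [simp]: "dim_vec s = m" "dim_vec u = m" by (simp_all add: s_def u_def)
  fix z :: "real vec"
  assume "dim_vec z = dim_vec (- (derivative_factor *\<^sub>v vectorize (E @\<^sub>c col_mat d)))"
  then have [simp]: "dim_vec z = n" by simp
  have "(A *\<^sub>v z) \<bullet> s = Q x * (z \<bullet> (W *\<^sub>v x))" unfolding s_def by (rule stationary_product) simp
  moreover have "Q x / (s \<bullet> s) = 1 / (1 + x \<bullet> (W *\<^sub>v x))"
    using r residual_self by (simp add: s_def)
  moreover have "2 * (s \<bullet> u) / (s \<bullet> s) * (Q x * (z \<bullet> (W *\<^sub>v x)))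
      = 2 * (s \<bullet> u) * (z \<bullet> (W *\<^sub>v x)) * (Q x / (s \<bullet> s))" by simp
  ultimately have "2 * (s \<bullet> u) / (s \<bullet> s) * ((A *\<^sub>v z) \<bullet> s) = 2 * (s \<bullet> u) / (1 + x \<bullet> (W *\<^sub>v x)) * (z \<bullet> (W *\<^sub>v x))"
    by simp
  then show "z \<bullet> ((2 * (r \<bullet> (E *\<^sub>v x - d)) / (1 + x \<bullet> (W *\<^sub>v x))) \<cdot>\<^sub>v (W *\<^sub>v x) - (E\<^sup>T *\<^sub>v r + A\<^sup>T *\<^sub>v (E *\<^sub>v x - d)))
    = z \<bullet> - (derivative_factor *\<^sub>v vectorize (E @\<^sub>c col_mat d))"
    unfolding derivative_factor_mult_vec[OF E] s_def[symmetric] u_def[symmetric]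
    by (simp add: householder_mult_vec scalar_prod_linear scalar_prod_transpose_right)
qed simp

text \<open>The reflection is orthogonal and maps \<open>r\<close> to \<open>- r\<close>, which gives the mixed term its sign.\<close>

lemma derivative_factor_form:
  assumes v[simp]: "dim_vec v = n" and r: "r \<bullet> r \<noteq> 0"
  shows "(vnorm (derivative_factor\<^sup>T *\<^sub>v v))\<^sup>2
    = (1 + x \<bullet> x) * ((A *\<^sub>v v) \<bullet> (A *\<^sub>v v)) - 2 * ((A *\<^sub>v v) \<bullet> r) * (x \<bullet> v) + (r \<bullet> r) * (v \<bullet> v)"
proof -
  define s where "s = r"
  define p where "p = householder s *\<^sub>v (A *\<^sub>v v)"
  have [simp]: "dim_vec s = m" "dim_vec p = m" by (simp_all add: s_def p_def)
  have "derivative_factor\<^sup>T *\<^sub>v v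
      = (mat_of_row (x @\<^sub>v vec 1 (\<lambda>_. - 1)) \<otimes>\<^sub>K 1\<^sub>m m)\<^sup>T *\<^sub>v p + ((1\<^sub>m n \<otimes>\<^sub>K mat_of_row s) @\<^sub>c 0\<^sub>m n m)\<^sup>T *\<^sub>v v"
    unfolding derivative_factor_def p_def s_def
    by (simp add: transpose_linear transpose_mult_dim add_mat_mult_vec mult_mat_mult_vec mult.commute)
  also have "(mat_of_row (x @\<^sub>v vec 1 (\<lambda>_. - 1)) \<otimes>\<^sub>K 1\<^sub>m m)\<^sup>T *\<^sub>v p = vectorize (outer_prod p x) @\<^sub>v (- p)"
  proof -
    have "outer_prod p (x @\<^sub>v vec 1 (\<lambda>_. - 1)) = outer_prod p x @\<^sub>c col_mat (- p)"
      by (rule eq_matI) (auto simp: outer_prod_def less_Suc_eq)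
    then show ?thesis
      by (simp add: transpose_kronecker_row_identity_mult_vec vectorize_append_col)
  qed
  also have "((1\<^sub>m n \<otimes>\<^sub>K mat_of_row s) @\<^sub>c 0\<^sub>m n m)\<^sup>T *\<^sub>v v = vectorize (outer_prod s v) @\<^sub>v 0\<^sub>v m"
    by (simp add: transpose_append_cols_mult_vec transpose_kronecker_identity_row_mult_vec
        zero_mat_mult_vec)
  also have "(vectorize (outer_prod p x) @\<^sub>v (- p)) + (vectorize (outer_prod s v) @\<^sub>v 0\<^sub>v m)
      = (vectorize (outer_prod p x) + vectorize (outer_prod s v)) @\<^sub>v (- p)"
    by (rule eq_vecI) auto
  finally have "(vnorm (derivative_factor\<^sup>T *\<^sub>v v))\<^sup>2
      = (vnorm (vectorize (outer_prod p x) + vectorize (outer_prod s v)))\<^sup>2 + (vnorm p)\<^sup>2"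
    by (simp add: vnorm_append_sq)
  also have "\<dots> = (1 + x \<bullet> x) * (p \<bullet> p) + 2 * (p \<bullet> s) * (x \<bullet> v) + (s \<bullet> s) * (v \<bullet> v)"
    by (simp add: vnorm_sq scalar_prod_add_self vectorize_outer_prod_scalar_prod algebra_simps)
  also have "p \<bullet> s = - ((A *\<^sub>v v) \<bullet> s)"
    using r scalar_prod_comm[of s "A *\<^sub>v v"] by (simp add: p_def householder_mult_vec scalar_prod_linear s_def[symmetric])
  also have "p \<bullet> p = (A *\<^sub>v v) \<bullet> (A *\<^sub>v v)"
    using r by (simp add: p_def householder_mult_vec scalar_prod_diff_self scalar_prod_comm[of s "A *\<^sub>v v"]
        s_def[symmetric])
  finally show ?thesis by (simp add: s_def)
qed

lemma minimizer_frechet: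
  assumes A12: "A1 \<in> carrier_mat m n1" "A2 \<in> carrier_mat m n2" and A_eq: "A = A1 @\<^sub>c A2"
    and n_eq: "n = n1 + n2" and W_eq: "W = tail_projection n1 n2"
    and P': "P' \<in> carrier_mat n n" "P' * (A\<^sup>T * A - Q x \<cdot>\<^sub>m W) = 1\<^sub>m n" and r: "r \<bullet> r \<noteq> 0"
  shows "mtls_frechet A1 A2 b (- (P' * derivative_factor))"
proof -
  have [simp]: "dim_row A1 = m" "dim_col A1 = n1" "dim_row A2 = m" "dim_col A2 = n2"
    "dim_row P' = n" "dim_col P' = n"
    using A12 P' by auto
  have sol: "mtls_solution A1 A2 b y \<longleftrightarrow> minimizer y" for y
    unfolding mtls_solution_iff[OF A12 b] A_eq n_eq W_eq by (rule refl)
  have "\<exists>!y. minimizer y" by (rule minimizer_exists[OF c x_dim pd])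
  then have the_x: "(THE y. mtls_solution A1 A2 b y) = x"
    unfolding sol using x_min by (rule the1_equality)
  define p where "p = frobenius_norm P'"
  have p: "0 \<le> p" by (simp add: p_def)
  show ?thesis
    unfolding mtls_frechet_def Let_def
  proof (intro conjI allI impI)
    show "- (P' * derivative_factor)
        \<in> carrier_mat (dim_col A1 + dim_col A2) (dim_vec b * (dim_col A1 + dim_col A2 + 1))"
      by (rule carrier_matI) (simp_all add: n_eq[symmetric] mult.commute)
    fix \<epsilon> :: real assume \<epsilon>: "0 < \<epsilon>"
    define G where "G = 2 * (2 * a + N1)"
    have K1: "0 \<le> G" by (simp add: G_def)
    have K2: "0 \<le> p * T" using p constants_nonneg by simp
    \<comment> \<open>The second bound preserves definiteness, the third turns \<open>p T \<delta>\<^sup>2\<close> into \<open>\<epsilon> \<delta>\<close>.\<close>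
    define \<eta> where "\<eta> = min 1 (min (c / (G + 1)) (\<epsilon> / (p * T + 1)))"
    have \<eta>: "0 < \<eta>" "\<eta> \<le> 1" "\<eta> \<le> c / (G + 1)" "\<eta> \<le> \<epsilon> / (p * T + 1)"
      using \<epsilon> c K1 K2 by (auto simp: \<eta>_def min_less_iff_conj intro!: divide_pos_pos add_nonneg_pos)
    show "\<exists>\<delta>>0. \<forall>D1\<in>carrier_mat (dim_vec b) (dim_col A1). \<forall>D2\<in>carrier_mat (dim_vec b) (dim_col A2).
      \<forall>d\<in>carrier_vec (dim_vec b).
        frobenius_norm (D1 @\<^sub>c D2 @\<^sub>c col_mat d) < \<delta> \<longrightarrow>
        (\<exists>!y. mtls_solution (A1 + D1) (A2 + D2) (b + d) y) \<and>
        vnorm ((THE y. mtls_solution (A1 + D1) (A2 + D2) (b + d) y) - (THE x. mtls_solution A1 A2 b x)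
            - (- (P' * derivative_factor)) *\<^sub>v vectorize (D1 @\<^sub>c D2 @\<^sub>c col_mat d))
          \<le> \<epsilon> * frobenius_norm (D1 @\<^sub>c D2 @\<^sub>c col_mat d)"
    proof (rule exI[of _ \<eta>], intro conjI \<eta>(1) ballI impI)
      fix D1 D2 :: "real mat" and d :: "real vec"
      assume D: "D1 \<in> carrier_mat (dim_vec b) (dim_col A1)" "D2 \<in> carrier_mat (dim_vec b) (dim_col A2)"
        "d \<in> carrier_vec (dim_vec b)" and small: "frobenius_norm (D1 @\<^sub>c D2 @\<^sub>c col_mat d) < \<eta>"
      have [simp]: "dim_row D1 = m" "dim_col D1 = n1" "dim_row D2 = m" "dim_col D2 = n2" "dim_vec d = m"
        using D by auto
      define E where "E = D1 @\<^sub>c D2"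
      have E: "E \<in> carrier_mat m n" by (rule carrier_matI) (simp_all add: E_def n_eq)
      then have [simp]: "dim_row E = m" "dim_col E = n" by auto
      have D_eq: "D1 @\<^sub>c D2 @\<^sub>c col_mat d = E @\<^sub>c col_mat d"
        unfolding E_def by (rule eq_matI) auto
      define \<delta> where "\<delta> = frobenius_norm (E @\<^sub>c col_mat d)"
      have \<delta>_sq: "\<delta>\<^sup>2 = (frobenius_norm E)\<^sup>2 + (vnorm d)\<^sup>2"
        unfolding \<delta>_def by (simp add: frobenius_norm_append_cols_sq frobenius_norm_col_mat_sq vnorm_sq)
      have \<delta>: "0 \<le> \<delta>" "\<delta> < \<eta>" using small by (simp_all add: \<delta>_def D_eq)
      have "frobenius_norm E \<le> \<delta>" "vnorm d \<le> \<delta>"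
        by (rule power2_le_imp_le, simp_all add: \<delta>_sq \<delta>)+
      then interpret p: perturbed_tls m n A W b x c \<delta> E d
        using E D \<delta> \<eta> by unfold_locales auto
      have "G * \<delta> \<le> c"
      proof -
        have "(G + 1) * \<delta> \<le> (G + 1) * (c / (G + 1))"
          using \<delta> \<eta> K1 by (intro mult_left_mono) linarith+
        also have "\<dots> = c" using K1 by simp
        finally show ?thesis using \<delta>(1) by (simp add: algebra_simps)
      qed
      then have guard: "2 * (2 * a + N1) * \<delta> \<le> c" by (simp only: G_def)
      have "D1 \<in> carrier_mat m n1" "D2 \<in> carrier_mat m n2" "b + d \<in> carrier_vec m" using D b by auto
      then have sol': "mtls_solution (A1 + D1) (A2 + D2) (b + d) y \<longleftrightarrow> p.pert.minimizer y" for y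
        using mtls_solution_iff[of "A1 + D1" m n1 "A2 + D2" n2 "b + d" y] A12
        by (simp add: append_cols_add E_def A_eq n_eq W_eq)
      have ex: "\<exists>!y. p.pert.minimizer y" by (rule p.perturbed_minimizer_exists[OF guard])
      then obtain y where y: "p.pert.minimizer y" by blast
      then have [simp]: "dim_vec y = n" by simp
      have the_y: "(THE y. mtls_solution (A1 + D1) (A2 + D2) (b + d) y) = y"
        unfolding sol' using ex y by (rule the1_equality)
      let ?h = "y - x"
      let ?q = "(2 * (r \<bullet> (E *\<^sub>v x - d)) / (1 + x \<bullet> (W *\<^sub>v x))) \<cdot>\<^sub>v (W *\<^sub>v x) - (E\<^sup>T *\<^sub>v r + A\<^sup>T *\<^sub>v (E *\<^sub>v x - d))"
      let ?Ph = "A\<^sup>T *\<^sub>v (A *\<^sub>v ?h) - Q x \<cdot>\<^sub>v (W *\<^sub>v ?h)"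
      have M_mult: "(A\<^sup>T * A - Q x \<cdot>\<^sub>m W) *\<^sub>v v = A\<^sup>T *\<^sub>v (A *\<^sub>v v) - Q x \<cdot>\<^sub>v (W *\<^sub>v v)"
        if "dim_vec v = n" for v
        using that by (simp add: mult_mat_vec_linear)
      have "P' *\<^sub>v ?Ph = P' *\<^sub>v ((A\<^sup>T * A - Q x \<cdot>\<^sub>m W) *\<^sub>v ?h)"
        by (subst M_mult) simp_all
      also have "\<dots> = (P' * (A\<^sup>T * A - Q x \<cdot>\<^sub>m W)) *\<^sub>v ?h"
        by (rule mult_mat_mult_vec[symmetric]) simp_all
      also have "\<dots> = ?h" by (simp only: P'(2)) (simp add: one_mat_mult_vec)
      finally have Ph: "P' *\<^sub>v ?Ph = ?h" .
      have "(- (P' * derivative_factor)) *\<^sub>v vectorize (E @\<^sub>c col_mat d) = P' *\<^sub>v ?q"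
        unfolding derivative_factor_first_order[OF E p.d r]
        by (simp add: uminus_mat_mult_vec mult_mat_mult_vec mult_mat_vec_uminus mult.commute)
      then have "y - x - (- (P' * derivative_factor)) *\<^sub>v vectorize (E @\<^sub>c col_mat d) = P' *\<^sub>v (?Ph - ?q)"
        by (subst mult_mat_vec_diff) (simp_all add: Ph)
      then have "vnorm (y - x - (- (P' * derivative_factor)) *\<^sub>v vectorize (E @\<^sub>c col_mat d)) \<le> p * (T * \<delta>\<^sup>2)"
        using vnorm_mult_bound[of "?Ph - ?q" P' p "T * \<delta>\<^sup>2", OF _ _ p.minimizer_expansion[OF guard y]]
        by (simp add: p_def)
      also have "p * (T * \<delta>\<^sup>2) = (p * T * \<delta>) * \<delta>" by (simp add: power2_eq_square mult_ac)
      also have "\<dots> \<le> \<epsilon> * \<delta>"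
      proof (rule mult_right_mono)
        have "(p * T + 1) * \<delta> \<le> (p * T + 1) * (\<epsilon> / (p * T + 1))"
          using \<delta> \<eta> K2 by (intro mult_left_mono) linarith+
        also have "\<dots> = \<epsilon>" using K2 by simp
        finally show "p * T * \<delta> \<le> \<epsilon>" using \<delta>(1) by (simp add: algebra_simps)
      qed (rule \<delta>(1))
      finally have "vnorm (y - x - (- (P' * derivative_factor)) *\<^sub>v vectorize (E @\<^sub>c col_mat d)) \<le> \<epsilon> * \<delta>" .
      then show "vnorm ((THE y. mtls_solution (A1 + D1) (A2 + D2) (b + d) y) - (THE x. mtls_solution A1 A2 b x)
            - (- (P' * derivative_factor)) *\<^sub>v vectorize (D1 @\<^sub>c D2 @\<^sub>c col_mat d))
          \<le> \<epsilon> * frobenius_norm (D1 @\<^sub>c D2 @\<^sub>c col_mat d)"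
        unfolding the_x the_y D_eq \<delta>_def .
      show "\<exists>!y. mtls_solution (A1 + D1) (A2 + D2) (b + d) y" unfolding sol' by (rule ex)
    qed
  qed
qed

end

section \<open>Equivalent forms of the norm\<close>

context tls_minimizer
begin

definition condition_form :: "real vec \<Rightarrow> real" where
  "condition_form v
    = (1 + x \<bullet> x) * ((A *\<^sub>v v) \<bullet> (A *\<^sub>v v)) - 2 * ((A *\<^sub>v v) \<bullet> r) * (x \<bullet> v) + (r \<bullet> r) * (v \<bullet> v)"

context
  fixes P' :: "real mat"
  assumes P': "P' \<in> carrier_mat n n" and P'_sym: "P'\<^sup>T = P'" and r: "r \<bullet> r \<noteq> 0"
begin

private abbreviation "K \<equiv> - (P' * derivative_factor)"

lemma P'_dims [simp]: "dim_row P' = n" "dim_col P' = n"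
  using P' by auto

lemma K_form:
  assumes "dim_vec u = n"
  shows "(vnorm (K\<^sup>T *\<^sub>v u))\<^sup>2 = condition_form (P' *\<^sub>v u)"
proof -
  have "K\<^sup>T *\<^sub>v u = - (derivative_factor\<^sup>T *\<^sub>v (P' *\<^sub>v u))"
    using assms by (simp add: transpose_linear transpose_mult_dim P'_sym uminus_mat_mult_vec mult_mat_mult_vec)
  then show ?thesis
    using assms derivative_factor_form[of "P' *\<^sub>v u"] r by (simp add: condition_form_def)
qed

lemma spectral_norm_K_gram:
  assumes M: "M \<in> carrier_mat n n" and form: "\<And>v. dim_vec v = n \<Longrightarrow> v \<bullet> (M *\<^sub>v v) = condition_form v"
    and sym: "\<And>u v. dim_vec u = n \<Longrightarrow> dim_vec v = n \<Longrightarrow> u \<bullet> (M *\<^sub>v v) = v \<bullet> (M *\<^sub>v u)"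
  shows "spectral_norm (P' * M * P') = (spectral_norm K)\<^sup>2"
proof -
  have [simp]: "dim_row M = n" "dim_col M = n" using M by auto
  have sandwich: "u \<bullet> ((P' * M * P') *\<^sub>v v) = (P' *\<^sub>v u) \<bullet> (M *\<^sub>v (P' *\<^sub>v v))"
    if "dim_vec u = n" "dim_vec v = n" for u v
    using that scalar_prod_transpose_right[of u P' "M *\<^sub>v (P' *\<^sub>v v)"]
    by (simp add: mult_mat_mult_vec P'_sym)
  show ?thesis
  proof (rule spectral_norm_gram[where k = n])
    show "u \<bullet> ((P' * M * P') *\<^sub>v v) = v \<bullet> ((P' * M * P') *\<^sub>v u)" if "dim_vec u = n" "dim_vec v = n" for u v
      using that sym[of "P' *\<^sub>v u" "P' *\<^sub>v v"] by (simp add: sandwich)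
    show "u \<bullet> ((P' * M * P') *\<^sub>v u) = (vnorm (K\<^sup>T *\<^sub>v u))\<^sup>2" if "dim_vec u = n" for u
      using that by (simp add: sandwich form K_form)
  qed simp_all
qed

lemma spectral_norm_K_factor:
  assumes B: "dim_row B = n" and form: "\<And>v. dim_vec v = n \<Longrightarrow> (vnorm (B\<^sup>T *\<^sub>v v))\<^sup>2 = condition_form v"
  shows "spectral_norm K = spectral_norm (P' * B)"
proof (rule spectral_norm_eq_if_same_form)
  fix u :: "real vec" assume "dim_vec u = dim_row (P' * B)"
  then have u: "dim_vec u = n" by simp
  then have "(P' * B)\<^sup>T *\<^sub>v u = B\<^sup>T *\<^sub>v (P' *\<^sub>v u)"
    using B by (simp add: transpose_mult_dim P'_sym mult_mat_mult_vec)
  then show "(vnorm (K\<^sup>T *\<^sub>v u))\<^sup>2 = (vnorm ((P' * B)\<^sup>T *\<^sub>v u))\<^sup>2"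
    using u by (simp add: K_form form)
qed simp

lemma condition_number_1:
  "spectral_norm K = sqrt (spectral_norm (P' * ((1 + (vnorm x)\<^sup>2) \<cdot>\<^sub>m (A\<^sup>T * A) - A\<^sup>T * outer_prod r x
      - outer_prod x r * A + (vnorm r)\<^sup>2 \<cdot>\<^sub>m 1\<^sub>m n) * P'))"
proof -
  define s where "s = r"
  have [simp]: "dim_vec s = m" by (simp add: s_def)
  let ?M = "(1 + (vnorm x)\<^sup>2) \<cdot>\<^sub>m (A\<^sup>T * A) - A\<^sup>T * outer_prod s x - outer_prod x s * A + (vnorm s)\<^sup>2 \<cdot>\<^sub>m 1\<^sub>m n"
  have M: "u \<bullet> (?M *\<^sub>v v) = (1 + x \<bullet> x) * ((A *\<^sub>v u) \<bullet> (A *\<^sub>v v)) - ((A *\<^sub>v u) \<bullet> s) * (x \<bullet> v)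
      - (u \<bullet> x) * (s \<bullet> (A *\<^sub>v v)) + (s \<bullet> s) * (u \<bullet> v)" if "dim_vec u = n" "dim_vec v = n" for u v
    using that by (simp add: mult_mat_vec_linear outer_prod_mult_vec scalar_prod_linear
        scalar_prod_transpose_right vnorm_sq mult_ac)
  have "spectral_norm (P' * ?M * P') = (spectral_norm K)\<^sup>2"
  proof (rule spectral_norm_K_gram)
    show "?M \<in> carrier_mat n n" by (rule carrier_matI) simp_all
    show "v \<bullet> (?M *\<^sub>v v) = condition_form v" if "dim_vec v = n" for v
      unfolding M[OF that that] condition_form_def s_def[symmetric]
      using that by (simp add: scalar_prod_comm[of s "A *\<^sub>v v"] scalar_prod_comm[of v x])
    show "u \<bullet> (?M *\<^sub>v v) = v \<bullet> (?M *\<^sub>v u)" if "dim_vec u = n" "dim_vec v = n" for u v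
      unfolding M[OF that] M[OF that(2) that(1)]
      using that scalar_prod_comm[of "A *\<^sub>v u" "A *\<^sub>v v"] scalar_prod_comm[of s "A *\<^sub>v v"]
        scalar_prod_comm[of s "A *\<^sub>v u"] scalar_prod_comm[of u x] scalar_prod_comm[of v x] scalar_prod_comm[of u v]
      by simp
  qed
  then show ?thesis using spectral_norm_nonneg[of K] by (simp add: s_def)
qed

lemma condition_number_2:
  fixes \<gamma> \<gamma>' :: real
  defines "\<gamma> \<equiv> 1 + (vnorm x)\<^sup>2" and "\<gamma>' \<equiv> 1 + x \<bullet> (W *\<^sub>v x)"
  shows "spectral_norm K = sqrt \<gamma> * sqrt (spectral_norm (P' * (A\<^sup>T * A + (Q x * \<gamma>' / \<gamma>) \<cdot>\<^sub>m
      (1\<^sub>m n - (1 / \<gamma>') \<cdot>\<^sub>m (W * outer_prod x x + outer_prod x x * W))) * P'))"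
proof -
  let ?M = "A\<^sup>T * A + (Q x * \<gamma>' / \<gamma>) \<cdot>\<^sub>m (1\<^sub>m n - (1 / \<gamma>') \<cdot>\<^sub>m (W * outer_prod x x + outer_prod x x * W))"
  have \<gamma>: "0 < \<gamma>" "0 < \<gamma>'"
    using W_form_nonneg[of x] by (simp_all add: \<gamma>_def \<gamma>'_def add_pos_nonneg)
  have M: "u \<bullet> (?M *\<^sub>v v) = (A *\<^sub>v u) \<bullet> (A *\<^sub>v v) + (Q x * \<gamma>' / \<gamma>) * (u \<bullet> v
      - (1 / \<gamma>') * ((u \<bullet> (W *\<^sub>v x)) * (x \<bullet> v) + (u \<bullet> x) * (x \<bullet> (W *\<^sub>v v))))"
    if "dim_vec u = n" "dim_vec v = n" for u v
    using that by (simp add: mult_mat_vec_linear outer_prod_mult_vec scalar_prod_linear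
        scalar_prod_transpose_right mult_ac)
  have "spectral_norm (P' * (\<gamma> \<cdot>\<^sub>m ?M) * P') = (spectral_norm K)\<^sup>2"
  proof (rule spectral_norm_K_gram)
    show "\<gamma> \<cdot>\<^sub>m ?M \<in> carrier_mat n n" by (rule carrier_matI) simp_all
    have smult: "u \<bullet> ((\<gamma> \<cdot>\<^sub>m ?M) *\<^sub>v v) = \<gamma> * (u \<bullet> (?M *\<^sub>v v))" if "dim_vec u = n" "dim_vec v = n" for u v
      using that by (subst smult_mat_mult_vec) simp_all
    show "v \<bullet> ((\<gamma> \<cdot>\<^sub>m ?M) *\<^sub>v v) = condition_form v" if v: "dim_vec v = n" for v
    proof -
      have "(A *\<^sub>v v) \<bullet> r = Q x * (v \<bullet> (W *\<^sub>v x))" using v by (rule stationary_product)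
      moreover have "r \<bullet> r = Q x * \<gamma>'" using residual_self by (simp add: \<gamma>'_def)
      moreover have "\<gamma> = 1 + x \<bullet> x" by (simp add: \<gamma>_def vnorm_sq)
      ultimately have "condition_form v = \<gamma> * ((A *\<^sub>v v) \<bullet> (A *\<^sub>v v)) - 2 * (Q x * (v \<bullet> (W *\<^sub>v x))) * (x \<bullet> v)
          + Q x * \<gamma>' * (v \<bullet> v)" by (simp only: condition_form_def)
      also have "\<dots> = \<gamma> * ((A *\<^sub>v v) \<bullet> (A *\<^sub>v v) + (Q x * \<gamma>' / \<gamma>) * (v \<bullet> v
          - (1 / \<gamma>') * ((v \<bullet> (W *\<^sub>v x)) * (x \<bullet> v) + (v \<bullet> x) * (x \<bullet> (W *\<^sub>v v)))))"
        using \<gamma> v W_commute[of x v] scalar_prod_comm[of v x] by (simp add: field_simps)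
      finally show ?thesis unfolding smult[OF v v] M[OF v v] by simp
    qed
    show "u \<bullet> ((\<gamma> \<cdot>\<^sub>m ?M) *\<^sub>v v) = v \<bullet> ((\<gamma> \<cdot>\<^sub>m ?M) *\<^sub>v u)" if "dim_vec u = n" "dim_vec v = n" for u v
      unfolding smult[OF that] smult[OF that(2) that(1)] M[OF that] M[OF that(2) that(1)]
      using that scalar_prod_comm[of "A *\<^sub>v u" "A *\<^sub>v v"] scalar_prod_comm[of u v]
        scalar_prod_comm[of u x] scalar_prod_comm[of v x] W_commute[of u x] W_commute[of v x]
      by (simp add: algebra_simps)
  qed
  moreover have "P' * (\<gamma> \<cdot>\<^sub>m ?M) * P' = \<gamma> \<cdot>\<^sub>m (P' * ?M * P')"
  proof -
    have M: "?M \<in> carrier_mat n n" by (rule carrier_matI) simp_all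
    show ?thesis
      unfolding mult_smult_distrib[OF P' M] by (rule mult_smult_assoc_mat[OF mult_carrier_mat[OF P' M] P'])
  qed
  ultimately have "(spectral_norm K)\<^sup>2 = \<gamma> * spectral_norm (P' * ?M * P')"
    using \<gamma> by (simp add: spectral_norm_smult)
  then have "spectral_norm K = sqrt (\<gamma> * spectral_norm (P' * ?M * P'))"
    using spectral_norm_nonneg[of K] by (metis real_sqrt_unique)
  then show ?thesis by (simp add: real_sqrt_mult)
qed

text \<open>This block occurs with \<open>u = u' = \<parallel>x\<parallel>\<close> and with \<open>u = 1 + \<beta>\<close>, \<open>u' = \<beta>\<close>. In both cases
  \<open>2 u u' - u'\<^sup>2 = \<parallel>x\<parallel>\<^sup>2\<close>, so that its last term cancels the last term of the other block.\<close>

lemma mixed_block_form: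
  assumes v[simp]: "dim_vec v = n"
  shows "(vnorm ((u \<cdot>\<^sub>m A\<^sup>T - (u' * Q x / (vnorm r)\<^sup>2) \<cdot>\<^sub>m (W * outer_prod x r))\<^sup>T *\<^sub>v v))\<^sup>2
    = u\<^sup>2 * ((A *\<^sub>v v) \<bullet> (A *\<^sub>v v)) - (2 * u * u' - u'\<^sup>2) * (Q x * (v \<bullet> (W *\<^sub>v x)))\<^sup>2 / (r \<bullet> r)"
proof -
  define s where "s = r"
  define k where "k = u' * Q x / (s \<bullet> s)"
  define z where "z = v \<bullet> (W *\<^sub>v x)"
  have [simp]: "dim_vec s = m" by (simp add: s_def)
  have r: "s \<bullet> s \<noteq> 0" using r by (simp add: s_def)
  have z: "x \<bullet> (W *\<^sub>v v) = z" using W_commute[of x v] by (simp add: z_def)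
  have As: "(A *\<^sub>v v) \<bullet> s = Q x * z" unfolding s_def z_def by (rule stationary_product) simp
  have "(u \<cdot>\<^sub>m A\<^sup>T - k \<cdot>\<^sub>m (W * outer_prod x s))\<^sup>T *\<^sub>v v = u \<cdot>\<^sub>v (A *\<^sub>v v) - (k * z) \<cdot>\<^sub>v s"
    by (simp add: transpose_linear transpose_mult_dim transpose_outer_prod W_sym mult_mat_vec_linear
        outer_prod_mult_vec z smult_smult_assoc)
  then have "(vnorm ((u \<cdot>\<^sub>m A\<^sup>T - k \<cdot>\<^sub>m (W * outer_prod x s))\<^sup>T *\<^sub>v v))\<^sup>2
      = u * u * ((A *\<^sub>v v) \<bullet> (A *\<^sub>v v)) - 2 * (u * (k * z) * ((A *\<^sub>v v) \<bullet> s)) + (k * z) * (k * z) * (s \<bullet> s)"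
    by (simp add: vnorm_sq scalar_prod_diff_self)
  also have "\<dots> = u\<^sup>2 * ((A *\<^sub>v v) \<bullet> (A *\<^sub>v v)) - (2 * u * u' - u'\<^sup>2) * (Q x * z)\<^sup>2 / (s \<bullet> s)"
    unfolding As k_def using r by (simp add: field_simps power2_eq_square)
  finally show ?thesis by (simp add: k_def s_def z_def vnorm_sq)
qed

lemma identity_block_form:
  assumes v[simp]: "dim_vec v = n"
  shows "(vnorm ((vnorm r \<cdot>\<^sub>m 1\<^sub>m n - (Q x / vnorm r) \<cdot>\<^sub>m (W * outer_prod x x))\<^sup>T *\<^sub>v v))\<^sup>2
    = (r \<bullet> r) * (v \<bullet> v) - 2 * Q x * (v \<bullet> (W *\<^sub>v x)) * (x \<bullet> v) + (x \<bullet> x) * (Q x * (v \<bullet> (W *\<^sub>v x)))\<^sup>2 / (r \<bullet> r)"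
proof -
  define \<rho>' where "\<rho>' = vnorm r"
  define z where "z = v \<bullet> (W *\<^sub>v x)"
  have \<rho>': "\<rho>' * \<rho>' = r \<bullet> r" by (simp add: \<rho>'_def vnorm_mult_self)
  with r have \<rho>'_nz: "\<rho>' \<noteq> 0" by auto
  have z: "x \<bullet> (W *\<^sub>v v) = z" using W_commute[of x v] by (simp add: z_def)
  have "(\<rho>' \<cdot>\<^sub>m 1\<^sub>m n - (Q x / \<rho>') \<cdot>\<^sub>m (W * outer_prod x x))\<^sup>T *\<^sub>v v = \<rho>' \<cdot>\<^sub>v v - (Q x / \<rho>' * z) \<cdot>\<^sub>v x"
    by (simp add: transpose_linear transpose_mult_dim transpose_outer_prod W_sym mult_mat_vec_linear
        outer_prod_mult_vec z smult_smult_assoc)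
  then have "(vnorm ((\<rho>' \<cdot>\<^sub>m 1\<^sub>m n - (Q x / \<rho>') \<cdot>\<^sub>m (W * outer_prod x x))\<^sup>T *\<^sub>v v))\<^sup>2
      = \<rho>' * \<rho>' * (v \<bullet> v) - 2 * (\<rho>' * (Q x / \<rho>' * z) * (v \<bullet> x)) + (Q x / \<rho>' * z) * (Q x / \<rho>' * z) * (x \<bullet> x)"
    by (simp add: vnorm_sq scalar_prod_diff_self)
  also have "\<dots> = (\<rho>' * \<rho>') * (v \<bullet> v) - 2 * Q x * z * (x \<bullet> v) + (x \<bullet> x) * (Q x * z)\<^sup>2 / (\<rho>' * \<rho>')"
    using \<rho>'_nz scalar_prod_comm[of v x] by (simp add: power2_eq_square)
  finally show ?thesis unfolding \<rho>' by (simp add: \<rho>'_def z_def)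
qed

lemma condition_form_reduced:
  assumes "dim_vec v = n"
  shows "condition_form v = (1 + x \<bullet> x) * ((A *\<^sub>v v) \<bullet> (A *\<^sub>v v)) - 2 * Q x * (v \<bullet> (W *\<^sub>v x)) * (x \<bullet> v)
    + (r \<bullet> r) * (v \<bullet> v)"
  unfolding condition_form_def stationary_product[OF assms] by simp

lemma condition_number_3:
  "spectral_norm K = spectral_norm (P' * (A\<^sup>T @\<^sub>c
      (vnorm x \<cdot>\<^sub>m A\<^sup>T - (vnorm x * Q x / (vnorm r)\<^sup>2) \<cdot>\<^sub>m (W * outer_prod x r)) @\<^sub>c
      (vnorm r \<cdot>\<^sub>m 1\<^sub>m n - (Q x / vnorm r) \<cdot>\<^sub>m (W * outer_prod x x))))"
proof (rule spectral_norm_K_factor)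
  fix v :: "real vec" assume v: "dim_vec v = n"
  show "(vnorm ((A\<^sup>T @\<^sub>c (vnorm x \<cdot>\<^sub>m A\<^sup>T - (vnorm x * Q x / (vnorm r)\<^sup>2) \<cdot>\<^sub>m (W * outer_prod x r)) @\<^sub>c
      (vnorm r \<cdot>\<^sub>m 1\<^sub>m n - (Q x / vnorm r) \<cdot>\<^sub>m (W * outer_prod x x)))\<^sup>T *\<^sub>v v))\<^sup>2 = condition_form v"
    using v unfolding condition_form_reduced[OF v]
    by (simp add: transpose_append_cols_mult_vec vnorm_append_sq mixed_block_form identity_block_form
        vnorm_sq[of x] vnorm_sq[of "A *\<^sub>v v"] vnorm_mult_self algebra_simps)
qed simp

lemma condition_number_4:
  assumes \<beta>: "\<beta> = - 1 + sqrt (1 + (vnorm x)\<^sup>2) \<or> \<beta> = - 1 - sqrt (1 + (vnorm x)\<^sup>2)"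
  shows "spectral_norm K = spectral_norm (P' *
      (((1 + \<beta>) \<cdot>\<^sub>m A\<^sup>T - (\<beta> * Q x / (vnorm r)\<^sup>2) \<cdot>\<^sub>m (W * outer_prod x r)) @\<^sub>c
       (vnorm r \<cdot>\<^sub>m 1\<^sub>m n - (Q x / vnorm r) \<cdot>\<^sub>m (W * outer_prod x x))))"
proof (rule spectral_norm_K_factor)
  have "(1 + \<beta>)\<^sup>2 = 1 + (vnorm x)\<^sup>2" using \<beta> by auto
  then have 1: "(1 + \<beta>)\<^sup>2 = 1 + x \<bullet> x" by (simp add: vnorm_sq)
  have 2: "2 * (1 + \<beta>) * \<beta> - \<beta>\<^sup>2 = x \<bullet> x" using 1 by (simp add: power2_eq_square algebra_simps)
  fix v :: "real vec" assume v: "dim_vec v = n"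
  show "(vnorm ((((1 + \<beta>) \<cdot>\<^sub>m A\<^sup>T - (\<beta> * Q x / (vnorm r)\<^sup>2) \<cdot>\<^sub>m (W * outer_prod x r)) @\<^sub>c
       (vnorm r \<cdot>\<^sub>m 1\<^sub>m n - (Q x / vnorm r) \<cdot>\<^sub>m (W * outer_prod x x)))\<^sup>T *\<^sub>v v))\<^sup>2 = condition_form v"
    using v unfolding condition_form_reduced[OF v]
    by (simp add: transpose_append_cols_mult_vec vnorm_append_sq mixed_block_form identity_block_form 1 2[simplified])
qed simp

end

end

section \<open>Genericity and the minimal value\<close>

text \<open>Repeated columns have to be excluded first, because linear independence refers to the set of
  columns.\<close>

lemma full_rank_trivial_kernel:
  fixes A :: "real mat"
  assumes A: "A \<in> carrier_mat m n" and rank: "vec_space.rank m A = n"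
    and y: "dim_vec y = n" "A *\<^sub>v y = 0\<^sub>v m"
  shows "y = 0\<^sub>v n"
proof (rule ccontr)
  assume nz: "y \<noteq> 0\<^sub>v n"
  interpret vec_space "TYPE(real)" m .
  have "distinct (cols A)"
  proof (rule ccontr)
    assume "\<not> distinct (cols A)"
    then have "card (set (cols A)) < n" using A by (metis card_distinct card_length carrier_matD(2) cols_length order_le_neq_trans)
    moreover have "rank A \<le> card (set (cols A))"
    proof -
      obtain S where "maximal S (\<lambda>T. T \<subseteq> set (cols A) \<and> lin_indpt T)"
        using maximal_exists[of "\<lambda>T. T \<subseteq> set (cols A) \<and> lin_indpt T" "card (set (cols A))" "{}"]
        by (meson List.finite_set card_mono empty_iff empty_subsetI finite_lin_indpt2 rev_finite_subset)
      then show ?thesis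
        using rank_card_indpt[OF A, of S] by (simp add: card_mono maximal_def)
    qed
    ultimately show False using rank by simp
  qed
  then show False
    using full_rank_lin_indpt[OF A rank] lin_depI[OF A _ nz y(2)] y(1) by (auto intro: carrier_vecI)
qed

text \<open>If \<open>M\<close> is positive semidefinite with inverse \<open>B\<close>, then the form of \<open>M\<close> at \<open>h - B h / \<beta>\<close>
  with \<open>\<beta> > \<parallel>B\<parallel>\<close> is nonnegative, and this bounds its value at \<open>h\<close> from below.\<close>

lemma semidefinite_invertible_lower_bound:
  fixes M B :: "real mat"
  assumes M: "M \<in> carrier_mat n n" and B: "B \<in> carrier_mat n n" and inv: "M * B = 1\<^sub>m n"
    and sym: "\<And>u v. dim_vec u = n \<Longrightarrow> dim_vec v = n \<Longrightarrow> u \<bullet> (M *\<^sub>v v) = v \<bullet> (M *\<^sub>v u)"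
    and psd: "\<And>v. dim_vec v = n \<Longrightarrow> 0 \<le> v \<bullet> (M *\<^sub>v v)"
  obtains c where "0 < c" "\<And>h. dim_vec h = n \<Longrightarrow> c * (h \<bullet> h) \<le> h \<bullet> (M *\<^sub>v h)"
proof -
  have [simp]: "dim_row M = n" "dim_col M = n" "dim_row B = n" "dim_col B = n" using M B by auto
  define \<beta> where "\<beta> = frobenius_norm B + 1"
  have \<beta>: "0 < \<beta>" by (simp add: \<beta>_def add_nonneg_pos)
  have "1 / \<beta> * (h \<bullet> h) \<le> h \<bullet> (M *\<^sub>v h)" if h[simp]: "dim_vec h = n" for h
  proof -
    define g where "g = B *\<^sub>v h"
    have [simp]: "dim_vec g = n" by (simp add: g_def)
    have Mg: "M *\<^sub>v g = h"
      using mult_mat_mult_vec[of M B h] by (simp add: g_def inv one_mat_mult_vec)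
    have gh: "g \<bullet> h \<le> \<beta> * (h \<bullet> h)"
    proof -
      have "g \<bullet> h \<le> (frobenius_norm B * vnorm h) * vnorm h"
        using abs_scalar_prod_bound[of g h "frobenius_norm B * vnorm h" "vnorm h"]
          vnorm_mult_mat_vec_le[of h B] by (simp add: g_def)
      then show ?thesis using scalar_prod_self_nonneg[of h] by (simp add: \<beta>_def mult.assoc vnorm_mult_self algebra_simps)
    qed
    have "0 \<le> (h - (1 / \<beta>) \<cdot>\<^sub>v g) \<bullet> (M *\<^sub>v (h - (1 / \<beta>) \<cdot>\<^sub>v g))" by (rule psd) simp
    also have "\<dots> = h \<bullet> (M *\<^sub>v h) - (2 / \<beta>) * (h \<bullet> h) + (1 / \<beta>) * (1 / \<beta>) * (g \<bullet> h)"
      using sym[of g h] scalar_prod_comm[of h g] \<beta>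
      by (simp add: mult_mat_vec_linear scalar_prod_linear Mg) (simp add: field_simps)
    also have "\<dots> \<le> h \<bullet> (M *\<^sub>v h) - (2 / \<beta>) * (h \<bullet> h) + (1 / \<beta>) * (h \<bullet> h)"
    proof -
      have "(1 / \<beta>) * (1 / \<beta>) * (g \<bullet> h) \<le> (1 / \<beta>) * (1 / \<beta>) * (\<beta> * (h \<bullet> h))"
        using \<beta> gh by (intro mult_left_mono) simp_all
      then show ?thesis using \<beta> by simp
    qed
    finally show ?thesis by (simp add: field_simps)
  qed
  then show thesis using that[of "1 / \<beta>"] \<beta> by simp
qed

text \<open>For \<open>t \<noteq> 0\<close> this is minimality, compared with \<open>- y / t\<close>; for \<open>t = 0\<close> it is semidefiniteness.\<close>

lemma (in weighted_tls) minimizer_homogeneous: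
  assumes x: "minimizer x" and y[simp]: "dim_vec y = n"
  shows "Q x * (t\<^sup>2 + y \<bullet> (W *\<^sub>v y)) \<le> (A *\<^sub>v y + t \<cdot>\<^sub>v b) \<bullet> (A *\<^sub>v y + t \<cdot>\<^sub>v b)"
proof (cases "t = 0")
  case True
  then have "A *\<^sub>v y + t \<cdot>\<^sub>v b = A *\<^sub>v y" by (intro eq_vecI) simp_all
  then show ?thesis using minimizer_stationary(2)[OF x y] True by simp
next
  case False
  define z where "z = (- 1 / t) \<cdot>\<^sub>v y"
  have [simp]: "dim_vec z = n" by (simp add: z_def)
  have y_eq: "y = (- t) \<cdot>\<^sub>v z" using False by (intro eq_vecI) (simp_all add: z_def)
  have eq: "A *\<^sub>v y + t \<cdot>\<^sub>v b = (- t) \<cdot>\<^sub>v (A *\<^sub>v z - b)"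
    unfolding y_eq by (subst mult_mat_vec_smult, simp) (rule eq_vecI, simp_all add: algebra_simps)
  have "Q x * (1 + z \<bullet> (W *\<^sub>v z)) \<le> (A *\<^sub>v z - b) \<bullet> (A *\<^sub>v z - b)"
    using x Q_ge_iff[of z "Q x"] by simp
  then have "t\<^sup>2 * (Q x * (1 + z \<bullet> (W *\<^sub>v z))) \<le> t\<^sup>2 * ((A *\<^sub>v z - b) \<bullet> (A *\<^sub>v z - b))"
    by (rule mult_left_mono) simp
  moreover have "t\<^sup>2 + y \<bullet> (W *\<^sub>v y) = t\<^sup>2 * (1 + z \<bullet> (W *\<^sub>v z))"
    unfolding y_eq by (simp add: mult_mat_vec_smult power2_eq_square algebra_simps)
  ultimately show ?thesis unfolding eq by (simp add: power2_eq_square mult_ac)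
qed

lemma orthogonal_transpose_isometry:
  fixes U :: "real mat"
  assumes U: "U \<in> carrier_mat m m" "U\<^sup>T * U = 1\<^sub>m m" and p: "dim_vec p = m"
  shows "(U\<^sup>T *\<^sub>v p) \<bullet> (U\<^sup>T *\<^sub>v p) = p \<bullet> p"
proof -
  have "U * U\<^sup>T = 1\<^sub>m m" using mat_mult_left_right_inverse[of "U\<^sup>T" m U] U by simp
  then have "U *\<^sub>v (U\<^sup>T *\<^sub>v p) = p"
    using mult_mat_mult_vec[of U "U\<^sup>T" p] U p by (simp add: one_mat_mult_vec)
  then show ?thesis
    using scalar_prod_transpose_right[of "U\<^sup>T *\<^sub>v p" U p] U p by simp
qed

lemma append_vec_assoc: "(u @\<^sub>v v) @\<^sub>v w = u @\<^sub>v (v @\<^sub>v w)"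
  by (rule eq_vecI) auto

text \<open>Orthogonal triangularization separates the exactly known columns: for each \<open>y2, t\<close> the first
  \<open>n1\<close> rows can be made zero through the choice of \<open>y1\<close>, and the other rows do not see \<open>y1\<close>.\<close>

locale tls_qr = weighted_tls m "n1 + n2" A "tail_projection n1 n2" b
  for m n1 n2 :: nat and A :: "real mat" and b :: "real vec" +
  fixes U R11 R12 R22 :: "real mat" and R1b R2b :: "real vec"
  assumes ker: "dim_vec y = n1 + n2 \<Longrightarrow> A *\<^sub>v y = 0\<^sub>v m \<Longrightarrow> y = 0\<^sub>v (n1 + n2)"
    and n1_le: "n1 \<le> m"
    and U: "U \<in> carrier_mat m m" "U\<^sup>T * U = 1\<^sub>m m"
    and R11: "R11 \<in> carrier_mat n1 n1" and R12: "R12 \<in> carrier_mat n1 n2" and R1b: "R1b \<in> carrier_vec n1"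
    and R22: "R22 \<in> carrier_mat (m - n1) n2" and R2b: "R2b \<in> carrier_vec (m - n1)"
    and QR: "U\<^sup>T * (A @\<^sub>c col_mat b)
      = four_block_mat R11 (R12 @\<^sub>c col_mat R1b) (0\<^sub>m (m - n1) n1) (R22 @\<^sub>c col_mat R2b)"
begin

abbreviation "C \<equiv> R22 @\<^sub>c col_mat R2b"
abbreviation "T \<equiv> R12 @\<^sub>c col_mat R1b"

lemma qr_dims [simp]:
  "dim_row U = m" "dim_col U = m" "dim_row R11 = n1" "dim_col R11 = n1" "dim_row R12 = n1" "dim_col R12 = n2"
  "dim_vec R1b = n1" "dim_row R22 = m - n1" "dim_col R22 = n2" "dim_vec R2b = m - n1"
  using U R11 R12 R1b R22 R2b by auto

lemma C: "C \<in> carrier_mat (m - n1) (Suc n2)" and T: "T \<in> carrier_mat n1 (Suc n2)"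
  by (rule carrier_matI; simp)+

lemma qr_split:
  assumes [simp]: "dim_vec y1 = n1" "dim_vec y2 = n2"
  shows "(A *\<^sub>v (y1 @\<^sub>v y2) + t \<cdot>\<^sub>v b) \<bullet> (A *\<^sub>v (y1 @\<^sub>v y2) + t \<cdot>\<^sub>v b)
    = (R11 *\<^sub>v y1 + T *\<^sub>v (y2 @\<^sub>v vec 1 (\<lambda>_. t))) \<bullet> (R11 *\<^sub>v y1 + T *\<^sub>v (y2 @\<^sub>v vec 1 (\<lambda>_. t)))
      + (C *\<^sub>v (y2 @\<^sub>v vec 1 (\<lambda>_. t))) \<bullet> (C *\<^sub>v (y2 @\<^sub>v vec 1 (\<lambda>_. t)))"
proof -
  define z where "z = y2 @\<^sub>v vec 1 (\<lambda>_. t)"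
  have z: "z \<in> carrier_vec (Suc n2)" and y1: "y1 \<in> carrier_vec n1" by (auto simp: z_def intro: carrier_vecI)
  let ?p = "A *\<^sub>v (y1 @\<^sub>v y2) + t \<cdot>\<^sub>v b"
  have "?p = (A @\<^sub>c col_mat b) *\<^sub>v (y1 @\<^sub>v z)"
    unfolding z_def append_vec_assoc[symmetric] by (simp add: append_cols_mult_vec col_mat_mult_vec)
  then have "U\<^sup>T *\<^sub>v ?p = (U\<^sup>T * (A @\<^sub>c col_mat b)) *\<^sub>v (y1 @\<^sub>v z)"
    by (subst mult_mat_mult_vec) (simp_all add: z_def)
  also have "\<dots> = (R11 *\<^sub>v y1 + T *\<^sub>v z) @\<^sub>v (0\<^sub>m (m - n1) n1 *\<^sub>v y1 + C *\<^sub>v z)"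
    unfolding QR by (rule four_block_mat_mult_vec[OF R11 T zero_carrier_mat C y1 z])
  also have "0\<^sub>m (m - n1) n1 *\<^sub>v y1 + C *\<^sub>v z = C *\<^sub>v z"
    by (simp add: zero_mat_mult_vec) (auto intro!: eq_vecI)
  finally have "U\<^sup>T *\<^sub>v ?p = (R11 *\<^sub>v y1 + T *\<^sub>v z) @\<^sub>v (C *\<^sub>v z)" .
  then have "(U\<^sup>T *\<^sub>v ?p) \<bullet> (U\<^sup>T *\<^sub>v ?p)
      = (R11 *\<^sub>v y1 + T *\<^sub>v z) \<bullet> (R11 *\<^sub>v y1 + T *\<^sub>v z) + (C *\<^sub>v z) \<bullet> (C *\<^sub>v z)"
    by (simp only: vnorm_append_sq flip: vnorm_sq)
  moreover have "(U\<^sup>T *\<^sub>v ?p) \<bullet> (U\<^sup>T *\<^sub>v ?p) = ?p \<bullet> ?p"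
    by (rule orthogonal_transpose_isometry[OF U]) simp
  ultimately show ?thesis by (simp only: z_def)
qed

lemma R11_trivial_kernel:
  assumes y1: "dim_vec y1 = n1" and 0: "R11 *\<^sub>v y1 = 0\<^sub>v n1"
  shows "y1 = 0\<^sub>v n1"
proof -
  let ?y = "y1 @\<^sub>v 0\<^sub>v n2" and ?z = "0\<^sub>v n2 @\<^sub>v vec 1 (\<lambda>_. 0 :: real)"
  have z0: "?z = 0\<^sub>v (Suc n2)" by (rule eq_vecI) auto
  have M0: "M *\<^sub>v 0\<^sub>v (Suc n2) = 0\<^sub>v (dim_row M)" if "dim_col M = Suc n2" for M :: "real mat"
    using that by (intro eq_vecI) (auto simp: scalar_prod_def)
  have "A *\<^sub>v ?y + 0 \<cdot>\<^sub>v b = A *\<^sub>v ?y" by (rule eq_vecI) simp_all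
  then have "(A *\<^sub>v ?y) \<bullet> (A *\<^sub>v ?y) = 0"
    using qr_split[OF y1, of "0\<^sub>v n2" 0] y1 unfolding z0 by (simp add: M0 0 scalar_prod_def)
  then have "A *\<^sub>v ?y = 0\<^sub>v m" by (simp add: scalar_prod_self_eq_0)
  then have "?y = 0\<^sub>v (n1 + n2)" using y1 by (intro ker) simp_all
  also have "\<dots> = 0\<^sub>v n1 @\<^sub>v 0\<^sub>v n2" by (rule eq_vecI) auto
  finally show ?thesis using append_vec_eq[OF carrier_vecI[OF y1] zero_carrier_vec] by blast
qed

lemma det_R11: "det R11 \<noteq> 0"
  using det_0_iff_vec_prod_zero[OF R11] R11_trivial_kernel by auto

lemma R11_solvable:
  assumes "dim_vec p = n1"
  obtains y1 where "dim_vec y1 = n1" "R11 *\<^sub>v y1 + p = 0\<^sub>v n1"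
proof -
  obtain B where B: "B \<in> carrier_mat n1 n1" "R11 * B = 1\<^sub>m n1"
    using invertible_if_trivial_kernel[OF R11] R11_trivial_kernel by metis
  have "R11 *\<^sub>v (B *\<^sub>v (- p)) = - p"
    using mult_mat_mult_vec[of R11 B "- p"] B assms by (simp add: one_mat_mult_vec)
  then have "R11 *\<^sub>v (B *\<^sub>v (- p)) + p = 0\<^sub>v n1" using assms by (auto intro!: eq_vecI)
  then show thesis using that[of "B *\<^sub>v (- p)"] B by simp
qed

context
  fixes x :: "real vec"
  assumes x: "minimizer x"
begin

text \<open>Choose \<open>y1\<close> such that the first \<open>n1\<close> rows vanish, and apply minimality in homogeneous form.\<close>

lemma reduced_lower_bound:
  assumes z: "dim_vec z = Suc n2"
  shows "Q x * (z \<bullet> z) \<le> (C *\<^sub>v z) \<bullet> (C *\<^sub>v z)"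
proof -
  define y2 t where "y2 = vec_first z n2" and "t = vec_last z 1 $ 0"
  have [simp]: "dim_vec y2 = n2" by (simp add: y2_def)
  have "vec_last z 1 = vec 1 (\<lambda>_. t)" by (rule eq_vecI) (auto simp: t_def)
  then have z_eq: "z = y2 @\<^sub>v vec 1 (\<lambda>_. t)"
    using append_vec_first_last[of z n2 1] z by (simp add: y2_def)
  obtain y1 where [simp]: "dim_vec y1 = n1" and y1: "R11 *\<^sub>v y1 + T *\<^sub>v z = 0\<^sub>v n1"
    using R11_solvable[of "T *\<^sub>v z"] by auto
  let ?y = "y1 @\<^sub>v y2"
  have "z \<bullet> z = t\<^sup>2 + ?y \<bullet> (tail_projection n1 n2 *\<^sub>v ?y)"
  proof -
    have "vec 1 (\<lambda>_. t) \<bullet> vec 1 (\<lambda>_. t) = t\<^sup>2" by (simp add: scalar_prod_def power2_eq_square)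
    then have "z \<bullet> z = y2 \<bullet> y2 + t\<^sup>2"
      unfolding z_eq by (simp add: vnorm_append_sq flip: vnorm_sq)
    then show ?thesis by (simp add: tail_projection_form)
  qed
  then have "Q x * (z \<bullet> z) \<le> (A *\<^sub>v ?y + t \<cdot>\<^sub>v b) \<bullet> (A *\<^sub>v ?y + t \<cdot>\<^sub>v b)"
    using minimizer_homogeneous[OF x, of ?y t] by simp
  also have "\<dots> = (C *\<^sub>v z) \<bullet> (C *\<^sub>v z)"
    using qr_split[of y1 y2 t] by (simp add: y1 del: One_nat_def flip: z_eq)
  finally show ?thesis .
qed

text \<open>The vector \<open>(x2, -1)\<close> attains the bound, so the minimal value is the smallest eigenvalue.\<close>

lemma minimal_value_smallest_eigenvalue:
  "roots_desc (char_poly (C\<^sup>T * C)) ! n2 = Q x"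
proof -
  define x1 x2 where "x1 = vec_first x n1" and "x2 = vec_last x n2"
  have [simp]: "dim_vec x1 = n1" "dim_vec x2 = n2" by (simp_all add: x1_def x2_def)
  have x_eq: "x = x1 @\<^sub>v x2" using append_vec_first_last[of x n1 n2] x by (simp add: x1_def x2_def)
  define z where "z = x2 @\<^sub>v vec 1 (\<lambda>_. - 1 :: real)"
  have z_dim: "dim_vec z = Suc n2" by (simp add: z_def)
  have "vec 1 (\<lambda>_. - 1 :: real) \<bullet> vec 1 (\<lambda>_. - 1) = 1" by (simp add: scalar_prod_def)
  then have "z \<bullet> z = x2 \<bullet> x2 + 1"
    unfolding z_def by (simp add: vnorm_append_sq flip: vnorm_sq)
  then have zz: "z \<bullet> z = 1 + x \<bullet> (tail_projection n1 n2 *\<^sub>v x)"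
    unfolding x_eq by (simp add: tail_projection_form)
  have "A *\<^sub>v x + (- 1) \<cdot>\<^sub>v b = A *\<^sub>v x - b" by (rule eq_vecI) simp_all
  then have "(C *\<^sub>v z) \<bullet> (C *\<^sub>v z) \<le> (A *\<^sub>v x - b) \<bullet> (A *\<^sub>v x - b)"
    using qr_split[of x1 x2 "- 1"] scalar_prod_self_nonneg[of "R11 *\<^sub>v x1 + T *\<^sub>v z"]
    by (simp del: One_nat_def flip: x_eq z_def)
  also have "\<dots> = Q x * (z \<bullet> z)" using residual_sq[of x] x zz by simp
  finally have eq: "Q x * (z \<bullet> z) = (C *\<^sub>v z) \<bullet> (C *\<^sub>v z)"
    using reduced_lower_bound[OF z_dim] by simp
  have nz: "z \<noteq> 0\<^sub>v (Suc n2)"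
  proof
    assume "z = 0\<^sub>v (Suc n2)"
    then have "z $ n2 = 0" by simp
    then show False by (simp add: z_def)
  qed
  show ?thesis
    by (rule smallest_root_gram_eqI[OF C reduced_lower_bound z_dim nz eq])
qed

text \<open>A null vector of the semidefinite form of \<open>A\<^sup>T A - Q x \<cdot> W\<close> would make \<open>Q x\<close> an eigenvalue of
  \<open>R22\<^sup>T R22\<close>, below its smallest one.\<close>

lemma definite_of_gap:
  assumes gap: "n2 = 0 \<or> Q x < roots_desc (char_poly (R22\<^sup>T * R22)) ! (n2 - 1)"
    and h: "dim_vec h = n1 + n2"
    and null: "(A *\<^sub>v h) \<bullet> (A *\<^sub>v h) = Q x * (h \<bullet> (tail_projection n1 n2 *\<^sub>v h))"
  shows "h = 0\<^sub>v (n1 + n2)"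
proof -
  define h1 h2 where "h1 = vec_first h n1" and "h2 = vec_last h n2"
  have [simp]: "dim_vec h1 = n1" "dim_vec h2 = n2" by (simp_all add: h1_def h2_def)
  have h_eq: "h = h1 @\<^sub>v h2" using append_vec_first_last[OF h] by (simp add: h1_def h2_def)
  have z0: "M *\<^sub>v w + c *\<^sub>v vec 1 (\<lambda>_. 0) = M *\<^sub>v w"
    if "dim_row c = dim_row M" "dim_col c = 1" for M c :: "real mat" and w
    using that by (intro eq_vecI) (auto simp: scalar_prod_def)
  have low: "Q x * (w \<bullet> w) \<le> (R22 *\<^sub>v w) \<bullet> (R22 *\<^sub>v w)" if "dim_vec w = n2" for w
  proof -
    let ?z = "w @\<^sub>v vec 1 (\<lambda>_. 0 :: real)"
    have "vec 1 (\<lambda>_. 0 :: real) \<bullet> vec 1 (\<lambda>_. 0) = 0" by (simp add: scalar_prod_def)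
    then have "?z \<bullet> ?z = w \<bullet> w"
      by (simp add: vnorm_append_sq flip: vnorm_sq)
    then show ?thesis using reduced_lower_bound[of ?z] that by (simp add: append_cols_mult_vec z0 del: One_nat_def)
  qed
  have "A *\<^sub>v h + 0 \<cdot>\<^sub>v b = A *\<^sub>v h" using h by (intro eq_vecI) simp_all
  then have "(A *\<^sub>v h) \<bullet> (A *\<^sub>v h) = (R11 *\<^sub>v h1 + R12 *\<^sub>v h2) \<bullet> (R11 *\<^sub>v h1 + R12 *\<^sub>v h2) + (R22 *\<^sub>v h2) \<bullet> (R22 *\<^sub>v h2)"
    using qr_split[of h1 h2 0] by (simp add: append_cols_mult_vec z0 del: One_nat_def flip: h_eq)
  moreover have "h \<bullet> (tail_projection n1 n2 *\<^sub>v h) = h2 \<bullet> h2"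
    unfolding h_eq by (simp add: tail_projection_form)
  ultimately have top: "(R11 *\<^sub>v h1 + R12 *\<^sub>v h2) \<bullet> (R11 *\<^sub>v h1 + R12 *\<^sub>v h2) = 0"
    and eq: "Q x * (h2 \<bullet> h2) = (R22 *\<^sub>v h2) \<bullet> (R22 *\<^sub>v h2)"
    using null low[of h2] scalar_prod_self_nonneg[of "R11 *\<^sub>v h1 + R12 *\<^sub>v h2"] by simp_all
  have h2: "h2 = 0\<^sub>v n2"
  proof (rule ccontr)
    assume nz: "h2 \<noteq> 0\<^sub>v n2"
    then have "n2 \<noteq> 0" by (auto intro!: eq_vecI)
    then obtain k where k: "n2 = Suc k" by (cases n2) auto
    have "R22\<^sup>T *\<^sub>v (R22 *\<^sub>v h2) = Q x \<cdot>\<^sub>v h2"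
      by (rule gram_eigenvector_of_minimizer) (simp_all add: low eq)
    then have "poly (char_poly (R22\<^sup>T * R22)) (Q x) = 0"
      using root_gram_iff[OF R22] nz by (intro iffD2[OF root_gram_iff[OF R22]] exI[of _ h2]) simp
    then have "roots_desc (char_poly (R22\<^sup>T * R22)) ! k \<le> Q x"
      using smallest_root_gram(2)[of R22 "m - n1" k] R22 k by simp
    then show False using gap k by simp
  qed
  have "R11 *\<^sub>v h1 + R12 *\<^sub>v h2 = 0\<^sub>v n1" using top by (simp add: scalar_prod_self_eq_0)
  moreover have "R12 *\<^sub>v h2 = 0\<^sub>v n1" unfolding h2 by (rule eq_vecI) (auto simp: scalar_prod_def)
  ultimately have "R11 *\<^sub>v h1 = 0\<^sub>v n1" 
    using right_zero_vec[OF carrier_vecI[of "R11 *\<^sub>v h1" n1]] by simp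
  then have "h1 = 0\<^sub>v n1" by (rule R11_trivial_kernel[rotated]) simp
  then have "h = 0\<^sub>v n1 @\<^sub>v 0\<^sub>v n2" using h_eq h2 by simp
  also have "\<dots> = 0\<^sub>v (n1 + n2)" by (rule eq_vecI) auto
  finally show ?thesis .
qed

end

subsection \<open>The two genericity conditions\<close>

lemma G1_gap:
  assumes "mtls_G1 n2 R22 R2b"
  shows "n2 = 0 \<or> roots_desc (char_poly (C\<^sup>T * C)) ! n2 < roots_desc (char_poly (R22\<^sup>T * R22)) ! (n2 - 1)"
proof (cases n2)
  case (Suc k)
  then have "sing_val (Suc n2) C < sing_val (Suc k) R22" using assms by (simp add: mtls_G1_def)
  then show ?thesis
    using sing_val_last[OF C] sing_val_last[of R22 "m - n1" k] R22 Suc by simp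
qed simp

text \<open>The first \<open>n1\<close> generalized eigenvalues are infinite, so an index \<open>n1 + Suc j\<close> refers to the finite
  ones.\<close>

lemma gen_eigval_block_triangular:
  assumes T': "T' \<in> carrier_mat n1 l" and C': "C' \<in> carrier_mat p l" and j: "j < l"
  defines "S \<equiv> four_block_mat R11 T' (0\<^sub>m p n1) C'"
  shows "gen_eigval (n1 + Suc j) (S\<^sup>T * S) (tail_projection n1 l) = ereal (roots_desc (char_poly (C'\<^sup>T * C')) ! j)"
proof -
  let ?p = "char_poly (C'\<^sup>T * C')" and ?c = "(- 1) ^ n1 * (det R11)\<^sup>2"
  have c: "?c \<noteq> 0" using det_R11 by simp
  have pen: "pencil_poly (S\<^sup>T * S) (tail_projection n1 l) = Polynomial.smult ?c ?p"
    unfolding S_def tail_projection_def by (rule pencil_poly_block_triangular[OF R11 T' C'])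
  have deg: "degree ?p = l" using degree_monic_char_poly[OF gram_carrier[OF C']] by simp
  have row: "dim_row (S\<^sup>T * S) = n1 + l" using C' by (simp add: S_def)
  have len: "length (roots_desc ?p) = l" by (rule length_roots_desc_gram[OF C'])
  have roots: "roots_desc (Polynomial.smult ?c ?p) = roots_desc ?p"
    using c unfolding roots_desc_def by (subst proots_smult) simp_all
  have "degree (Polynomial.smult ?c ?p) = l" using c deg by (subst degree_smult_eq) simp
  then show ?thesis
    unfolding gen_eigval_def pen row roots using len j by (simp add: nth_append)
qed

lemma QR_left: "U\<^sup>T * A = four_block_mat R11 R12 (0\<^sub>m (m - n1) n1) R22"
proof (rule eq_matI)
  fix i j
  assume "i < dim_row (four_block_mat R11 R12 (0\<^sub>m (m - n1) n1) R22)"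
    "j < dim_col (four_block_mat R11 R12 (0\<^sub>m (m - n1) n1) R22)"
  then have i: "i < m" and j: "j < n1 + n2" using n1_le by simp_all
  have "(U\<^sup>T * A) $$ (i, j) = (U\<^sup>T * (A @\<^sub>c col_mat b)) $$ (i, j)"
    using i j by (simp add: scalar_prod_def)
  also have "\<dots> = four_block_mat R11 R12 (0\<^sub>m (m - n1) n1) R22 $$ (i, j)"
    unfolding QR using i j n1_le by (auto simp: less_diff_conv2)
  finally show "(U\<^sup>T * A) $$ (i, j) = four_block_mat R11 R12 (0\<^sub>m (m - n1) n1) R22 $$ (i, j)" .
qed (use n1_le in simp_all)

lemma gram_QR:
  assumes "dim_row M = m"
  shows "(U\<^sup>T * M)\<^sup>T * (U\<^sup>T * M) = M\<^sup>T * M"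
proof -
  have M: "M \<in> carrier_mat m (dim_col M)" using assms by (intro carrier_matI) simp_all
  have "U * U\<^sup>T = 1\<^sub>m m" using mat_mult_left_right_inverse[of "U\<^sup>T" m U] U by simp
  then have "U * (U\<^sup>T * M) = M"
    using assoc_mult_mat[OF U(1) _ M, of "U\<^sup>T"] U left_mult_one_mat[OF M] by simp
  moreover have "(U\<^sup>T * M)\<^sup>T = M\<^sup>T * U"
    using assms by (subst transpose_mult_dim) simp_all
  moreover have "(M\<^sup>T * U) * (U\<^sup>T * M) = M\<^sup>T * (U * (U\<^sup>T * M))"
  proof (rule assoc_mult_mat)
    show "M\<^sup>T \<in> carrier_mat (dim_col M) m" "U\<^sup>T * M \<in> carrier_mat m (dim_col M)"
      by (rule carrier_matI; simp add: assms)+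
  qed (rule U)
  ultimately show ?thesis by simp
qed

lemma G2_gap:
  assumes "mtls_G2 (n1 + n2) A b (tail_projection n1 n2)"
  shows "n2 = 0 \<or> roots_desc (char_poly (C\<^sup>T * C)) ! n2 < roots_desc (char_poly (R22\<^sup>T * R22)) ! (n2 - 1)"
proof (cases n2)
  case (Suc k)
  let ?A' = "A @\<^sub>c col_mat b"
  have W': "diag_block_mat [tail_projection n1 n2, 1\<^sub>m 1] = tail_projection n1 (Suc n2)"
    unfolding tail_projection_def diag_block_zero_one diag_block_mat.simps Let_def
    by (rule eq_matI) auto
  have "gen_eigval (n1 + n2) (A\<^sup>T * A) (tail_projection n1 n2) = ereal (roots_desc (char_poly (R22\<^sup>T * R22)) ! k)"
    using gen_eigval_block_triangular[OF R12 R22, of k] gram_QR[of A] Suc by (simp flip: QR_left)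
  moreover have "gen_eigval (Suc (n1 + n2)) (?A'\<^sup>T * ?A') (tail_projection n1 (Suc n2))
      = ereal (roots_desc (char_poly (C\<^sup>T * C)) ! n2)"
    using gen_eigval_block_triangular[OF T C, of n2] gram_QR[of ?A'] by (simp flip: QR)
  ultimately show ?thesis using assms Suc unfolding mtls_G2_def Let_def W' by simp
qed simp

end

section \<open>The condition number\<close>

theorem theorem3:
  fixes m n n1 n2 :: nat
    and A A1 A2 Q R11 R12 R22 W P P' H0 K :: "real mat"
    and b x r R1b R2b :: "real vec"
    and \<kappa> \<sigma> \<gamma> \<gamma>' \<beta> :: real
  defines "n \<equiv> n1 + n2"
    and "A \<equiv> A1 @\<^sub>c A2"
    and "W \<equiv> diag_block_mat [0\<^sub>m n1 n1, 1\<^sub>m n2]"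
    and "\<sigma> \<equiv> sing_val (n2 + 1) (R22 @\<^sub>c col_mat R2b)"
    and "r \<equiv> A *\<^sub>v x - b"
    and "P \<equiv> A\<^sup>T * A - \<sigma>\<^sup>2 \<cdot>\<^sub>m W"
    and "P' \<equiv> mat_inv P"
    and "H0 \<equiv> 1\<^sub>m m - (2 / (vnorm r)\<^sup>2) \<cdot>\<^sub>m outer_prod r r"
    and "\<gamma> \<equiv> 1 + (vnorm x)\<^sup>2"
    and "\<gamma>' \<equiv> 1 + x \<bullet> (W *\<^sub>v x)"
    and "K \<equiv> - (P' * (A\<^sup>T * H0 * (mat_of_row (x @\<^sub>v vec 1 (\<lambda>_. - 1)) \<otimes>\<^sub>K 1\<^sub>m m)
                       + ((1\<^sub>m n \<otimes>\<^sub>K mat_of_row r) @\<^sub>c 0\<^sub>m n m)))"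
    and "\<kappa> \<equiv> spectral_norm K"
  assumes A1: "A1 \<in> carrier_mat m n1"
    and A2: "A2 \<in> carrier_mat m n2"
    and b: "b \<in> carrier_vec m"
    and mn: "m \<ge> n"
    and full_rank: "vec_space.rank m A = n"
    and inconsistent: "\<not> (\<exists>y \<in> carrier_vec n. A *\<^sub>v y = b)"
    and Q: "Q \<in> carrier_mat m m" "Q\<^sup>T * Q = 1\<^sub>m m"
    and R11: "R11 \<in> carrier_mat n1 n1"
    and R12: "R12 \<in> carrier_mat n1 n2"
    and R1b: "R1b \<in> carrier_vec n1"
    and R22: "R22 \<in> carrier_mat (m - n1) n2"
    and R2b: "R2b \<in> carrier_vec (m - n1)"
    and QR: "Q\<^sup>T * (A @\<^sub>c col_mat b)
             = four_block_mat R11 (R12 @\<^sub>c col_mat R1b) (0\<^sub>m (m - n1) n1) (R22 @\<^sub>c col_mat R2b)"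
    and upper: "\<And>i j. i < m \<Longrightarrow> j < n + 1 \<Longrightarrow> j < i \<Longrightarrow> (Q\<^sup>T * (A @\<^sub>c col_mat b)) $$ (i, j) = 0"
    and generic: "mtls_G1 n2 R22 R2b \<or> mtls_G2 n A b W"
    and x: "mtls_solution A1 A2 b x"
    and \<beta>: "\<beta> = - 1 + sqrt (1 + (vnorm x)\<^sup>2) \<or> \<beta> = - 1 - sqrt (1 + (vnorm x)\<^sup>2)"
  shows "invertible_mat P \<and>
    mtls_frechet A1 A2 b K \<and>
    \<kappa> =
      sqrt (spectral_norm (P' * (\<gamma> \<cdot>\<^sub>m (A\<^sup>T * A) - A\<^sup>T * outer_prod r x - outer_prod x r * A
                                  + (vnorm r)\<^sup>2 \<cdot>\<^sub>m 1\<^sub>m n) * P')) \<and>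
    \<kappa> =
      sqrt \<gamma> * sqrt (spectral_norm
        (P' * (A\<^sup>T * A + (\<sigma>\<^sup>2 * \<gamma>' / \<gamma>) \<cdot>\<^sub>m
                 (1\<^sub>m n - (1 / \<gamma>') \<cdot>\<^sub>m (W * outer_prod x x + outer_prod x x * W))) * P')) \<and>
    \<kappa> =
      spectral_norm (P' *
        (A\<^sup>T @\<^sub>c
         (vnorm x \<cdot>\<^sub>m A\<^sup>T - (vnorm x * \<sigma>\<^sup>2 / (vnorm r)\<^sup>2) \<cdot>\<^sub>m (W * outer_prod x r)) @\<^sub>c
         (vnorm r \<cdot>\<^sub>m 1\<^sub>m n - (\<sigma>\<^sup>2 / vnorm r) \<cdot>\<^sub>m (W * outer_prod x x)))) \<and>
    \<kappa> =
      spectral_norm (P' *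
        (((1 + \<beta>) \<cdot>\<^sub>m A\<^sup>T - (\<beta> * \<sigma>\<^sup>2 / (vnorm r)\<^sup>2) \<cdot>\<^sub>m (W * outer_prod x r)) @\<^sub>c
         (vnorm r \<cdot>\<^sub>m 1\<^sub>m n - (\<sigma>\<^sup>2 / vnorm r) \<cdot>\<^sub>m (W * outer_prod x x))))"
proof -
  have [simp]: "dim_row A1 = m" "dim_col A1 = n1" "dim_row A2 = m" "dim_col A2 = n2" "dim_vec b = m"
    using A1 A2 b by auto
  have W_eq: "W = tail_projection n1 n2" by (simp only: W_def tail_projection_def)
  have A: "A \<in> carrier_mat m n" unfolding A_def n_def by (rule carrier_matI) simp_all
  have W_carrier: "tail_projection n1 n2 \<in> carrier_mat (n1 + n2) (n1 + n2)" by (rule carrier_matI) simp_all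
  have W_sym: "(tail_projection n1 n2)\<^sup>T = tail_projection n1 n2"
    unfolding tail_projection_def diag_block_zero_one by (rule eq_matI) auto
  have W_idem: "tail_projection n1 n2 * tail_projection n1 n2 = tail_projection n1 n2"
    unfolding tail_projection_def diag_block_zero_one
    by (subst mult_four_block_mat[OF zero_carrier_mat zero_carrier_mat zero_carrier_mat one_carrier_mat
        zero_carrier_mat zero_carrier_mat zero_carrier_mat one_carrier_mat]) simp
  interpret tls_qr m n1 n2 A b Q R11 R12 R22 R1b R2b
  proof unfold_locales
    show "A \<in> carrier_mat m (n1 + n2)" using A by (simp only: n_def)
    show "y = 0\<^sub>v (n1 + n2)" if "dim_vec y = n1 + n2" "A *\<^sub>v y = 0\<^sub>v m" for y
      using full_rank_trivial_kernel[OF A full_rank] that by (simp add: n_def)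
    show "n1 \<le> m" using mn by (simp add: n_def)
  qed (fact b W_carrier W_sym W_idem Q R11 R12 R1b R22 R2b QR)+
  have x_min: "minimizer x"
    using x unfolding mtls_solution_iff[OF A1 A2 b] A_def .
  then have x_dim[simp]: "dim_vec x = n1 + n2" by simp
  let ?Q = "wtls_quotient A b (tail_projection n1 n2) x"
  have \<sigma>: "\<sigma>\<^sup>2 = ?Q"
    using sing_val_last[OF C] minimal_value_smallest_eigenvalue[OF x_min] Q_nonneg[of x]
    by (simp add: \<sigma>_def)
  have gap: "n2 = 0 \<or> ?Q < roots_desc (char_poly (R22\<^sup>T * R22)) ! (n2 - 1)"
    using generic G1_gap G2_gap minimal_value_smallest_eigenvalue[OF x_min] by (auto simp: W_eq n_def)
  have P: "P \<in> carrier_mat (n1 + n2) (n1 + n2)"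
    unfolding P_def W_eq by (rule carrier_matI) simp_all
  have P_mult: "P *\<^sub>v v = A\<^sup>T *\<^sub>v (A *\<^sub>v v) - ?Q \<cdot>\<^sub>v (tail_projection n1 n2 *\<^sub>v v)" if "dim_vec v = n1 + n2" for v
    using that unfolding P_def W_eq \<sigma> by (simp add: mult_mat_vec_linear)
  have P_bilinear: "u \<bullet> (P *\<^sub>v v) = (A *\<^sub>v u) \<bullet> (A *\<^sub>v v) - ?Q * (u \<bullet> (tail_projection n1 n2 *\<^sub>v v))"
    if "dim_vec u = n1 + n2" "dim_vec v = n1 + n2" for u v
    using that by (simp add: P_mult scalar_prod_linear scalar_prod_transpose_right)
  have "v = 0\<^sub>v (n1 + n2)" if v: "dim_vec v = n1 + n2" and "P *\<^sub>v v = 0\<^sub>v (n1 + n2)" for v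
  proof (rule definite_of_gap[OF x_min gap v])
    have "v \<bullet> (P *\<^sub>v v) = 0" using that by (simp add: scalar_prod_def)
    then show "(A *\<^sub>v v) \<bullet> (A *\<^sub>v v) = ?Q * (v \<bullet> (tail_projection n1 n2 *\<^sub>v v))"
      unfolding P_bilinear[OF v v] by simp
  qed
  then obtain B where B: "B \<in> carrier_mat (n1 + n2) (n1 + n2)" "P * B = 1\<^sub>m (n1 + n2)" "B * P = 1\<^sub>m (n1 + n2)"
    using invertible_if_trivial_kernel[OF P] by metis
  have invertible: "invertible_mat P"
    unfolding invertible_mat_def inverts_mat_def using P B by (auto intro!: exI[of _ B])
  have P': "P' \<in> carrier_mat (n1 + n2) (n1 + n2)" "P * P' = 1\<^sub>m (n1 + n2)" "P' * P = 1\<^sub>m (n1 + n2)"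
  proof -
    have "P \<in> Units (ring_mat TYPE(real) (n1 + n2) ())"
      using P B by (auto simp: Units_def ring_mat_def)
    then obtain B' where "mat_inverse P = Some B'"
      using mat_inverse(1)[OF P, of "()"] by (cases "mat_inverse P") auto
    then show "P' \<in> carrier_mat (n1 + n2) (n1 + n2)" "P * P' = 1\<^sub>m (n1 + n2)" "P' * P = 1\<^sub>m (n1 + n2)"
      using mat_inverse(2)[OF P] by (simp_all add: P'_def mat_inv_def)
  qed
  have P'_sym: "P'\<^sup>T = P'"
  proof -
    have "P\<^sup>T = P"
      unfolding P_def W_eq by (simp add: transpose_linear transpose_mult_dim W_sym)
    then have "P'\<^sup>T * P = 1\<^sub>m (n1 + n2)"
      using P'(2) P P'(1) transpose_mult_dim[of P P'] by simp
    then have "P'\<^sup>T * P * P' = P'" using P' by simp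
    moreover have "P'\<^sup>T * P * P' = P'\<^sup>T * (P * P')"
      by (rule assoc_mult_mat[of _ "n1 + n2" "n1 + n2"]) (use P P' in auto)
    ultimately show ?thesis using P' by simp
  qed
  obtain c where c: "0 < c" "\<And>h. dim_vec h = n1 + n2 \<Longrightarrow> c * (h \<bullet> h) \<le> h \<bullet> (P *\<^sub>v h)"
  proof (rule semidefinite_invertible_lower_bound[OF P B(1,2)])
    show "u \<bullet> (P *\<^sub>v v) = v \<bullet> (P *\<^sub>v u)" if "dim_vec u = n1 + n2" "dim_vec v = n1 + n2" for u v
      using that W_commute[OF that] scalar_prod_comm[of "A *\<^sub>v u" "A *\<^sub>v v"] by (simp add: P_bilinear)
    show "0 \<le> v \<bullet> (P *\<^sub>v v)" if "dim_vec v = n1 + n2" for v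
      using minimizer_stationary(2)[OF x_min that] by (simp add: P_bilinear that)
  qed blast
  interpret opt: tls_minimizer m "n1 + n2" A "tail_projection n1 n2" b x c
    using x_min c P_bilinear by unfold_locales auto
  have r_nz: "(A *\<^sub>v x - b) \<bullet> (A *\<^sub>v x - b) \<noteq> 0"
  proof
    assume "(A *\<^sub>v x - b) \<bullet> (A *\<^sub>v x - b) = 0"
    then have "A *\<^sub>v x - b = 0\<^sub>v m" by (simp add: scalar_prod_self_eq_0)
    then have "(A *\<^sub>v x - b) $ i = 0" if "i < m" for i using that by simp
    then have "A *\<^sub>v x = b" by (intro eq_vecI) simp_all
    moreover have "x \<in> carrier_vec n" unfolding n_def by (rule carrier_vecI) (rule x_dim)
    ultimately show False using inconsistent by blast
  qed
  have K_eq: "K = - (P' * opt.derivative_factor)"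
    unfolding K_def opt.derivative_factor_def H0_def householder_def r_def n_def by simp
  have frechet: "mtls_frechet A1 A2 b K"
    unfolding K_eq using A1 A2 A_def P'(1,3) r_nz
    by (intro opt.minimizer_frechet[where ?n1.0 = n1 and ?n2.0 = n2]) (simp_all add: P_def W_eq \<sigma>)
  show ?thesis
    unfolding \<kappa>_def K_eq
    using invertible frechet[unfolded K_eq] opt.condition_number_1[OF P'(1) P'_sym r_nz] opt.condition_number_2[OF P'(1) P'_sym r_nz]
      opt.condition_number_3[OF P'(1) P'_sym r_nz] opt.condition_number_4[OF P'(1) P'_sym r_nz \<beta>]
    unfolding \<sigma> \<gamma>_def \<gamma>'_def r_def n_def W_eq by blast
qed

end
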